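(* Let $(M,g)$ be a compact oriented Riemannian manifold of dimension $m=3$ (boundary possibly empty), let $\mathcal N\subset M$ be a $2$-dimensional closed hypersurface with $\mathcal N\cap\partial M=\emptyset$, and let $\Delta_M=-(\operatorname{Tr}\nabla^2+E)$ be a Laplacian on a vector bundle $\mathcal E\to M$ of rank $r_0$. Let $R(\lambda)$ be the associated Dirichlet-to-Neumann operator on $\mathcal N$, and for $p\in\mathcal N$ let $J_2(s,p)$ be the function of $s$ built from the homogeneous symbol of the resolvent of $R(\lambda)$ (with $\lambda$ a parameter of weight $2$) as defined in the context. Then for each $p\in\mathcal N$ the densities $q_2(p)=\frac12 J_2(s,p)\big|_{s=0}$ and $\pi_2(p)=-\frac{\partial}{\partial s}\big|_{s=0}J_2(s,p)$ are given by $$q_2(p)=\frac12\, r_0\left\{\frac{\tau_M(p)}{32\pi}+\frac{\tau_{\mathcal N}(p)}{96\pi}-\frac{H_1^2(p)}{32\pi}+\frac{H_2(p)}{32\pi}\right\}+\frac1{8\pi}\operatorname{Tr}E(p),$$ $$\pi_2(p)=r_0\left\{\left(\frac{\tau_M(p)}{32\pi}+\frac{\tau_{\mathcal N}(p)}{96\pi}-\frac{H_1^2(p)}{32\pi}+\frac{H_2(p)}{32\pi}\right)\ln 2-\frac1{64\pi}\big(\tau_M(p)-\tau_{\mathcal N}(p)\big)-\frac{3H_1^2(p)}{128\pi}+\frac{5H_2(p)}{128\pi}\right\}+\frac{\ln 2}{4\pi}\operatorname{Tr}E(p).$$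
   Context: Setting. A unit normal field $\partial_{x_m}$ along $\mathcal N$ is fixed ($m=3$). $M_0$ is the compact Riemannian manifold with boundary $\partial M\cup\mathcal N^+\cup\mathcal N^-$ obtained by cutting $M$ along $\mathcal N$ ($\mathcal N^\pm$ are copies of $\mathcal N$; $\partial_{x_m}$ points outward on $\mathcal N^+$ and inward on $\mathcal N^-$). $\mathcal E$ carries an inner product. A Laplacian is a non-negative symmetric second order differential operator on sections of $\mathcal E$ with principal symbol $|\xi|^2\operatorname{Id}$, with Dirichlet condition on $\partial M$ if $\partial M\ne\emptyset$; it can be written $\Delta_M=-(\operatorname{Tr}\nabla^2+E)$ with a connection $\nabla$ on $\mathcal E$ and a bundle endomorphism $E$, i.e. locally $\Delta_M\phi=-\sum_{i,j} g^{ij}(\nabla_{\partial_i}\nabla_{\partial_j}\phi-\nabla_{\nabla^{LC}_{\partial_i}\partial_j}\phi)-E\phi$. Dirichlet-to-Neumann operator. For $\lambda\ge0$ and $f\in C^\infty(\mathcal E|_{\mathcal N})$ let $\psi$ on $M_0$ solve $(\Delta_M+\lambda)\psi=0$, $\psi|_{\mathcal N^+}=\psi|_{\mathcal N^-}=f$, $\psi|_{\partial M}=0$; then $R(\lambda)f=(\nabla_{\partial_{x_m}}\psi)|_{\mathcal N^+}-(\nabla_{\partial_{x_m}}\psi)|_{\mathcal N^-}$. Curvatures. $\tau_M$, $\tau_{\mathcal N}$ are the scalar curvatures of $M$ and of $\mathcal N$ (induced metric), positive on round spheres. $\kappa_1,\kappa_2$ are the eigenvalues of the shape operator $S(X)=-\nabla^{LC}_X\partial_{x_m}$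 of $\mathcal N$; $H_1=\frac12(\kappa_1+\kappa_2)$, $H_2=\kappa_1\kappa_2$. Coordinates. Near $p$ use boundary normal coordinates $(x,x_m)=(x_1,x_2,x_3)$: $x$ are geodesic normal coordinates of $\mathcal N$ centred at $p$ (with coordinate directions at $p$ principal directions) and $x_m$ is arclength along the geodesics leaving $\mathcal N$ in direction $\partial_{x_m}$, so $g=\sum_{\alpha,\beta=1}^{2}g_{\alpha\beta}(x,x_m)dx^\alpha dx^\beta+(dx^m)^2$. Greek indices run over $1,2$; $|g|=\det(g_{\alpha\beta})$; $\omega_j$ are the connection matrices of $\nabla$ in a fixed local frame, $\nabla_{\partial_{x_j}}=\partial_{x_j}+\omega_j$. Put $|\xi|^2=\sum g^{\alpha\beta}(x,x_m)\xi_\alpha\xi_\beta$, $A=-\frac12\sum g^{\alpha\beta}\partial_{x_m}g_{\alpha\beta}$, $D_x=\frac1i\partial_x$, $p_1=-i\sum_{\alpha,\beta}\big(\tfrac12g^{\alpha\beta}\partial_{x_\alpha}\ln|g|+\partial_{x_\alpha}g^{\alpha\beta}\big)\xi_\beta-2i\sum_{\alpha,\beta} g^{\alpha\beta}\omega_\alpha\xi_\beta$, $p_0=-\sum_{\alpha,\beta} g^{\alpha\beta}\big(\partial_{x_\alpha}\omega_\beta+\omega_\alpha\omega_\beta-\sum_\gamma\Gamma^\gamma_{\alpha\beta}\omega_\gamma\big)-E$. Symbols ($\lambda$ has weight 2; products such as $\partial_\xi a\,\partial_x b$ mean $\sum_\alpha\partial_{\xi_\alpha}a\,\partial_{x_\alpha}b$;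 scalar terms are multiplied by $\operatorname{Id}$): $\alpha_1=\beta_1=\sqrt{|\xi|^2+\lambda}$, $\alpha_0=\frac1{2\alpha_1}\{p_1+A\alpha_1+i\,\partial_\xi\alpha_1\partial_x\alpha_1-\partial_{x_m}\alpha_1\}$, $\beta_0=\frac1{2\alpha_1}\{p_1-A\alpha_1+i\,\partial_\xi\alpha_1\partial_x\alpha_1+\partial_{x_m}\alpha_1\}$, $\alpha_{-1}=\frac1{2\alpha_1}\{\sum_{|\omega|=2}\frac1{\omega!}\partial_\xi^\omega\alpha_1\partial_x^\omega\alpha_1+i\partial_\xi\alpha_0\partial_x\alpha_1+i\partial_\xi\alpha_1\partial_x\alpha_0-\alpha_0^2+p_0+A\alpha_0-\partial_{x_m}\alpha_0+\alpha_0\omega_m-\omega_m\alpha_0\}$, $\beta_{-1}=\frac1{2\alpha_1}\{\sum_{|\omega|=2}\frac1{\omega!}\partial_\xi^\omega\beta_1\partial_x^\omega\beta_1+i\partial_\xi\beta_0\partial_x\beta_1+i\partial_\xi\beta_1\partial_x\beta_0-\beta_0^2+p_0-A\beta_0+\partial_{x_m}\beta_0-\beta_0\omega_m+\omega_m\beta_0\}$ (here $\omega$ as a summation index is a multi-index). At $x_m=0$ put $\theta_j=\alpha_j+\beta_j$ for $j=1,0,-1$; $\theta_1+\theta_0+\theta_{-1}+\cdots$ is the homogeneous symbol of $R(\lambda)$. The first terms of the symbol of $(\mu-R(\lambda))^{-1}$ are $r_{-1}=(\mu-\theta_1)^{-1}$, $r_{-2}=r_{-1}\{\partial_\xi\theta_1\cdot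 D_xr_{-1}+\theta_0r_{-1}\}$, and $r_{-3}=r_{-1}\{\sum_{|\omega|=2}\frac1{\omega!}\partial_\xi^\omega\theta_1D_x^\omega r_{-1}+\partial_\xi\theta_1\cdot D_xr_{-2}+\partial_\xi\theta_0\cdot D_xr_{-1}+\theta_0r_{-2}+\theta_{-1}r_{-1}\}$. Definition of $J_2$: $$J_2(s,p)=\frac1{(2\pi)^2}\int_{T_p^*\mathcal N}\frac1{2\pi i}\int_\gamma\mu^{-s}\operatorname{Tr}r_{-3}(p,\xi,\lambda=1,\mu)\,d\mu\,d\xi$$ for $\operatorname{Re}s$ large, continued meromorphically to $s=0$, where $\gamma$ is a counterclockwise contour in $\mathbb C\setminus(-\infty,0]$ enclosing $2\sqrt{|\xi|^2+1}$. (These densities integrate over $\mathcal N$ to the coefficients $q_2$ of $\ln\lambda$ and $\pi_2$ of $\lambda^0$ in the expansion of the logarithm of the zeta-determinant $\ln\operatorname{Det}R(\lambda)$ as $\lambda\to\infty$.) *)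

theory Defs
  imports "HOL-Analysis.Analysis" "HOL-Complex_Analysis.Complex_Analysis"
begin

section \<open>Smooth functions and coordinate calculus\<close>

primrec times_cont_diff_on ::
  "nat \<Rightarrow> ('a::euclidean_space \<Rightarrow> 'b::real_normed_vector) \<Rightarrow> 'a set \<Rightarrow> bool" where
  "times_cont_diff_on 0 f U \<longleftrightarrow> continuous_on U f"
| "times_cont_diff_on (Suc k) f U \<longleftrightarrow>
     f differentiable_on U \<and> (\<forall>v. times_cont_diff_on k (\<lambda>x. frechet_derivative f (at x) v) U)"

text \<open>Smoothness on an arbitrary set is the local existence of smooth extensions to open sets.
  This covers relatively open subsets of a half-space and submanifolds.\<close>

definition smooth_on :: "('a::euclidean_space \<Rightarrow> 'b::real_normed_vector) \<Rightarrow> 'a set \<Rightarrow> bool" where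
  "smooth_on f S \<longleftrightarrow> (\<forall>x\<in>S. \<exists>U F. open U \<and> x \<in> U \<and> (\<forall>k. times_cont_diff_on k F U) \<and>
     (\<forall>y\<in>U \<inter> S. F y = f y))"

definition pd :: "'n \<Rightarrow> (real^'n \<Rightarrow> 'b::real_normed_vector) \<Rightarrow> real^'n \<Rightarrow> 'b" where
  "pd i f x = vector_derivative (\<lambda>t. f (x + t *\<^sub>R axis i 1)) (at 0)"

definition christoffel :: "(real^'n \<Rightarrow> real^'n^'n) \<Rightarrow> 'n \<Rightarrow> 'n \<Rightarrow> 'n \<Rightarrow> real^'n \<Rightarrow> real" where
  "christoffel G k i j x = 1/2 * (\<Sum>l\<in>UNIV. matrix_inv (G x) $ k $ l *
     (pd i (\<lambda>y. G y $ l $ j) x + pd j (\<lambda>y. G y $ l $ i) x - pd l (\<lambda>y. G y $ i $ j) x))"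

text \<open>\<open>riemann G l k i j\<close> is the component along the \<open>l\<close>-th coordinate field of
  \<open>R(\<partial>\<^sub>i, \<partial>\<^sub>j) \<partial>\<^sub>k\<close> for \<open>R(X, Y) = [\<nabla>\<^sub>X, \<nabla>\<^sub>Y] - \<nabla>\<^bsub>[X, Y]\<^esub>\<close>; with the contraction in
  \<open>ricci\<close> the scalar curvature of a round sphere is positive.\<close>

definition riemann ::
  "(real^'n \<Rightarrow> real^'n^'n) \<Rightarrow> 'n \<Rightarrow> 'n \<Rightarrow> 'n \<Rightarrow> 'n \<Rightarrow> real^'n \<Rightarrow> real" where
  "riemann G l k i j x = pd i (christoffel G l j k) x - pd j (christoffel G l i k) x +
     (\<Sum>p\<in>UNIV. christoffel G l i p x * christoffel G p j k x -
                 christoffel G l j p x * christoffel G p i k x)"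

definition ricci :: "(real^'n \<Rightarrow> real^'n^'n) \<Rightarrow> 'n \<Rightarrow> 'n \<Rightarrow> real^'n \<Rightarrow> real" where
  "ricci G k j x = (\<Sum>i\<in>UNIV. riemann G i k i j x)"

definition scalar_curvature :: "(real^'n \<Rightarrow> real^'n^'n) \<Rightarrow> real^'n \<Rightarrow> real" where
  "scalar_curvature G x = (\<Sum>k\<in>UNIV. \<Sum>j\<in>UNIV. matrix_inv (G x) $ k $ j * ricci G k j x)"

definition levi_civita ::
  "(real^'n \<Rightarrow> real^'n^'n) \<Rightarrow> real^'n \<Rightarrow> (real^'n \<Rightarrow> real^'n) \<Rightarrow> real^'n \<Rightarrow> real^'n" where
  "levi_civita G X V x = (\<chi> k. (\<Sum>i\<in>UNIV. X $ i * pd i V x $ k) +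
     (\<Sum>i\<in>UNIV. \<Sum>j\<in>UNIV. christoffel G k i j x * X $ i * V x $ j))"

definition geodesic_on :: "(real^'n \<Rightarrow> real^'n^'n) \<Rightarrow> (real \<Rightarrow> real^'n) \<Rightarrow> real set \<Rightarrow> bool" where
  "geodesic_on G u I \<longleftrightarrow> (\<exists>u' u''. \<forall>t\<in>I.
     (u has_vector_derivative u' t) (at t within I) \<and>
     (u' has_vector_derivative u'' t) (at t within I) \<and>
     (\<forall>k. u'' t $ k +
        (\<Sum>i\<in>UNIV. \<Sum>j\<in>UNIV. christoffel G k i j (u t) * u' t $ i * u' t $ j) = 0))"


section \<open>Compact 3-manifolds with boundary\<close>

type_synonym 'a chart = "'a set \<times> ('a \<Rightarrow> real^3)"

abbreviation dom_of :: "'a chart \<Rightarrow> 'a set" where "dom_of c \<equiv> fst c"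
abbreviation cmap :: "'a chart \<Rightarrow> 'a \<Rightarrow> real^3" where "cmap c \<equiv> snd c"
definition cimg :: "'a chart \<Rightarrow> (real^3) set" where "cimg c = cmap c ` dom_of c"
definition cinv :: "'a chart \<Rightarrow> real^3 \<Rightarrow> 'a" where "cinv c = inv_into (dom_of c) (cmap c)"

definition overlap :: "'a chart \<Rightarrow> 'a chart \<Rightarrow> (real^3) set" where
  "overlap c c' = cmap c ` (dom_of c \<inter> dom_of c')"

definition transition :: "'a chart \<Rightarrow> 'a chart \<Rightarrow> real^3 \<Rightarrow> real^3" where
  "transition c c' = cmap c' \<circ> cinv c"

definition is_chart :: "'a topology \<Rightarrow> 'a chart \<Rightarrow> bool" where
  "is_chart M c \<longleftrightarrow> openin M (dom_of c) \<and>
     (open (cimg c) \<or> openin (top_of_set {x. 0 \<le> x $ 3}) (cimg c)) \<and>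
     homeomorphic_map (subtopology M (dom_of c)) (top_of_set (cimg c)) (cmap c)"

definition compatible :: "'a chart \<Rightarrow> 'a chart \<Rightarrow> bool" where
  "compatible c c' \<longleftrightarrow> smooth_on (transition c c') (overlap c c') \<and>
     smooth_on (transition c' c) (overlap c' c)"

text \<open>A smooth structure is a maximal atlas.\<close>

definition smooth_structure :: "'a topology \<Rightarrow> 'a chart set \<Rightarrow> bool" where
  "smooth_structure M A \<longleftrightarrow> (\<forall>c\<in>A. is_chart M c) \<and> (\<Union>c\<in>A. dom_of c) = topspace M \<and>
     (\<forall>c\<in>A. \<forall>c'\<in>A. compatible c c') \<and>
     (\<forall>c. is_chart M c \<and> (\<forall>c'\<in>A. compatible c c') \<longrightarrow> c \<in> A)"

definition bdry :: "'a topology \<Rightarrow> 'a chart set \<Rightarrow> 'a set" where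
  "bdry M A = {q \<in> topspace M. \<forall>c\<in>A. q \<in> dom_of c \<longrightarrow> cmap c q \<notin> interior (cimg c)}"

definition orientation :: "'a topology \<Rightarrow> 'a chart set \<Rightarrow> 'a chart set \<Rightarrow> bool" where
  "orientation M A Or \<longleftrightarrow> Or \<subseteq> A \<and> (\<Union>c\<in>Or. dom_of c) = topspace M \<and>
     (\<forall>c\<in>Or. \<forall>c'\<in>Or. \<forall>x\<in>overlap c c'. \<forall>D.
        (transition c c' has_derivative D) (at x within overlap c c') \<longrightarrow> det (matrix D) > 0)"

text \<open>Tensors are families of local components, indexed by the charts, that satisfy the
  transformation law.\<close>

type_synonym 'a metric = "'a chart \<Rightarrow> real^3 \<Rightarrow> real^3^3"

definition riemannian_metric :: "'a chart set \<Rightarrow> 'a metric \<Rightarrow> bool" where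
  "riemannian_metric A g \<longleftrightarrow>
     (\<forall>c\<in>A. smooth_on (g c) (cimg c) \<and>
        (\<forall>x\<in>cimg c. transpose (g c x) = g c x \<and> (\<forall>v. v \<noteq> 0 \<longrightarrow> 0 < v \<bullet> (g c x *v v)))) \<and>
     (\<forall>c\<in>A. \<forall>c'\<in>A. \<forall>x\<in>overlap c c'. \<forall>D.
        (transition c c' has_derivative D) (at x within overlap c c') \<longrightarrow>
        (\<forall>v u. D v \<bullet> (g c' (transition c c' x) *v D u) = v \<bullet> (g c x *v u)))"

definition riemannian_volume ::
  "'a topology \<Rightarrow> 'a chart set \<Rightarrow> 'a metric \<Rightarrow> 'a measure \<Rightarrow> bool" where
  "riemannian_volume M A g vol \<longleftrightarrow>
     space vol = topspace M \<and> sets vol = sigma_sets (topspace M) {U. openin M U} \<and>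
     (\<forall>c\<in>A. \<forall>B\<in>sets vol. B \<subseteq> dom_of c \<longrightarrow>
        emeasure vol B = (\<integral>\<^sup>+x\<in>cmap c ` B. ennreal (sqrt (det (g c x))) \<partial>lborel))"


section \<open>Hypersurfaces\<close>

definition slice_chart :: "'a chart set \<Rightarrow> 'a set \<Rightarrow> 'a chart \<Rightarrow> bool" where
  "slice_chart A N c \<longleftrightarrow> c \<in> A \<and> open (cimg c) \<and>
     dom_of c \<inter> N = {q \<in> dom_of c. cmap c q $ 3 = 0}"

definition closed_hypersurface :: "'a topology \<Rightarrow> 'a chart set \<Rightarrow> 'a set \<Rightarrow> bool" where
  "closed_hypersurface M A N \<longleftrightarrow> compactin M N \<and>
     (\<forall>q\<in>N. \<exists>c. slice_chart A N c \<and> q \<in> dom_of c)"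

definition unit_normal_field ::
  "'a chart set \<Rightarrow> 'a metric \<Rightarrow> 'a set \<Rightarrow> ('a chart \<Rightarrow> 'a \<Rightarrow> real^3) \<Rightarrow> bool" where
  "unit_normal_field A g N \<nu> \<longleftrightarrow>
     (\<forall>c\<in>A. smooth_on (\<lambda>x. \<nu> c (cinv c x)) (cmap c ` (dom_of c \<inter> N)) \<and>
        (\<forall>q\<in>N \<inter> dom_of c. \<nu> c q \<bullet> (g c (cmap c q) *v \<nu> c q) = 1)) \<and>
     (\<forall>c\<in>A. \<forall>c'\<in>A. \<forall>q\<in>N \<inter> dom_of c \<inter> dom_of c'. \<forall>D.
        (transition c c' has_derivative D) (at (cmap c q) within overlap c c') \<longrightarrow>
        D (\<nu> c q) = \<nu> c' q) \<and>
     (\<forall>c. slice_chart A N c \<longrightarrow> (\<forall>q\<in>N \<inter> dom_of c. \<forall>v. v $ 3 = 0 \<longrightarrow>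
        v \<bullet> (g c (cmap c q) *v \<nu> c q) = 0))"

definition adapted_chart ::
  "'a chart set \<Rightarrow> 'a set \<Rightarrow> ('a chart \<Rightarrow> 'a \<Rightarrow> real^3) \<Rightarrow> 'a chart \<Rightarrow> bool" where
  "adapted_chart A N \<nu> c \<longleftrightarrow> slice_chart A N c \<and> (\<forall>q\<in>N \<inter> dom_of c. \<nu> c q = axis 3 1)"

definition pt :: "real^2 \<Rightarrow> real \<Rightarrow> real^3" where
  "pt x t = vector [x $ 1, x $ 2, t]"

text \<open>The inclusion of the Greek indices 1, 2 into 1, 2, 3.\<close>

definition tn :: "2 \<Rightarrow> 3" where
  "tn a = (if a = 1 then 1 else 2)"

definition tangential_metric :: "(real^3 \<Rightarrow> real^3^3) \<Rightarrow> real \<Rightarrow> real^2 \<Rightarrow> real^2^2" where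
  "tangential_metric G t x = (\<chi> a b. G (pt x t) $ tn a $ tn b)"

text \<open>The shape operator at points of the slice \<open>x\<^sub>3 = 0\<close> of an adapted chart, where
  the unit normal is the third coordinate field.\<close>

definition shape_operator :: "(real^3 \<Rightarrow> real^3^3) \<Rightarrow> real^3 \<Rightarrow> real^3 \<Rightarrow> real^3" where
  "shape_operator G x X = - levi_civita G X (\<lambda>_. axis 3 1) x"

text \<open>The third coordinate is arclength along the normal geodesics because their
  initial velocity is the unit normal.\<close>

definition boundary_normal_chart ::
  "'a chart set \<Rightarrow> 'a metric \<Rightarrow> 'a set \<Rightarrow> ('a chart \<Rightarrow> 'a \<Rightarrow> real^3) \<Rightarrow> 'a \<Rightarrow> 'a chart \<Rightarrow> bool" where
  "boundary_normal_chart A g N \<nu> p c \<longleftrightarrow>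
     adapted_chart A N \<nu> c \<and> p \<in> dom_of c \<and> cmap c p = 0 \<and>
     (\<forall>x t. pt x t \<in> cimg c \<longrightarrow>
        (\<forall>s\<in>closed_segment 0 t. pt x s \<in> cimg c) \<and> (\<forall>s\<in>{0..1}. pt (s *\<^sub>R x) 0 \<in> cimg c)) \<and>
     tangential_metric (g c) 0 0 = mat 1 \<and>
     (\<forall>x. pt x 0 \<in> cimg c \<longrightarrow>
        geodesic_on (tangential_metric (g c) 0) (\<lambda>s. s *\<^sub>R x) {0..1}) \<and>
     (\<forall>x t. pt x t \<in> cimg c \<longrightarrow> geodesic_on (g c) (\<lambda>s. pt x s) (closed_segment 0 t))"


section \<open>Vector bundles and Laplacians\<close>

text \<open>A bundle with projection \<open>\<pi>\<close> is given by a set of local frames. A frame is an open set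
  with a map that sends each vector over this set to its coefficients; the fibres have the
  vector space structure transported along these maps.\<close>

type_synonym ('a, 'e, 'r) frame = "'a set \<times> ('e \<Rightarrow> complex^'r)"

definition fibre :: "('e \<Rightarrow> 'a) \<Rightarrow> 'a \<Rightarrow> 'e set" where
  "fibre \<pi> q = {v. \<pi> v = q}"

definition frame_change ::
  "('e \<Rightarrow> 'a) \<Rightarrow> ('a, 'e, 'r::finite) frame \<Rightarrow> ('a, 'e, 'r) frame \<Rightarrow> 'a \<Rightarrow> complex^'r^'r" where
  "frame_change \<pi> f f' q = matrix (\<lambda>z. snd f' (inv_into (fibre \<pi> q) (snd f) z))"

definition vector_bundle ::
  "'a topology \<Rightarrow> 'a chart set \<Rightarrow> ('e \<Rightarrow> 'a) \<Rightarrow> ('a, 'e, 'r::finite) frame set \<Rightarrow> bool" where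
  "vector_bundle M A \<pi> Fr \<longleftrightarrow>
     (\<forall>f\<in>Fr. openin M (fst f) \<and> (\<forall>q\<in>fst f. bij_betw (snd f) (fibre \<pi> q) UNIV)) \<and>
     (\<Union>f\<in>Fr. fst f) = topspace M \<and>
     (\<forall>f\<in>Fr. \<forall>f'\<in>Fr.
        (\<forall>q\<in>fst f \<inter> fst f'. \<forall>v\<in>fibre \<pi> q. snd f' v = frame_change \<pi> f f' q *v snd f v) \<and>
        (\<forall>c\<in>A. smooth_on (\<lambda>x. frame_change \<pi> f f' (cinv c x))
           (cmap c ` (dom_of c \<inter> fst f \<inter> fst f'))))"

definition local_rep ::
  "'a chart \<Rightarrow> ('a, 'e, 'r::finite) frame \<Rightarrow> ('a \<Rightarrow> 'e) \<Rightarrow> real^3 \<Rightarrow> complex^'r" where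
  "local_rep c f \<sigma> x = snd f (\<sigma> (cinv c x))"

definition smooth_section_on ::
  "'a chart set \<Rightarrow> ('e \<Rightarrow> 'a) \<Rightarrow> ('a, 'e, 'r::finite) frame set \<Rightarrow> 'a set \<Rightarrow> ('a \<Rightarrow> 'e) \<Rightarrow> bool" where
  "smooth_section_on A \<pi> Fr B \<sigma> \<longleftrightarrow> (\<forall>q\<in>B. \<pi> (\<sigma> q) = q) \<and>
     (\<forall>c\<in>A. \<forall>f\<in>Fr. smooth_on (local_rep c f \<sigma>) (cmap c ` (dom_of c \<inter> fst f \<inter> B)))"

definition vanishes_on :: "('a, 'e, 'r::finite) frame set \<Rightarrow> 'a set \<Rightarrow> ('a \<Rightarrow> 'e) \<Rightarrow> bool" where
  "vanishes_on Fr B \<sigma> \<longleftrightarrow> (\<forall>q\<in>B. \<forall>f\<in>Fr. q \<in> fst f \<longrightarrow> snd f (\<sigma> q) = 0)"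

definition inner_product_on_bundle ::
  "'a chart set \<Rightarrow> ('e \<Rightarrow> 'a) \<Rightarrow> ('a, 'e, 'r::finite) frame set \<Rightarrow> ('e \<Rightarrow> 'e \<Rightarrow> complex) \<Rightarrow> bool" where
  "inner_product_on_bundle A \<pi> Fr ip \<longleftrightarrow> (\<forall>f\<in>Fr. \<exists>h :: 'a \<Rightarrow> complex^'r^'r.
     (\<forall>c\<in>A. smooth_on (\<lambda>x. h (cinv c x)) (cmap c ` (dom_of c \<inter> fst f))) \<and>
     (\<forall>q\<in>fst f. \<forall>u\<in>fibre \<pi> q. \<forall>v\<in>fibre \<pi> q.
        ip u v = (\<Sum>i\<in>UNIV. \<Sum>j\<in>UNIV. h q $ i $ j * snd f u $ i * cnj (snd f v $ j)) \<and>
        ip v u = cnj (ip u v) \<and>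
        (snd f u \<noteq> 0 \<longrightarrow> 0 < Re (ip u u))))"

definition endo_matrix ::
  "('e \<Rightarrow> 'a) \<Rightarrow> ('a, 'e, 'r::finite) frame \<Rightarrow> ('e \<Rightarrow> 'e) \<Rightarrow> 'a \<Rightarrow> complex^'r^'r" where
  "endo_matrix \<pi> f E q = matrix (\<lambda>z. snd f (E (inv_into (fibre \<pi> q) (snd f) z)))"

definition bundle_endomorphism ::
  "'a chart set \<Rightarrow> ('e \<Rightarrow> 'a) \<Rightarrow> ('a, 'e, 'r::finite) frame set \<Rightarrow> ('e \<Rightarrow> 'e) \<Rightarrow> bool" where
  "bundle_endomorphism A \<pi> Fr E \<longleftrightarrow> (\<forall>f\<in>Fr.
     (\<forall>q\<in>fst f. \<forall>v\<in>fibre \<pi> q. E v \<in> fibre \<pi> q \<and> snd f (E v) = endo_matrix \<pi> f E q *v snd f v) \<and>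
     (\<forall>c\<in>A. smooth_on (\<lambda>x. endo_matrix \<pi> f E (cinv c x)) (cmap c ` (dom_of c \<inter> fst f))))"

text \<open>A connection is given by its matrices with respect to charts and frames. If \<open>H\<close> is the
  change of frame, so that \<open>s' = H s\<close>, then \<open>\<partial> s' + \<omega>' s' = H (\<partial> s + \<omega> s)\<close> amounts to
  \<open>\<omega>' H = H \<omega> - \<partial> H\<close>. The law at boundary points follows by continuity.\<close>

type_synonym ('a, 'e, 'r) conn =
  "'a chart \<Rightarrow> ('a, 'e, 'r) frame \<Rightarrow> 3 \<Rightarrow> real^3 \<Rightarrow> complex^'r^'r"

definition connection ::
  "'a chart set \<Rightarrow> ('e \<Rightarrow> 'a) \<Rightarrow> ('a, 'e, 'r::finite) frame set \<Rightarrow> ('a, 'e, 'r) conn \<Rightarrow> bool" where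
  "connection A \<pi> Fr w \<longleftrightarrow>
     (\<forall>c\<in>A. \<forall>f\<in>Fr. \<forall>j. smooth_on (w c f j) (cmap c ` (dom_of c \<inter> fst f))) \<and>
     (\<forall>c\<in>A. \<forall>c'\<in>A. \<forall>f\<in>Fr. \<forall>f'\<in>Fr.
        \<forall>x\<in>cmap c ` (dom_of c \<inter> dom_of c' \<inter> fst f \<inter> fst f') \<inter> interior (cimg c). \<forall>j.
          (\<Sum>k\<in>UNIV. (pd j (transition c c') x $ k) *\<^sub>R w c' f' k (transition c c' x)) **
            frame_change \<pi> f f' (cinv c x) =
          frame_change \<pi> f f' (cinv c x) ** w c f j x -
            pd j (\<lambda>y. frame_change \<pi> f f' (cinv c y)) x)"

definition cov_deriv ::
  "(3 \<Rightarrow> real^3 \<Rightarrow> complex^'r^'r) \<Rightarrow> 3 \<Rightarrow> (real^3 \<Rightarrow> complex^'r::finite) \<Rightarrow> real^3 \<Rightarrow> complex^'r" where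
  "cov_deriv w j s x = pd j s x + w j x *v s x"

definition local_laplacian ::
  "(real^3 \<Rightarrow> real^3^3) \<Rightarrow> (3 \<Rightarrow> real^3 \<Rightarrow> complex^'r^'r) \<Rightarrow> (real^3 \<Rightarrow> complex^'r^'r) \<Rightarrow>
   (real^3 \<Rightarrow> complex^'r::finite) \<Rightarrow> real^3 \<Rightarrow> complex^'r" where
  "local_laplacian G w e s x =
     - (\<Sum>i\<in>UNIV. \<Sum>j\<in>UNIV. matrix_inv (G x) $ i $ j *\<^sub>R
          (cov_deriv w i (cov_deriv w j s) x -
             (\<Sum>k\<in>UNIV. christoffel G k i j x *\<^sub>R cov_deriv w k s x)))
     - e x *v s x"

text \<open>\<open>Lap\<close> is the operator \<open>-(Tr \<nabla>\<^sup>2 + E)\<close>, and it is symmetric and non-negative on the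
  sections that satisfy the Dirichlet condition.\<close>

definition laplacian ::
  "'a topology \<Rightarrow> 'a chart set \<Rightarrow> 'a metric \<Rightarrow> 'a measure \<Rightarrow> ('e \<Rightarrow> 'a) \<Rightarrow>
   ('a, 'e, 'r::finite) frame set \<Rightarrow> ('e \<Rightarrow> 'e \<Rightarrow> complex) \<Rightarrow> ('a, 'e, 'r) conn \<Rightarrow> ('e \<Rightarrow> 'e) \<Rightarrow>
   (('a \<Rightarrow> 'e) \<Rightarrow> 'a \<Rightarrow> 'e) \<Rightarrow> bool" where
  "laplacian M A g vol \<pi> Fr ip w E Lap \<longleftrightarrow>
     (\<forall>\<sigma>. smooth_section_on A \<pi> Fr (topspace M) \<sigma> \<longrightarrow>
        smooth_section_on A \<pi> Fr (topspace M) (Lap \<sigma>) \<and>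
        (\<forall>c\<in>A. \<forall>f\<in>Fr. \<forall>x\<in>cmap c ` (dom_of c \<inter> fst f) \<inter> interior (cimg c).
           local_rep c f (Lap \<sigma>) x =
           local_laplacian (g c) (w c f) (\<lambda>y. endo_matrix \<pi> f E (cinv c y)) (local_rep c f \<sigma>) x)) \<and>
     (\<forall>\<sigma> \<tau>. smooth_section_on A \<pi> Fr (topspace M) \<sigma> \<and> vanishes_on Fr (bdry M A) \<sigma> \<and>
        smooth_section_on A \<pi> Fr (topspace M) \<tau> \<and> vanishes_on Fr (bdry M A) \<tau> \<longrightarrow>
        (LINT q|vol. ip (Lap \<sigma> q) (\<tau> q)) = (LINT q|vol. ip (\<sigma> q) (Lap \<tau> q))) \<and>
     (\<forall>\<sigma>. smooth_section_on A \<pi> Fr (topspace M) \<sigma> \<and> vanishes_on Fr (bdry M A) \<sigma> \<longrightarrow>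
        0 \<le> Re (LINT q|vol. ip (Lap \<sigma> q) (\<sigma> q)))"


section \<open>The Dirichlet-to-Neumann operator\<close>

text \<open>Since the two boundary values on the copies of \<open>N\<close> agree, a solution on the manifold cut
  along \<open>N\<close> is a section over \<open>M\<close> which is smooth off \<open>N\<close> and smooth up to \<open>N\<close> from each
  side. The copy of \<open>N\<close> on which the normal points outward is approached from \<open>x\<^sub>3 < 0\<close>.\<close>

definition cut_solution ::
  "'a topology \<Rightarrow> 'a chart set \<Rightarrow> 'a metric \<Rightarrow> ('e \<Rightarrow> 'a) \<Rightarrow> ('a, 'e, 'r::finite) frame set \<Rightarrow>
   ('a, 'e, 'r) conn \<Rightarrow> ('e \<Rightarrow> 'e) \<Rightarrow> 'a set \<Rightarrow> ('a chart \<Rightarrow> 'a \<Rightarrow> real^3) \<Rightarrow>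
   real \<Rightarrow> ('a \<Rightarrow> 'e) \<Rightarrow> ('a \<Rightarrow> 'e) \<Rightarrow> bool" where
  "cut_solution M A g \<pi> Fr w E N \<nu> lam \<phi> \<psi> \<longleftrightarrow>
     smooth_section_on A \<pi> Fr (topspace M - N) \<psi> \<and>
     (\<forall>c f. adapted_chart A N \<nu> c \<and> f \<in> Fr \<longrightarrow>
        smooth_on (local_rep c f \<psi>) {x \<in> cmap c ` (dom_of c \<inter> fst f). 0 \<le> x $ 3} \<and>
        smooth_on (local_rep c f \<psi>) {x \<in> cmap c ` (dom_of c \<inter> fst f). x $ 3 \<le> 0}) \<and>
     (\<forall>q\<in>N. \<psi> q = \<phi> q) \<and> vanishes_on Fr (bdry M A) \<psi> \<and>
     (\<forall>c\<in>A. \<forall>f\<in>Fr. \<forall>x\<in>cmap c ` (dom_of c \<inter> fst f - N) \<inter> interior (cimg c).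
        local_laplacian (g c) (w c f) (\<lambda>y. endo_matrix \<pi> f E (cinv c y)) (local_rep c f \<psi>) x +
        lam *\<^sub>R local_rep c f \<psi> x = 0)"

definition normal_jump ::
  "'a chart set \<Rightarrow> ('e \<Rightarrow> 'a) \<Rightarrow> ('a, 'e, 'r::finite) frame set \<Rightarrow> ('a, 'e, 'r) conn \<Rightarrow>
   'a set \<Rightarrow> ('a chart \<Rightarrow> 'a \<Rightarrow> real^3) \<Rightarrow> ('a \<Rightarrow> 'e) \<Rightarrow> ('a \<Rightarrow> 'e) \<Rightarrow> bool" where
  "normal_jump A \<pi> Fr w N \<nu> \<psi> \<eta> \<longleftrightarrow> smooth_section_on A \<pi> Fr N \<eta> \<and>
     (\<forall>c f. adapted_chart A N \<nu> c \<and> f \<in> Fr \<longrightarrow> (\<forall>q\<in>N \<inter> dom_of c \<inter> fst f. \<exists>a b.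
        ((\<lambda>t. cov_deriv (w c f) 3 (local_rep c f \<psi>) (cmap c q + t *\<^sub>R axis 3 1)) \<longlongrightarrow> a) (at_left 0) \<and>
        ((\<lambda>t. cov_deriv (w c f) 3 (local_rep c f \<psi>) (cmap c q + t *\<^sub>R axis 3 1)) \<longlongrightarrow> b) (at_right 0) \<and>
        snd f (\<eta> q) = a - b))"

definition dirichlet_to_neumann ::
  "'a topology \<Rightarrow> 'a chart set \<Rightarrow> 'a metric \<Rightarrow> ('e \<Rightarrow> 'a) \<Rightarrow> ('a, 'e, 'r::finite) frame set \<Rightarrow>
   ('a, 'e, 'r) conn \<Rightarrow> ('e \<Rightarrow> 'e) \<Rightarrow> 'a set \<Rightarrow> ('a chart \<Rightarrow> 'a \<Rightarrow> real^3) \<Rightarrow>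
   real \<Rightarrow> ('a \<Rightarrow> 'e) \<Rightarrow> 'a \<Rightarrow> 'e" where
  "dirichlet_to_neumann M A g \<pi> Fr w E N \<nu> lam \<phi> =
     (SOME \<eta>. \<exists>\<psi>. cut_solution M A g \<pi> Fr w E N \<nu> lam \<phi> \<psi> \<and> normal_jump A \<pi> Fr w N \<nu> \<psi> \<eta>)"


section \<open>Symbols\<close>

definition cscale :: "complex \<Rightarrow> complex^'r^'r \<Rightarrow> complex^'r^'r" (infixr "*\<^sub>c" 75) where
  "z *\<^sub>c B = map_matrix ((*) z) B"

type_synonym 'r symbol = "real^2 \<Rightarrow> real^2 \<Rightarrow> complex^'r^'r"

definition dx :: "2 \<Rightarrow> 'r::finite symbol \<Rightarrow> 'r symbol" where
  "dx a F x \<xi> = pd a (\<lambda>y. F y \<xi>) x"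

definition dxi :: "2 \<Rightarrow> 'r::finite symbol \<Rightarrow> 'r symbol" where
  "dxi a F x \<xi> = pd a (F x) \<xi>"

definition Dx :: "2 \<Rightarrow> 'r::finite symbol \<Rightarrow> 'r symbol" where
  "Dx a F x \<xi> = (1 / \<i>) *\<^sub>c dx a F x \<xi>"

text \<open>Multi-indices are pairs of natural numbers.\<close>

definition mderiv :: "(2 \<Rightarrow> 'r symbol \<Rightarrow> 'r symbol) \<Rightarrow> nat \<times> nat \<Rightarrow> 'r symbol \<Rightarrow> 'r::finite symbol" where
  "mderiv d m F = (d 1 ^^ fst m) ((d 2 ^^ snd m) F)"

text \<open>In \<open>contr1\<close> and \<open>contr2\<close> the parameter \<open>d\<close> is \<open>dx\<close> or \<open>Dx\<close>.\<close>

definition contr1 :: "(2 \<Rightarrow> 'r symbol \<Rightarrow> 'r symbol) \<Rightarrow> 'r symbol \<Rightarrow> 'r symbol \<Rightarrow> 'r::finite symbol" where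
  "contr1 d F G x \<xi> = (\<Sum>a\<in>UNIV. dxi a F x \<xi> ** d a G x \<xi>)"

definition contr2 :: "(2 \<Rightarrow> 'r symbol \<Rightarrow> 'r symbol) \<Rightarrow> 'r symbol \<Rightarrow> 'r symbol \<Rightarrow> 'r::finite symbol" where
  "contr2 d F G x \<xi> = (\<Sum>m\<in>{m. fst m + snd m = 2}.
     (1 / (fact (fst m) * fact (snd m))) *\<^sub>R (mderiv dxi m F x \<xi> ** mderiv d m G x \<xi>))"

text \<open>Local data in boundary normal coordinates, with \<open>t\<close> in the role of \<open>x\<^sub>m\<close>: the metrics \<open>h t\<close>
  of the slices, the connection matrices \<open>w j t\<close> and the matrix \<open>e t\<close> of the endomorphism.\<close>

context
  fixes h :: "real \<Rightarrow> real^2 \<Rightarrow> real^2^2"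
    and w :: "3 \<Rightarrow> real \<Rightarrow> real^2 \<Rightarrow> complex^'r::finite^'r"
    and e :: "real \<Rightarrow> real^2 \<Rightarrow> complex^'r^'r"
begin

definition ginv :: "2 \<Rightarrow> 2 \<Rightarrow> real \<Rightarrow> real^2 \<Rightarrow> real" where
  "ginv a b t x = matrix_inv (h t x) $ a $ b"

definition normsq :: "real \<Rightarrow> real^2 \<Rightarrow> real^2 \<Rightarrow> real" where
  "normsq t x \<xi> = (\<Sum>a\<in>UNIV. \<Sum>b\<in>UNIV. ginv a b t x * \<xi> $ a * \<xi> $ b)"

definition Acoef :: "real \<Rightarrow> real^2 \<Rightarrow> real" where
  "Acoef t x = - 1/2 * (\<Sum>a\<in>UNIV. \<Sum>b\<in>UNIV. ginv a b t x *
     vector_derivative (\<lambda>s. h s x $ a $ b) (at t))"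

definition p1 :: "real \<Rightarrow> 'r symbol" where
  "p1 t x \<xi> =
     (- \<i> * complex_of_real (\<Sum>a\<in>UNIV. \<Sum>b\<in>UNIV.
        (1/2 * ginv a b t x * pd a (\<lambda>y. ln (det (h t y))) x + pd a (ginv a b t) x) * \<xi> $ b)) *\<^sub>c mat 1
     - (2 * \<i>) *\<^sub>c (\<Sum>a\<in>UNIV. \<Sum>b\<in>UNIV. (ginv a b t x * \<xi> $ b) *\<^sub>R w (tn a) t x)"

definition p0 :: "real \<Rightarrow> real^2 \<Rightarrow> complex^'r^'r" where
  "p0 t x = - (\<Sum>a\<in>UNIV. \<Sum>b\<in>UNIV. ginv a b t x *\<^sub>R
       (pd a (w (tn b) t) x + w (tn a) t x ** w (tn b) t x -
        (\<Sum>k\<in>UNIV. christoffel (h t) k a b x *\<^sub>R w (tn k) t x))) - e t x"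

definition root1 :: "real \<Rightarrow> real \<Rightarrow> real^2 \<Rightarrow> real^2 \<Rightarrow> complex" where
  "root1 lam t x \<xi> = complex_of_real (sqrt (normsq t x \<xi> + lam))"

definition alpha1 :: "real \<Rightarrow> real \<Rightarrow> 'r symbol" where
  "alpha1 lam t x \<xi> = root1 lam t x \<xi> *\<^sub>c mat 1"

definition beta1 :: "real \<Rightarrow> real \<Rightarrow> 'r symbol" where
  "beta1 lam t x \<xi> = root1 lam t x \<xi> *\<^sub>c mat 1"

definition alpha0 :: "real \<Rightarrow> real \<Rightarrow> 'r symbol" where
  "alpha0 lam t x \<xi> = (1 / (2 * root1 lam t x \<xi>)) *\<^sub>c
     (p1 t x \<xi> + Acoef t x *\<^sub>R alpha1 lam t x \<xi>
      + \<i> *\<^sub>c contr1 dx (alpha1 lam t) (alpha1 lam t) x \<xi>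
      - vector_derivative (\<lambda>s. alpha1 lam s x \<xi>) (at t))"

definition beta0 :: "real \<Rightarrow> real \<Rightarrow> 'r symbol" where
  "beta0 lam t x \<xi> = (1 / (2 * root1 lam t x \<xi>)) *\<^sub>c
     (p1 t x \<xi> - Acoef t x *\<^sub>R alpha1 lam t x \<xi>
      + \<i> *\<^sub>c contr1 dx (alpha1 lam t) (alpha1 lam t) x \<xi>
      + vector_derivative (\<lambda>s. alpha1 lam s x \<xi>) (at t))"

definition alpha_minus1 :: "real \<Rightarrow> real \<Rightarrow> 'r symbol" where
  "alpha_minus1 lam t x \<xi> = (1 / (2 * root1 lam t x \<xi>)) *\<^sub>c
     (contr2 dx (alpha1 lam t) (alpha1 lam t) x \<xi>
      + \<i> *\<^sub>c contr1 dx (alpha0 lam t) (alpha1 lam t) x \<xi>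
      + \<i> *\<^sub>c contr1 dx (alpha1 lam t) (alpha0 lam t) x \<xi>
      - alpha0 lam t x \<xi> ** alpha0 lam t x \<xi>
      + p0 t x + Acoef t x *\<^sub>R alpha0 lam t x \<xi>
      - vector_derivative (\<lambda>s. alpha0 lam s x \<xi>) (at t)
      + alpha0 lam t x \<xi> ** w 3 t x - w 3 t x ** alpha0 lam t x \<xi>)"

definition beta_minus1 :: "real \<Rightarrow> real \<Rightarrow> 'r symbol" where
  "beta_minus1 lam t x \<xi> = (1 / (2 * root1 lam t x \<xi>)) *\<^sub>c
     (contr2 dx (beta1 lam t) (beta1 lam t) x \<xi>
      + \<i> *\<^sub>c contr1 dx (beta0 lam t) (beta1 lam t) x \<xi>
      + \<i> *\<^sub>c contr1 dx (beta1 lam t) (beta0 lam t) x \<xi>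
      - beta0 lam t x \<xi> ** beta0 lam t x \<xi>
      + p0 t x - Acoef t x *\<^sub>R beta0 lam t x \<xi>
      + vector_derivative (\<lambda>s. beta0 lam s x \<xi>) (at t)
      - beta0 lam t x \<xi> ** w 3 t x + w 3 t x ** beta0 lam t x \<xi>)"

text \<open>The first three homogeneous components of the symbol of the Dirichlet-to-Neumann operator
  (\<open>lam\<close> has weight 2), and those of the symbol of its resolvent.\<close>

definition theta1 :: "real \<Rightarrow> 'r symbol" where
  "theta1 lam x \<xi> = alpha1 lam 0 x \<xi> + beta1 lam 0 x \<xi>"

definition theta0 :: "real \<Rightarrow> 'r symbol" where
  "theta0 lam x \<xi> = alpha0 lam 0 x \<xi> + beta0 lam 0 x \<xi>"

definition theta_minus1 :: "real \<Rightarrow> 'r symbol" where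
  "theta_minus1 lam x \<xi> = alpha_minus1 lam 0 x \<xi> + beta_minus1 lam 0 x \<xi>"

definition r_minus1 :: "real \<Rightarrow> complex \<Rightarrow> 'r symbol" where
  "r_minus1 lam \<mu> x \<xi> = matrix_inv (mat \<mu> - theta1 lam x \<xi>)"

definition r_minus2 :: "real \<Rightarrow> complex \<Rightarrow> 'r symbol" where
  "r_minus2 lam \<mu> x \<xi> = r_minus1 lam \<mu> x \<xi> **
     (contr1 Dx (theta1 lam) (r_minus1 lam \<mu>) x \<xi> + theta0 lam x \<xi> ** r_minus1 lam \<mu> x \<xi>)"

definition r_minus3 :: "real \<Rightarrow> complex \<Rightarrow> 'r symbol" where
  "r_minus3 lam \<mu> x \<xi> = r_minus1 lam \<mu> x \<xi> **
     (contr2 Dx (theta1 lam) (r_minus1 lam \<mu>) x \<xi>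
      + contr1 Dx (theta1 lam) (r_minus2 lam \<mu>) x \<xi>
      + contr1 Dx (theta0 lam) (r_minus1 lam \<mu>) x \<xi>
      + theta0 lam x \<xi> ** r_minus2 lam \<mu> x \<xi>
      + theta_minus1 lam x \<xi> ** r_minus1 lam \<mu> x \<xi>)"

definition admissible_contours :: "(real^2 \<Rightarrow> real \<Rightarrow> complex) \<Rightarrow> bool" where
  "admissible_contours \<gamma> \<longleftrightarrow> (\<forall>\<xi>. valid_path (\<gamma> \<xi>) \<and> pathfinish (\<gamma> \<xi>) = pathstart (\<gamma> \<xi>) \<and>
     path_image (\<gamma> \<xi>) \<subseteq> - (\<real>\<^sub>\<le>\<^sub>0 \<union> {2 * root1 1 0 0 \<xi>}) \<and>
     winding_number (\<gamma> \<xi>) (2 * root1 1 0 0 \<xi>) = 1)"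

definition J2_density :: "(real^2 \<Rightarrow> real \<Rightarrow> complex) \<Rightarrow> complex \<Rightarrow> real^2 \<Rightarrow> complex" where
  "J2_density \<gamma> s \<xi> = 1 / (2 * pi * \<i>) *
     contour_integral (\<gamma> \<xi>) (\<lambda>\<mu>. \<mu> powr (- s) * trace (r_minus3 1 \<mu> 0 \<xi>))"

text \<open>\<open>J\<close> is the meromorphic continuation of the integral, which is required to converge
  absolutely for large real part of \<open>s\<close>. A nicely meromorphic function has no removable
  singularities, so that such a \<open>J\<close> is unique.\<close>

definition is_J2 :: "(real^2 \<Rightarrow> real \<Rightarrow> complex) \<Rightarrow> (complex \<Rightarrow> complex) \<Rightarrow> bool" where
  "is_J2 \<gamma> J \<longleftrightarrow> J nicely_meromorphic_on UNIV \<and> (\<exists>s0. \<forall>s. s0 < Re s \<longrightarrow>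
     integrable lborel (J2_density \<gamma> s) \<and>
     J s = 1 / (2 * pi)\<^sup>2 * (LINT \<xi>|lborel. J2_density \<gamma> s \<xi>))"

end

end

theory Submission
  imports Defs
begin

text \<open>
  Write $a$ for the root $\alpha_1$. Then $\alpha_0 = \theta_0/2 + \delta$ and $\beta_0 = \theta_0/2 - \delta$
  with a scalar $\delta = A/2 - \partial_t a / (2a)$, so that the commutators with $\omega_m$ cancel in
  $\theta_{-1}$. In normal coordinates the first tangential derivatives of the metric vanish at $p$, and
  the trace of $r_{-3}$ reduces to $c_2 (\mu - 2a)^{-2} + c_3 (\mu - 2a)^{-3}$; the fourth order pole drops
  out because the second derivatives $h_{ab,cd}$ contracted with four copies of $\xi$ vanish.

  Residue calculus turns the contour integral into multiples of $(2a)^{-s-1}$ and $(2a)^{-s-2}$. The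
  remaining integrals over the plane are moments of powers of $\sqrt{1 + |\xi|^2}$; they are elementary, since
  $|\xi|^2$ has the constant density $\pi$ on the half line and the angular averages follow
  from invariance under reflections and a rotation by 45 degrees. The result is $2^{-s}$ times a rational
  function of $s$ that is regular at $0$. All terms with the connection cancel for every $s$.

  The jet of the metric at $p$ is expressed by curvatures. The normal coordinates on the hypersurface determine
  all second tangential derivatives from its Gauss curvature. The first normal derivative is $-2$ times the
  shape operator, and only the trace of the second normal derivative enters; it is determined by the scalar curvature
  of the ambient metric.
\<close>

text \<open>Every plane moment has a simple pole at \<open>s = 0\<close>, while every residue
  carries a factor \<open>s\<close>; this is why the continuation is regular at 0 and both densities
  can be read off from one explicit function. The factor \<open>2 powr (- s)\<close> comes from the
  leading symbol \<open>2 * rho\<close> and is the only source of \<open>ln 2\<close>.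

  The connection enters through a single number \<open>Q\<close>, with weight -1 in degree 0 and 1
  in degree 2 of the double pole, and -4 in degree 2 of the triple pole. After integration these
  weights combine to a multiple of 1 - 1/(s+2) - (s+1)/(s+2) = 0.

  The obstacle is that the symbols are nested derivatives: a formula valid only at the base point
  cannot be differentiated. Metric data and symbols of order 1 and 0 are therefore computed on an
  open neighbourhood of the origin, and evaluated there only after the last differentiation.
  Existence of each derivative has to be carried along, since the derivative operators of the
  definitions are total functions.\<close>

no_notation fps_nth (infixl "$" 75)


section \<open>The contour integral\<close>

text \<open>The slit plane is the domain of the principal branch, so \<open>w\<close> is the only
  singularity of the integrand there. Simple connectedness makes the winding numbers about points of
  the slit vanish; of the contour only its winding number about \<open>w\<close> remains.\<close>

lemma contour_integral_powr_over_power: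
  fixes w s :: complex
  assumes g: "valid_path g" "pathfinish g = pathstart g"
    and img: "path_image g \<subseteq> - (\<real>\<^sub>\<le>\<^sub>0 \<union> {w})" and wind: "winding_number g w = 1"
    and w: "w \<notin> \<real>\<^sub>\<le>\<^sub>0"
  shows "contour_integral g (\<lambda>\<mu>. \<mu> powr (- s) / (\<mu> - w) ^ Suc n) =
           2 * pi * \<i> * ((deriv ^^ n) (\<lambda>\<mu>. \<mu> powr (- s)) w / fact n)"
    and "(\<lambda>\<mu>. \<mu> powr (- s) / (\<mu> - w) ^ Suc n) contour_integrable_on g"
proof -
  let ?S = "- \<real>\<^sub>\<le>\<^sub>0 :: complex set"
  have star: "starlike ?S"
    unfolding starlike_def
  \<comment> \<open>The star centre is 1: a segment from 1 can return to the real axis only if its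
    other end is real. That end is then positive, and so is the whole segment.\<close>
  proof (intro bexI[of _ 1] ballI subsetI)
    show "(1::complex) \<in> ?S" by auto
    fix x z :: complex assume x: "x \<in> ?S" and z: "z \<in> closed_segment 1 x"
    then obtain u where u: "0 \<le> u" "u \<le> 1" "z = (1 - u) *\<^sub>R 1 + u *\<^sub>R x"
      by (auto simp: closed_segment_def)
    show "z \<in> ?S"
    proof
      assume "z \<in> \<real>\<^sub>\<le>\<^sub>0"
      then have im: "u * Im x = 0" and re: "1 - u + u * Re x \<le> 0"
        using u by (auto simp: complex_nonpos_Reals_iff)
      have "u \<noteq> 0" using re by auto
      then have "Im x = 0" using im by simp
      then have "Re x > 0" using x by (auto simp: complex_nonpos_Reals_iff not_le)
      then have "0 < 1 - u + u * Re x" using u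
        by (cases "u = 1") (auto intro!: add_pos_nonneg mult_nonneg_nonneg)
      then show False using re by simp
    qed
  qed
  have S: "open ?S" "simply_connected ?S"
    using star by (auto intro: starlike_imp_simply_connected open_Compl)
  have hol: "(\<lambda>\<mu>. \<mu> powr (- s)) holomorphic_on ?S"
    by (intro holomorphic_intros) auto
  have hol': "(\<lambda>\<mu>. \<mu> powr (- s) / (\<mu> - w) ^ Suc n) holomorphic_on ?S - {w}"
    by (intro holomorphic_intros holomorphic_on_subset[OF hol]) auto
  have sub: "path_image g \<subseteq> ?S - {w}" using img by auto
  have "contour_integral g (\<lambda>\<mu>. \<mu> powr (- s) / (\<mu> - w) ^ Suc n) =
     2 * pi * \<i> * (\<Sum>p\<in>{w}. winding_number g p * residue (\<lambda>\<mu>. \<mu> powr (- s) / (\<mu> - w) ^ Suc n) p)"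
  proof (rule Residue_theorem[OF S(1) _ _ hol' g sub])
    show "\<forall>z. z \<notin> ?S \<longrightarrow> winding_number g z = 0"
      using S simply_connected_imp_winding_number_zero[of ?S g] g sub
      by (auto simp: valid_path_imp_path)
  qed (use S simply_connected_imp_connected in auto)
  moreover have "residue (\<lambda>\<mu>. \<mu> powr (- s) / (\<mu> - w) ^ Suc n) w
      = (deriv ^^ n) (\<lambda>\<mu>. \<mu> powr (- s)) w / fact n"
    using w by (intro residue_holomorphic_over_power[OF S(1) _ hol]) auto
  ultimately show "contour_integral g (\<lambda>\<mu>. \<mu> powr (- s) / (\<mu> - w) ^ Suc n) =
           2 * pi * \<i> * ((deriv ^^ n) (\<lambda>\<mu>. \<mu> powr (- s)) w / fact n)"
    by (simp add: wind)
  show "(\<lambda>\<mu>. \<mu> powr (- s) / (\<mu> - w) ^ Suc n) contour_integrable_on g"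
    using contour_integrable_holomorphic_simple[OF hol' _ g(1) sub] S by auto
qed

lemma deriv_powr_right:
  fixes w s :: complex
  assumes "w \<notin> \<real>\<^sub>\<le>\<^sub>0"
  shows "deriv (\<lambda>\<mu>. \<mu> powr s) w = s * w powr (s - 1)"
  by (rule DERIV_imp_deriv) (use assms in \<open>auto intro!: derivative_eq_intros\<close>)

lemma deriv2_powr_right:
  fixes w s :: complex
  assumes "w \<notin> \<real>\<^sub>\<le>\<^sub>0"
  shows "deriv (deriv (\<lambda>\<mu>. \<mu> powr s)) w = s * (s - 1) * w powr (s - 2)"
proof -
  \<comment> \<open>The outer derivative sees a whole neighbourhood of \<open>w\<close>, so the
    formula for the inner one is needed near \<open>w\<close>; the slit is closed.\<close>
  have "eventually (\<lambda>z. z \<in> - \<real>\<^sub>\<le>\<^sub>0) (nhds w)"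
    using assms by (intro eventually_nhds_in_open) (auto intro: open_Compl)
  then have "eventually (\<lambda>z. deriv (\<lambda>\<mu>. \<mu> powr s) z = s * z powr (s - 1)) (nhds w)"
    by eventually_elim (simp add: deriv_powr_right)
  then have "deriv (deriv (\<lambda>\<mu>. \<mu> powr s)) w = deriv (\<lambda>z. s * z powr (s - 1)) w"
    by (rule deriv_cong_ev) simp
  also have "\<dots> = s * ((s - 1) * w powr (s - 1 - 1))"
    by (rule DERIV_imp_deriv) (use assms in \<open>auto intro!: derivative_eq_intros\<close>)
  finally show ?thesis by (simp add: algebra_simps)
qed

text \<open>The factors multiplying \<open>c2\<close> and \<open>c3\<close> are the first derivative
  and half the second derivative of the power. The expansion of \<open>F\<close> is required only
  off \<open>w\<close>: at \<open>w\<close> the resolvent symbol is an unspecified value of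
  \<open>matrix_inv\<close>, and the contour avoids this point.\<close>

lemma contour_integral_powr_two_poles:
  fixes w s c2 c3 :: complex
  assumes g: "valid_path g" "pathfinish g = pathstart g"
    and img: "path_image g \<subseteq> - (\<real>\<^sub>\<le>\<^sub>0 \<union> {w})" and wind: "winding_number g w = 1"
    and w: "w \<notin> \<real>\<^sub>\<le>\<^sub>0"
    and F: "\<And>\<mu>. \<mu> \<noteq> w \<Longrightarrow> F \<mu> = c2 / (\<mu> - w)\<^sup>2 + c3 / (\<mu> - w) ^ 3"
  shows "1 / (2 * pi * \<i>) * contour_integral g (\<lambda>\<mu>. \<mu> powr (- s) * F \<mu>) =
    c2 * (- s * w powr (- s - 1)) + c3 * (s * (s + 1) / 2 * w powr (- s - 2))"
proof -
  note I = contour_integral_powr_over_power[OF g img wind w]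
  have "contour_integral g (\<lambda>\<mu>. \<mu> powr (- s) * F \<mu>) =
     contour_integral g (\<lambda>\<mu>. c2 * (\<mu> powr (- s) / (\<mu> - w) ^ Suc 1) + c3 * (\<mu> powr (- s) / (\<mu> - w) ^ Suc 2))"
  proof (rule contour_integral_eq)
    fix \<mu> assume "\<mu> \<in> path_image g"
    then have "\<mu> \<noteq> w" using img by auto
    then show "\<mu> powr (- s) * F \<mu> =
        c2 * (\<mu> powr (- s) / (\<mu> - w) ^ Suc 1) + c3 * (\<mu> powr (- s) / (\<mu> - w) ^ Suc 2)"
      by (simp add: F[of \<mu>] numeral_eq_Suc distrib_left mult.commute)
  qed
  also have "\<dots> = c2 * contour_integral g (\<lambda>\<mu>. \<mu> powr (- s) / (\<mu> - w) ^ Suc 1)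
      + c3 * contour_integral g (\<lambda>\<mu>. \<mu> powr (- s) / (\<mu> - w) ^ Suc 2)"
    by (subst contour_integral_add) (intro contour_integrable_lmul I(2) contour_integral_lmul arg_cong2[where f = plus] refl)+
  also have "\<dots> = 2 * pi * \<i> * (c2 * (- s * w powr (- s - 1)) + c3 * (s * (s + 1) / 2 * w powr (- s - 2)))"
    unfolding I(1) using deriv_powr_right[OF w, of "-s"] deriv2_powr_right[OF w, of "-s"]
    by (simp add: numeral_2_eq_2 algebra_simps)
  finally show ?thesis by simp
qed


section \<open>Moments over the plane\<close>

text \<open>Lebesgue measure is determined by its values on boxes, and the preimage of a box is its
  image under the inverse isometry. The detour through \<open>lebesgue\<close> is due to the
  invariance of volume under isometries being stated for the completed measure.\<close>

lemma lborel_distr_orthogonal: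
  fixes f :: "real^2 \<Rightarrow> real^2"
  assumes f: "orthogonal_transformation f"
  shows "distr lborel borel f = lborel"
proof (rule lborel_eqI[symmetric])
  have lin: "linear f" using f by (rule orthogonal_transformation_linear)
  have meas[measurable]: "f \<in> borel_measurable borel"
    using lin by (intro borel_measurable_continuous_onI linear_continuous_on linear_linear[THEN iffD2])
  obtain g where g: "orthogonal_transformation g" "f \<circ> g = id" "g \<circ> f = id"
    using f orthogonal_transformation_inv[OF f] orthogonal_transformation_surj[OF f]
      orthogonal_transformation_inj[OF f]
    by (metis inj_iff surj_iff)
  fix l u :: "real^2"
  assume le: "\<And>b. b \<in> Basis \<Longrightarrow> l \<bullet> b \<le> u \<bullet> b"
  have vim: "f -` box l u = g ` box l u"
    using g by (auto simp: o_def id_def fun_eq_iff image_iff) metis+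
  have "emeasure (distr lborel borel f) (box l u) = emeasure lborel (f -` box l u)"
    by (subst emeasure_distr) auto
  also have "\<dots> = emeasure lebesgue (f -` box l u)"
    using measurable_sets[OF meas, of "box l u"] by (simp add: emeasure_completion)
  also have "\<dots> = ennreal (measure lebesgue (g ` box l u))"
    unfolding vim using measurable_orthogonal_image[OF g(1), of "box l u"] by (simp add: emeasure_eq_measure2)
  also have "\<dots> = ennreal (measure lebesgue (box l u))"
    by (subst measure_orthogonal_image[OF g(1)]) auto
  also have "\<dots> = emeasure lborel (box l u)"
    by (simp add: emeasure_eq_measure2)
  also have "\<dots> = (\<Prod>b\<in>Basis. (u - l) \<bullet> b)"
    using le by (rule emeasure_lborel_box)
  finally show "emeasure (distr lborel borel f) (box l u) = (\<Prod>b\<in>Basis. (u - l) \<bullet> b)" .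
qed simp

lemma has_bochner_integral_orthogonal:
  fixes f :: "real^2 \<Rightarrow> real^2" and F :: "real^2 \<Rightarrow> complex"
  assumes f: "orthogonal_transformation f" and F: "has_bochner_integral lborel F I"
  shows "has_bochner_integral lborel (\<lambda>x. F (f x)) I"
proof -
  have meas[measurable]: "f \<in> borel_measurable borel"
    using orthogonal_transformation_linear[OF f]
    by (intro borel_measurable_continuous_onI linear_continuous_on linear_linear[THEN iffD2])
  have [measurable]: "F \<in> borel_measurable borel"
    using F by (auto simp: has_bochner_integral_iff)
  have "integrable (distr lborel borel f) F" "integral\<^sup>L (distr lborel borel f) F = I"
    using F by (simp_all add: lborel_distr_orthogonal[OF f] has_bochner_integral_iff)
  then show ?thesis
    by (simp add: has_bochner_integral_iff integrable_distr_eq integral_distr)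
qed

text \<open>A disc of radius \<open>sqrt b\<close> has area \<open>pi * b\<close>, which is linear
  in \<open>b\<close>. Half-open intervals suffice: they generate the Borel sets, and their
  preimages are discs or differences of discs.\<close>

lemma distr_norm_square:
  "distr lborel borel (\<lambda>x :: real^2. (norm x)\<^sup>2) = density lborel (\<lambda>u. ennreal pi * indicator {0<..} u)"
  (is "?M = ?N")
proof -
  define E where "E = range (\<lambda>(a, b). {a<..b::real})"
  have M: "emeasure ?M {a<..b} = ennreal (pi * (max 0 b - max 0 a))" if "a \<le> b" for a b :: real
  proof -
    have eq: "(\<lambda>x :: real^2. (norm x)\<^sup>2) -` {a<..b} \<inter> UNIV =
       (if a < 0 then (if b < 0 then {} else cball 0 (sqrt b)) else cball 0 (sqrt b) - cball 0 (sqrt a))"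
      by (auto simp: real_le_rsqrt real_sqrt_le_iff not_le real_less_rsqrt  intro: order.strict_trans2
          dest: real_sqrt_le_mono real_sqrt_less_mono)
         (smt (verit) real_sqrt_le_iff real_sqrt_abs norm_ge_zero zero_le_power2 real_le_lsqrt real_le_rsqrt)+
    have 1: "emeasure lborel (cball (0::real^2) (sqrt c)) = ennreal (pi * c)" if "c \<ge> 0" for c
      using that by (subst emeasure_cball) (auto simp: unit_ball_vol_2)
    have "emeasure ?M {a<..b} = emeasure lborel ((\<lambda>x :: real^2. (norm x)\<^sup>2) -` {a<..b} \<inter> UNIV)"
      by (subst emeasure_distr) auto
    also have "\<dots> = ennreal (pi * (max 0 b - max 0 a))"
    proof (cases "a < 0")
      case True then show ?thesis unfolding eq using 1 that by (auto simp: max_def)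
    next
      case False
      have "emeasure lborel (cball (0::real^2) (sqrt b) - cball 0 (sqrt a)) =
         ennreal (pi * b) - ennreal (pi * a)"
        using False that real_sqrt_le_mono[OF that]
        by (subst emeasure_Diff) (auto simp: 1 simp del: real_sqrt_le_iff intro: subset_cball)
      then show ?thesis unfolding eq using False that
        by (auto simp: max_def ennreal_minus right_diff_distrib)
    qed
    finally show ?thesis .
  qed
  have N: "emeasure ?N {a<..b} = ennreal (pi * (max 0 b - max 0 a))" if "a \<le> b" for a b :: real
  proof -
    have "emeasure ?N {a<..b} = (\<integral>\<^sup>+u. ennreal pi * indicator {max 0 a<..max 0 b} u \<partial>lborel)"
      using that by (subst emeasure_density) (auto intro!: nn_integral_cong simp: indicator_def max_def)
    also have "\<dots> = ennreal pi * ennreal (max 0 b - max 0 a)"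
      using that by (subst nn_integral_cmult_indicator) auto
    finally show ?thesis using that by (simp add: ennreal_mult[symmetric])
  qed
  show ?thesis
  \<comment> \<open>Uniqueness of measures needs a sequence of generators of finite measure that
    exhausts the line.\<close>
  proof (rule measure_eqI_generator_eq[of E UNIV _ _ "\<lambda>i. {- real i<..real i}"])
    show "Int_stable E"
      by (auto simp: E_def Int_stable_def image_iff)
    show "emeasure ?M X = emeasure ?N X" if "X \<in> E" for X
    proof -
      from that obtain a b where X: "X = {a<..b}" by (auto simp: E_def)
      show ?thesis
      proof (cases "a \<le> b")
        case True then show ?thesis by (simp only: X M N)
      qed (simp add: X)
    qed
    have borel: "sets borel = sigma_sets UNIV E"
      unfolding E_def by (subst borel_sigma_sets_Ioc) (simp add: sets_measure_of)
    show "sets ?M = sigma_sets UNIV E" "sets ?N = sigma_sets UNIV E" by (simp_all add: borel)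
    show "(\<Union>i. {- real i<..real i}) = UNIV"
    proof safe
      fix x :: real
      obtain n :: nat where "\<bar>x\<bar> < real n" using reals_Archimedean2 by blast
      then show "x \<in> (\<Union>i. {- real i<..real i})" by (intro UN_I[of n]) auto
    qed auto
  qed (auto simp: E_def M)
qed


section \<open>Integrals of radial complex powers\<close>

lemma norm_real_powr:
  "0 < x \<Longrightarrow> norm (complex_of_real x powr z) = x powr Re z"
  by (subst norm_powr_real_powr) auto

text \<open>The antiderivative \<open>(1 + u) powr (1 - z) / (1 - z)\<close> vanishes at infinity
  because \<open>1 < Re z\<close>, so the integral is minus its value at 0.\<close>

lemma has_bochner_integral_powr_ray:
  fixes z :: complex
  assumes z: "1 < Re z"
  shows "has_bochner_integral lborel (\<lambda>u. indicator {0<..} u *\<^sub>R complex_of_real (1 + u) powr (- z)) (1 / (z - 1))"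
proof -
  let ?f = "\<lambda>u. complex_of_real (1 + u) powr (- z)"
  have z1: "z - 1 \<noteq> 0" "1 - z \<noteq> 0" using z by auto
  have nonpos: "1 + complex_of_real u \<notin> \<real>\<^sub>\<le>\<^sub>0" if "-1 < u" for u
    using that by (auto simp: complex_nonpos_Reals_iff)
  have der: "((\<lambda>u. complex_of_real (1 + u) powr (1 - z) / (1 - z)) has_vector_derivative ?f u) (at u)"
    if "-1 < u" for u
  proof -
    have "((\<lambda>v. (1 + v) powr (1 - z) / (1 - z)) has_field_derivative ?f u) (at (of_real u))"
      using nonpos[OF that] z1 by (auto intro!: derivative_eq_intros)
    from has_vector_derivative_real_field[OF this] show ?thesis by (simp add: o_def)
  qed
  have cont: "continuous_on {-1<..} ?f"
    by (intro continuous_intros) (use nonpos in \<open>force+\<close>)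
  have meas: "(\<lambda>u. indicator {0<..} u *\<^sub>R ?f u) \<in> borel_measurable borel"
    using borel_measurable_continuous_on_indicator[of "{0<..}" ?f] continuous_on_subset[OF cont, of "{0<..}"]
    by auto
  have lim: "((\<lambda>u. complex_of_real (1 + u) powr (1 - z) / (1 - z)) \<longlongrightarrow> 0) at_top"
  proof (rule tendsto_norm_zero_cancel)
    have "((\<lambda>u::real. (1 + u) powr (1 - Re z) / norm (1 - z)) \<longlongrightarrow> 0 / norm (1 - z)) at_top"
      using z z1 by (intro tendsto_divide tendsto_neg_powr filterlim_tendsto_add_at_top[OF tendsto_const])
         (auto simp: filterlim_ident)
    moreover have "\<forall>\<^sub>F u::real in at_top. (1 + u) powr (1 - Re z) / norm (1 - z) =
        norm (complex_of_real (1 + u) powr (1 - z) / (1 - z))"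
      using eventually_gt_at_top[of 0] by eventually_elim (simp add: norm_divide norm_real_powr del: of_real_add)
    ultimately show "((\<lambda>u. norm (complex_of_real (1 + u) powr (1 - z) / (1 - z))) \<longlongrightarrow> 0) at_top"
      using tendsto_cong by fastforce
  qed
  \<comment> \<open>The fundamental theorem on an unbounded interval presupposes absolute
    integrability. The norm is a real power, whose integral is computed in the same way without
    convergence issues.\<close>
  have int: "set_integrable lborel {0<..} ?f"
    unfolding set_integrable_def
  proof (rule integrableI_bounded)
    show "(\<lambda>u. indicator {0<..} u *\<^sub>R ?f u) \<in> borel_measurable lborel" using meas by simp
    have "(\<integral>\<^sup>+u. ennreal (norm (indicator {0<..} u *\<^sub>R ?f u)) \<partial>lborel) \<le>
       (\<integral>\<^sup>+u. ennreal ((1 + u) powr (- Re z)) * indicator {0..} u \<partial>lborel)"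
      by (intro nn_integral_mono) (auto simp: indicator_def norm_real_powr simp del: of_real_add)
    also have "\<dots> = ennreal (0 - (1 + 0) powr (1 - Re z) / (1 - Re z))"
    proof (rule nn_integral_FTC_atLeast)
      show "((\<lambda>u. (1 + u) powr (1 - Re z) / (1 - Re z)) \<longlongrightarrow> 0) at_top"
        using z by (intro tendsto_divide_zero tendsto_neg_powr filterlim_tendsto_add_at_top[OF tendsto_const])
           (auto simp: filterlim_ident)
      show "((\<lambda>u. (1 + u) powr (1 - Re z) / (1 - Re z)) has_real_derivative (1 + u) powr (- Re z)) (at u)"
        if "0 \<le> u" for u
        using that z by (auto intro!: derivative_eq_intros)
    qed auto
    also have "\<dots> < \<infinity>" by simp
    finally show "(\<integral>\<^sup>+u. ennreal (norm (indicator {0<..} u *\<^sub>R ?f u)) \<partial>lborel) < \<infinity>" .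
  qed
  have "(LBINT u=0..\<infinity>. ?f u) = 0 - 1 / (1 - z)"
  proof (rule interval_integral_FTC_integrable)
    show "(((\<lambda>u. complex_of_real (1 + u) powr (1 - z) / (1 - z)) \<circ> real_of_ereal) \<longlongrightarrow> 1 / (1 - z)) (at_right 0)"
      unfolding zero_ereal_def o_def
    proof (rule ereal_tendsto_simps(2)[THEN iffD2, unfolded o_def])
      have "((\<lambda>u. complex_of_real (1 + u) powr (1 - z) / (1 - z)) \<longlongrightarrow> complex_of_real (1 + 0) powr (1 - z) / (1 - z)) (at 0)"
        using has_vector_derivative_continuous[OF der[of 0]] by (simp add: isCont_def)
      then show "((\<lambda>u. complex_of_real (1 + u) powr (1 - z) / (1 - z)) \<longlongrightarrow> 1 / (1 - z)) (at_right 0)"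
        by (simp add: filterlim_at_split)
    qed
    show "(((\<lambda>u. complex_of_real (1 + u) powr (1 - z) / (1 - z)) \<circ> real_of_ereal) \<longlongrightarrow> 0) (at_left \<infinity>)"
      using lim by (simp add: ereal_tendsto_simps)
    show "((\<lambda>u. complex_of_real (1 + u) powr (1 - z) / (1 - z)) has_vector_derivative ?f u) (at u)"
      if "(0::ereal) < ereal u" "ereal u < \<infinity>" for u using that by (intro der) (simp add: zero_ereal_def)
    show "isCont ?f u" if "(0::ereal) < ereal u" "ereal u < \<infinity>" for u
      using that cont by (simp add: continuous_on_eq_continuous_at zero_ereal_def)
    show "set_integrable lborel (einterval 0 \<infinity>) ?f"
      using int by (simp add: zero_ereal_def)
  qed simp
  moreover have "0 - 1 / (1 - z) = 1 / (z - 1)"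
    using z1 by (simp add: divide_simps)
  ultimately have "(LINT u|lborel. indicator {0<..} u *\<^sub>R ?f u) = 1 / (z - 1)"
    by (simp add: interval_lebesgue_integral_def zero_ereal_def set_lebesgue_integral_def)
  then show ?thesis
    using int by (simp add: has_bochner_integral_iff set_integrable_def)
qed

lemma has_bochner_integral_powr_plane:
  fixes z :: complex
  assumes z: "1 < Re z"
  shows "has_bochner_integral lborel (\<lambda>\<xi>::real^2. complex_of_real (1 + (norm \<xi>)\<^sup>2) powr (- z)) (pi / (z - 1))"
proof -
  let ?f = "\<lambda>u. complex_of_real (1 + u) powr (- z)"
  have meas[measurable]: "?f \<in> borel_measurable borel" 
    unfolding powr_def by measurable
  have dens: "density lborel (\<lambda>u. ennreal pi * indicator {0<..} u) =
       density lborel (\<lambda>u::real. ennreal (pi * indicator {0<..} u))"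
    by (intro arg_cong2[where f = density] ext refl) (auto simp: indicator_def)
  have "has_bochner_integral lborel (\<lambda>u. pi *\<^sub>R (indicator {0<..} u *\<^sub>R ?f u)) (pi *\<^sub>R (1 / (z - 1)))"
    by (intro has_bochner_integral_scaleR_right has_bochner_integral_powr_ray z)
  then have *: "has_bochner_integral lborel (\<lambda>u. (pi * indicator {0<..} u) *\<^sub>R ?f u) (pi / (z - 1))"
    by (simp add: scaleR_conv_of_real mult.assoc)
  have "has_bochner_integral (density lborel (\<lambda>u. ennreal (pi * indicator {0<..} u))) ?f (pi / (z - 1))"
    by (rule has_bochner_integral_density) (use * in auto)
  then have "has_bochner_integral (distr lborel borel (\<lambda>x :: real^2. (norm x)\<^sup>2)) ?f (pi / (z - 1))"
    by (simp only: distr_norm_square dens)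
  then show ?thesis
    by (simp add: has_bochner_integral_iff integrable_distr_eq integral_distr)
qed

lemma of_real_sqrt_powr:
  assumes "0 < y"
  shows "complex_of_real (sqrt y) powr z = complex_of_real y powr (z / 2)"
  using assms by (simp add: powr_def ln_sqrt Ln_of_real)

text \<open>This is \<open>alpha1\<close> at the centre of normal coordinates, where the metric is
  Euclidean, for \<open>lam = 1\<close>.\<close>

definition rho :: "real^2 \<Rightarrow> real" where
  "rho \<xi> = sqrt (1 + (norm \<xi>)\<^sup>2)"

lemma rho_pos: "0 < rho \<xi>"
  by (simp add: rho_def add_pos_nonneg)

lemma rho_square: "(rho \<xi>)\<^sup>2 = 1 + (norm \<xi>)\<^sup>2"
  by (simp add: rho_def)

lemma norm_square_2: "(norm (\<xi>::real^2))\<^sup>2 = (\<xi> $ 1)\<^sup>2 + (\<xi> $ 2)\<^sup>2"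
  by (simp add: norm_vec_def L2_set_def sum_2)

lemma rho_orthogonal: "orthogonal_transformation f \<Longrightarrow> rho (f \<xi>) = rho \<xi>"
  by (simp add: rho_def orthogonal_transformation)

text \<open>Isometries leave \<open>rho\<close> unchanged and so relate moments. The swap equates
  pure moments, the reflection annihilates the mixed quadratic one. The third map, a rotation by 45
  degrees up to a reflection, turns the product of the squared coordinates into a quarter of the
  square of their difference.\<close>

lemma orthogonal_transformation_swap: "orthogonal_transformation (\<lambda>\<xi>::real^2. vector [\<xi> $ 2, \<xi> $ 1] :: real^2)"
  and orthogonal_transformation_reflect: "orthogonal_transformation (\<lambda>\<xi>::real^2. vector [\<xi> $ 1, - \<xi> $ 2] :: real^2)"
  and orthogonal_transformation_diag: "orthogonal_transformation
    (\<lambda>\<xi>::real^2. vector [(\<xi> $ 1 + \<xi> $ 2) / sqrt 2, (\<xi> $ 1 - \<xi> $ 2) / sqrt 2] :: real^2)"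
proof -
  have sqrt2: "(a + b) / sqrt 2 * ((c + d) / sqrt 2) + (a - b) / sqrt 2 * ((c - d) / sqrt 2) = a * c + b * d"
    for a b c d :: real
    by (simp add: algebra_simps add_divide_distrib diff_divide_distrib)
  show "orthogonal_transformation (\<lambda>\<xi>::real^2. vector [\<xi> $ 2, \<xi> $ 1] :: real^2)"
    "orthogonal_transformation (\<lambda>\<xi>::real^2. vector [\<xi> $ 1, - \<xi> $ 2] :: real^2)"
    "orthogonal_transformation
      (\<lambda>\<xi>::real^2. vector [(\<xi> $ 1 + \<xi> $ 2) / sqrt 2, (\<xi> $ 1 - \<xi> $ 2) / sqrt 2] :: real^2)"
    unfolding orthogonal_transformation_def linear_iff vec_eq_iff forall_2 inner_vec_def sum_2 vector_2 inner_real_def sqrt2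
    by (auto simp: algebra_simps add_divide_distrib diff_divide_distrib)
qed

section \<open>Moments of degree 0, 2 and 4\<close>

lemma has_bochner_integral_rho:
  fixes s :: complex
  assumes s: "0 < Re s"
  shows "has_bochner_integral lborel (\<lambda>\<xi>. of_real (rho \<xi>) powr (- s - 2)) (2 * pi / s)"
proof -
  have "has_bochner_integral lborel (\<lambda>\<xi>::real^2. complex_of_real (1 + (norm \<xi>)\<^sup>2) powr (- (s / 2 + 1))) (pi / (s / 2 + 1 - 1))"
    using s by (intro has_bochner_integral_powr_plane) auto
  moreover have "complex_of_real (1 + (norm \<xi>)\<^sup>2) powr (- (s / 2 + 1)) = of_real (rho \<xi>) powr (- s - 2)" for \<xi> :: "real^2"
  proof -
    have "- (s / 2 + 1) = (- s - 2) / 2" by (simp add: field_simps)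
    show ?thesis
      unfolding rho_def \<open>- (s / 2 + 1) = (- s - 2) / 2\<close> by (subst of_real_sqrt_powr) (simp_all add: add_pos_nonneg del: of_real_add)
  qed
  ultimately show ?thesis by (simp add: field_simps)
qed

text \<open>The squared norm is \<open>rho^2 - 1\<close>. A factor of degree 2 is thereby traded for
  a difference of two powers of \<open>rho\<close>, and higher moments follow from the moment of
  degree 0 by shifting \<open>s\<close> by 2.\<close>

lemma rho_powr_add:
  fixes z :: complex
  shows "of_real (norm \<xi> ^ 2) * complex_of_real (rho \<xi>) powr (z - 2) = of_real (rho \<xi>) powr z - of_real (rho \<xi>) powr (z - 2)"
proof -
  have "complex_of_real (rho \<xi>) powr z = complex_of_real (rho \<xi>) powr (z - 2) * complex_of_real (rho \<xi>) powr 2"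
    using powr_add[of "complex_of_real (rho \<xi>)" "z - 2" 2] by simp
  also have "complex_of_real (rho \<xi>) powr 2 = of_real ((rho \<xi>)\<^sup>2)"
    using rho_pos[of \<xi>] by (simp add: powr_nat'[of 2, simplified])
  finally show ?thesis by (simp add: rho_square algebra_simps)
qed

lemma has_bochner_integral_rho_2:
  fixes s :: complex
  assumes s: "0 < Re s"
  shows "has_bochner_integral lborel (\<lambda>\<xi>. of_real ((norm \<xi>)\<^sup>2) * of_real (rho \<xi>) powr (- s - 4)) (4 * pi / (s * (s + 2)))"
proof -
  have nz: "s \<noteq> 0" "s + 2 \<noteq> 0" using s by (auto simp: complex_eq_iff)
  have "has_bochner_integral lborel (\<lambda>\<xi>. of_real (rho \<xi>) powr (- s - 2) - of_real (rho \<xi>) powr (- (s + 2) - 2))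
     (2 * pi / s - 2 * pi / (s + 2))"
    using s by (intro has_bochner_integral_diff has_bochner_integral_rho) auto
  moreover have "of_real (rho \<xi>) powr (- s - 2) - of_real (rho \<xi>) powr (- (s + 2) - 2) =
      of_real ((norm \<xi>)\<^sup>2) * of_real (rho \<xi>) powr (- s - 4)" for \<xi>
    using rho_powr_add[of \<xi> "- s - 2"] by (simp add: algebra_simps)
  moreover have "2 * pi / s - 2 * pi / (s + 2) = 4 * pi / (s * (s + 2))"
    using nz by (simp add: divide_simps) (simp add: algebra_simps)
  ultimately show ?thesis by simp
qed

lemma has_bochner_integral_rho_4:
  fixes s :: complex
  assumes s: "0 < Re s"
  shows "has_bochner_integral lborel (\<lambda>\<xi>. of_real ((norm \<xi>)^4) * of_real (rho \<xi>) powr (- s - 6)) (16 * pi / (s * (s + 2) * (s + 4)))"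
proof -
  have nz: "s \<noteq> 0" "s + 2 \<noteq> 0" "s + 4 \<noteq> 0" using s by (auto simp: complex_eq_iff)
  have eq: "4 * pi / (s * (s + 2)) - 4 * pi / ((s + 2) * ((s + 2) + 2)) = 16 * pi / (s * (s + 2) * (s + 4))"
    using nz by (simp add: divide_simps add.assoc) (simp add: algebra_simps)
  have "has_bochner_integral lborel (\<lambda>\<xi>. of_real ((norm \<xi>)\<^sup>2) * of_real (rho \<xi>) powr (- s - 4) -
      of_real ((norm \<xi>)\<^sup>2) * of_real (rho \<xi>) powr (- (s + 2) - 4))
     (4 * pi / (s * (s + 2)) - 4 * pi / ((s + 2) * ((s + 2) + 2)))"
    using s by (intro has_bochner_integral_diff has_bochner_integral_rho_2) auto
  moreover have "of_real ((norm \<xi>)\<^sup>2) * of_real (rho \<xi>) powr (- s - 4) -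
      of_real ((norm \<xi>)\<^sup>2) * of_real (rho \<xi>) powr (- (s + 2) - 4) =
      of_real ((norm \<xi>)^4) * of_real (rho \<xi>) powr (- s - 6)" for \<xi> :: "real^2"
  proof -
    have "of_real ((norm \<xi>)^4) * of_real (rho \<xi>) powr (- s - 6) =
       of_real ((norm \<xi>)\<^sup>2) * (of_real ((norm \<xi>)\<^sup>2) * of_real (rho \<xi>) powr ((- s - 4) - 2))"
      by (simp add: power4_eq_xxxx power2_eq_square algebra_simps)
    then show ?thesis unfolding rho_powr_add by (simp add: algebra_simps)
  qed
  ultimately show ?thesis unfolding eq by simp
qed

lemma rho_powr_measurable:
  fixes z :: complex
  shows "(\<lambda>\<xi>. of_real (rho \<xi>) powr z) \<in> borel_measurable borel"
  unfolding powr_def rho_def by measurable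

lemma integrable_rho_bounded:
  fixes z :: complex
  assumes I: "integrable lborel (\<lambda>\<xi>. of_real (n \<xi>) * of_real (rho \<xi>) powr z)"
    and m[measurable]: "m \<in> borel_measurable borel" and le: "\<And>\<xi>. \<bar>m \<xi>\<bar> \<le> \<bar>n \<xi>\<bar>"
  shows "integrable lborel (\<lambda>\<xi>. of_real (m \<xi>) * of_real (rho \<xi>) powr z :: complex)"
  using I
proof (rule Bochner_Integration.integrable_bound)
  show "(\<lambda>\<xi>. of_real (m \<xi>) * of_real (rho \<xi>) powr z :: complex) \<in> borel_measurable lborel"
    using rho_powr_measurable by simp
qed (use le in \<open>auto simp: norm_mult intro!: mult_right_mono\<close>)

text \<open>By the swap each square receives half of the radial integral, and by the reflection the
  mixed moment equals its negative. Each monomial is integrable because it is dominated by the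
  squared norm.\<close>

lemma has_bochner_integral_rho_quadratic:
  fixes s :: complex
  assumes s: "0 < Re s"
  defines "I \<equiv> 2 * pi / (s * (s + 2))"
  shows "has_bochner_integral lborel (\<lambda>\<xi>. of_real ((\<xi> $ 1)\<^sup>2) * of_real (rho \<xi>) powr (- s - 4)) I"
    and "has_bochner_integral lborel (\<lambda>\<xi>. of_real ((\<xi> $ 2)\<^sup>2) * of_real (rho \<xi>) powr (- s - 4)) I"
    and "has_bochner_integral lborel (\<lambda>\<xi>. of_real (\<xi> $ 1 * \<xi> $ 2) * of_real (rho \<xi>) powr (- s - 4)) 0"
proof -
  define F where "F m \<xi> = of_real (m \<xi>) * complex_of_real (rho \<xi>) powr (- s - 4)" for m and \<xi> :: "real^2"
  have int: "integrable lborel (F m)" if "m \<in> borel_measurable borel" "\<And>\<xi>. \<bar>m \<xi>\<bar> \<le> (norm \<xi>)\<^sup>2" for m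
    unfolding F_def
    by (rule integrable_rho_bounded[OF _ that(1), of "\<lambda>\<xi>. (norm \<xi>)\<^sup>2"])
       (use has_bochner_integral_rho_2[OF s] that in \<open>auto simp: has_bochner_integral_iff\<close>)
  have symm: "integral\<^sup>L lborel (F (\<lambda>\<xi>. m (f \<xi>))) = integral\<^sup>L lborel (F m)"
    if "orthogonal_transformation f" "integrable lborel (F m)" for m f
    using has_bochner_integral_orthogonal[OF that(1), of "F m" "integral\<^sup>L lborel (F m)"] that
    by (simp add: has_bochner_integral_iff F_def[abs_def] rho_orthogonal)
  have i1: "integrable lborel (F (\<lambda>\<xi>. (\<xi> $ 1)\<^sup>2))" and i2: "integrable lborel (F (\<lambda>\<xi>. (\<xi> $ 2)\<^sup>2))"
    by (intro int; simp add: norm_square_2)+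
  have i12: "integrable lborel (F (\<lambda>\<xi>. \<xi> $ 1 * \<xi> $ 2))"
  proof (rule int)
    fix \<xi> :: "real^2"
    have "2 * \<bar>\<xi> $ 1\<bar> * \<bar>\<xi> $ 2\<bar> \<le> \<bar>\<xi> $ 1\<bar>\<^sup>2 + \<bar>\<xi> $ 2\<bar>\<^sup>2"
      by (rule sum_squares_bound)
    moreover have "0 \<le> \<bar>\<xi> $ 1\<bar> * \<bar>\<xi> $ 2\<bar>" by simp
    ultimately show "\<bar>\<xi> $ 1 * \<xi> $ 2\<bar> \<le> (norm \<xi>)\<^sup>2"
      unfolding norm_square_2 abs_mult by (simp only: mult.assoc power2_abs)
  qed simp
  have "integral\<^sup>L lborel (F (\<lambda>\<xi>. (\<xi> $ 1)\<^sup>2)) + integral\<^sup>L lborel (F (\<lambda>\<xi>. (\<xi> $ 2)\<^sup>2)) =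
    integral\<^sup>L lborel (\<lambda>\<xi>. F (\<lambda>\<xi>. (\<xi> $ 1)\<^sup>2) \<xi> + F (\<lambda>\<xi>. (\<xi> $ 2)\<^sup>2) \<xi>)"
    using i1 i2 by simp
  also have "\<dots> = 2 * I"
    using has_bochner_integral_rho_2[OF s]
    by (simp add: has_bochner_integral_iff F_def norm_square_2 I_def distrib_right)
  finally have sum: "integral\<^sup>L lborel (F (\<lambda>\<xi>. (\<xi> $ 1)\<^sup>2)) + integral\<^sup>L lborel (F (\<lambda>\<xi>. (\<xi> $ 2)\<^sup>2)) = 2 * I" .
  have e12: "integral\<^sup>L lborel (F (\<lambda>\<xi>. (\<xi> $ 2)\<^sup>2)) = integral\<^sup>L lborel (F (\<lambda>\<xi>. (\<xi> $ 1)\<^sup>2))"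
    using symm[OF orthogonal_transformation_swap i1] by simp
  have "integral\<^sup>L lborel (F (\<lambda>\<xi>. - (\<xi> $ 1 * \<xi> $ 2))) = integral\<^sup>L lborel (F (\<lambda>\<xi>. \<xi> $ 1 * \<xi> $ 2))"
    using symm[OF orthogonal_transformation_reflect i12] by simp
  moreover have "integral\<^sup>L lborel (F (\<lambda>\<xi>. - (\<xi> $ 1 * \<xi> $ 2))) = - integral\<^sup>L lborel (F (\<lambda>\<xi>. \<xi> $ 1 * \<xi> $ 2))"
    by (simp add: F_def[abs_def])
  ultimately have "integral\<^sup>L lborel (F (\<lambda>\<xi>. \<xi> $ 1 * \<xi> $ 2)) = 0" by simp
  then show "has_bochner_integral lborel (\<lambda>\<xi>. of_real ((\<xi> $ 1)\<^sup>2) * of_real (rho \<xi>) powr (- s - 4)) I"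
    and "has_bochner_integral lborel (\<lambda>\<xi>. of_real ((\<xi> $ 2)\<^sup>2) * of_real (rho \<xi>) powr (- s - 4)) I"
    and "has_bochner_integral lborel (\<lambda>\<xi>. of_real (\<xi> $ 1 * \<xi> $ 2) * of_real (rho \<xi>) powr (- s - 4)) 0"
    using sum e12 i1 i2 i12 by (simp_all add: has_bochner_integral_iff F_def[abs_def])
qed

text \<open>Three linear relations determine the pure moments \<open>?A\<close>, \<open>?B\<close>
  and the mixed moment \<open>?C\<close>: the radial integral gives
  \<open>?A + ?B + 2 * ?C = 8 * I\<close>, the swap gives \<open>?A = ?B\<close>, and the diagonal
  isometry gives \<open>4 * ?C = ?A + ?B - 2 * ?C\<close>. Their ratio is 3 : 3 : 1.\<close>

lemma has_bochner_integral_rho_quartic: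
  fixes s :: complex
  assumes s: "0 < Re s"
  defines "I \<equiv> 2 * pi / (s * (s + 2) * (s + 4))"
  shows "has_bochner_integral lborel (\<lambda>\<xi>. of_real ((\<xi> $ 1)^4) * of_real (rho \<xi>) powr (- s - 6)) (3 * I)"
    and "has_bochner_integral lborel (\<lambda>\<xi>. of_real ((\<xi> $ 2)^4) * of_real (rho \<xi>) powr (- s - 6)) (3 * I)"
    and "has_bochner_integral lborel (\<lambda>\<xi>. of_real ((\<xi> $ 1)\<^sup>2 * (\<xi> $ 2)\<^sup>2) * of_real (rho \<xi>) powr (- s - 6)) I"
proof -
  define F where "F m \<xi> = of_real (m \<xi>) * complex_of_real (rho \<xi>) powr (- s - 6)" for m and \<xi> :: "real^2"
  have int: "integrable lborel (F m)" if "m \<in> borel_measurable borel" "\<And>\<xi>. \<bar>m \<xi>\<bar> \<le> (norm \<xi>)^4" for m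
    unfolding F_def
    by (rule integrable_rho_bounded[OF _ that(1), of "\<lambda>\<xi>. (norm \<xi>)^4"])
       (use has_bochner_integral_rho_4[OF s] that in \<open>auto simp: has_bochner_integral_iff\<close>)
  have symm: "integral\<^sup>L lborel (F (\<lambda>\<xi>. m (f \<xi>))) = integral\<^sup>L lborel (F m)"
    if "orthogonal_transformation f" "integrable lborel (F m)" for m f
    using has_bochner_integral_orthogonal[OF that(1), of "F m" "integral\<^sup>L lborel (F m)"] that
    by (simp add: has_bochner_integral_iff F_def[abs_def] rho_orthogonal)
  have n4: "(norm \<xi>)^4 = (\<xi> $ 1)^4 + (\<xi> $ 2)^4 + 2 * ((\<xi> $ 1)\<^sup>2 * (\<xi> $ 2)\<^sup>2)" for \<xi> :: "real^2"
  proof -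
    have "(norm \<xi>)^4 = ((norm \<xi>)\<^sup>2)\<^sup>2" by simp
    then show ?thesis unfolding norm_square_2 by (simp add: power2_eq_square power4_eq_xxxx algebra_simps)
  qed
  have i1: "integrable lborel (F (\<lambda>\<xi>. (\<xi> $ 1)^4))" and i2: "integrable lborel (F (\<lambda>\<xi>. (\<xi> $ 2)^4))"
    and i12: "integrable lborel (F (\<lambda>\<xi>. (\<xi> $ 1)\<^sup>2 * (\<xi> $ 2)\<^sup>2))"
    by (intro int; simp add: n4 abs_mult)+
  let ?A = "integral\<^sup>L lborel (F (\<lambda>\<xi>. (\<xi> $ 1)^4))" and ?B = "integral\<^sup>L lborel (F (\<lambda>\<xi>. (\<xi> $ 2)^4))"
    and ?C = "integral\<^sup>L lborel (F (\<lambda>\<xi>. (\<xi> $ 1)\<^sup>2 * (\<xi> $ 2)\<^sup>2))"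
  have "?A + ?B + 2 * ?C = integral\<^sup>L lborel (\<lambda>\<xi>. F (\<lambda>\<xi>. (\<xi> $ 1)^4) \<xi> + F (\<lambda>\<xi>. (\<xi> $ 2)^4) \<xi> +
      2 * F (\<lambda>\<xi>. (\<xi> $ 1)\<^sup>2 * (\<xi> $ 2)\<^sup>2) \<xi>)"
    using i1 i2 i12 by simp
  also have "\<dots> = 8 * I"
    using has_bochner_integral_rho_4[OF s]
    by (simp add: has_bochner_integral_iff F_def n4 I_def distrib_right mult.assoc)
  finally have sum: "?A + ?B + 2 * ?C = 8 * I" .
  have AB: "?B = ?A"
    using symm[OF orthogonal_transformation_swap i1] by simp
  have sq: "((x + y) / sqrt 2)\<^sup>2 * ((x - y) / sqrt 2)\<^sup>2 = 1/4 * (x^4 + y^4 - 2 * (x\<^sup>2 * y\<^sup>2))" for x y :: real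
    by (simp add: power_divide power2_eq_square power4_eq_xxxx field_simps)
  have "?C = integral\<^sup>L lborel (F (\<lambda>\<xi>. 1/4 * ((\<xi> $ 1)^4 + (\<xi> $ 2)^4 - 2 * ((\<xi> $ 1)\<^sup>2 * (\<xi> $ 2)\<^sup>2))))"
    using symm[OF orthogonal_transformation_diag i12] by (simp add: sq)
  also have "\<dots> = integral\<^sup>L lborel (\<lambda>\<xi>. 1/4 * (F (\<lambda>\<xi>. (\<xi> $ 1)^4) \<xi> + F (\<lambda>\<xi>. (\<xi> $ 2)^4) \<xi> -
      2 * F (\<lambda>\<xi>. (\<xi> $ 1)\<^sup>2 * (\<xi> $ 2)\<^sup>2) \<xi>))"
    by (intro Bochner_Integration.integral_cong) (auto simp: F_def algebra_simps)
  also have "\<dots> = 1/4 * (?A + ?B - 2 * ?C)"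
    using i1 i2 i12 by simp
  finally have "4 * ?C = ?A + ?B - 2 * ?C" by simp
  then have "8 * ?C = 8 * I" "2 * ?A = 6 * ?C" using sum AB by algebra+
  then have "?C = I" "?A = 3 * I" by simp_all
  then show "has_bochner_integral lborel (\<lambda>\<xi>. of_real ((\<xi> $ 1)^4) * of_real (rho \<xi>) powr (- s - 6)) (3 * I)"
    and "has_bochner_integral lborel (\<lambda>\<xi>. of_real ((\<xi> $ 2)^4) * of_real (rho \<xi>) powr (- s - 6)) (3 * I)"
    and "has_bochner_integral lborel (\<lambda>\<xi>. of_real ((\<xi> $ 1)\<^sup>2 * (\<xi> $ 2)\<^sup>2) * of_real (rho \<xi>) powr (- s - 6)) I"
    using AB i1 i2 i12 by (simp_all add: has_bochner_integral_iff F_def[abs_def])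
qed


section \<open>Meromorphic continuation\<close>

text \<open>This is the identity theorem. The difference vanishes on a half-plane; after removal of
  its singularities it vanishes everywhere, so \<open>J\<close> and \<open>F\<close> agree on a
  punctured neighbourhood of \<open>a\<close>.\<close>

lemma nicely_meromorphic_eq_near:
  assumes J: "J nicely_meromorphic_on UNIV" and F: "F meromorphic_on UNIV" "F analytic_on {a}"
    and eq: "\<And>s. b < Re s \<Longrightarrow> J s = F s"
  shows "eventually (\<lambda>s. J s = F s) (nhds a)"
proof -
  let ?D = "\<lambda>s. J s - F s"
  have mer: "?D meromorphic_on UNIV"
    using J F by (intro meromorphic_intros) (auto simp: nicely_meromorphic_on_def)
  have iso: "isolated_singularity_at ?D z" for z
    by (rule meromorphic_on_isolated_singularity[OF meromorphic_on_subset[OF mer]]) simp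
  have "eventually (\<lambda>s. s \<in> {s. b < Re s} - {of_real (b + 1)}) (at (complex_of_real (b + 1)))"
    by (intro eventually_at_in_open) (auto simp: open_halfspace_Re_gt)
  then have "eventually (\<lambda>s. ?D s = 0) (at (complex_of_real (b + 1)))"
    by eventually_elim (simp add: eq)
  moreover have "eventually (\<lambda>s. remove_sings ?D s = ?D s) (at (complex_of_real (b + 1)))"
    using iso by (intro eventually_remove_sings_eq_at) auto
  ultimately have "eventually (\<lambda>s. remove_sings ?D s = 0) (at (complex_of_real (b + 1)))"
    by eventually_elim simp
  then have "frequently (\<lambda>s. remove_sings ?D s = 0) (at (complex_of_real (b + 1)))"
    by (intro eventually_frequently) auto
  from frequently_eq_meromorphic_imp_constant[OF this remove_sings_nicely_meromorphic[OF mer]]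
  have zero: "remove_sings ?D s = 0" for s by auto
  have "eventually (\<lambda>s. remove_sings ?D s = ?D s) (at a)"
    using iso by (intro eventually_remove_sings_eq_at) auto
  then have ev: "eventually (\<lambda>s. J s = F s) (at a)"
    by eventually_elim (simp add: zero)
  \<comment> \<open>At \<open>a\<close> itself the continuity of \<open>F\<close> gives
    \<open>J\<close> a finite limit, which excludes a pole; a nicely meromorphic function then takes
    its limit as value.\<close>
  have limF: "F \<midarrow>a\<rightarrow> F a"
    using F(2) by (intro isContD analytic_at_imp_isCont)
  have limJ: "J \<midarrow>a\<rightarrow> F a"
    using limF tendsto_cong[OF ev] by simp
  then have "\<not> is_pole J a"
    unfolding is_pole_def using not_tendsto_and_filterlim_at_infinity[OF _ limJ] by auto
  then have "J \<midarrow>a\<rightarrow> J a" using J by (auto simp: nicely_meromorphic_on_def)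
  then have "J a = F a" using limJ LIM_unique by blast
  with ev show ?thesis by (auto simp: eventually_nhds_conv_at)
qed

text \<open>
  The parameters are the coefficients of the moments of degree 0, 2 and 4 in the double pole, and of
  degree 2 in the triple pole, of the trace of $r_{-3}$.
\<close>

definition J2_profile :: "complex \<Rightarrow> complex \<Rightarrow> complex \<Rightarrow> complex \<Rightarrow> complex \<Rightarrow> complex" where
  "J2_profile m0 m k n s = 2 powr (- s) / (2 * pi) *
     (- (m0 + m / (s + 2) + k / ((s + 2) * (s + 4))) / 2 + n * (s + 1) / (8 * (s + 2)))"

lemma J2_profile_meromorphic: "J2_profile m0 m k n meromorphic_on UNIV"
  unfolding J2_profile_def[abs_def] by (intro meromorphic_intros analytic_intros analytic_on_imp_meromorphic_on) auto

lemma J2_profile_analytic: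
  assumes "s \<noteq> -2" "s \<noteq> -4"
  shows "J2_profile m0 m k n analytic_on {s}"
proof -
  have nz: "s + 2 \<noteq> 0" "s + 4 \<noteq> 0" using assms by (auto simp: eq_neg_iff_add_eq_0)
  moreover have "8 * s + 16 \<noteq> 0" using nz(1) by (auto simp: add_eq_0_iff2)
  ultimately show ?thesis
    unfolding J2_profile_def[abs_def] by (intro analytic_intros) auto
qed

lemma J2_profile_0: "J2_profile m0 m k n 0 = (- (m0 + m / 2 + k / 8) / 2 + n / 16) / (2 * pi)"
  by (simp add: J2_profile_def)

text \<open>Differentiating \<open>2 powr (- s)\<close> reproduces the value with factor
  \<open>- ln 2\<close>. The terms in \<open>m\<close>, \<open>k\<close> and \<open>n\<close> of the
  rational factor have derivatives \<open>m / 8\<close>, \<open>3 * k / 64\<close> and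
  \<open>n / 32\<close> at 0; the term \<open>m0\<close> is constant.\<close>

lemma deriv_J2_profile_0:
  "deriv (J2_profile m0 m k n) 0 = - ln 2 * J2_profile m0 m k n 0 + (m / 8 + 3 * k / 64 + n / 32) / (2 * pi)"
proof -
  let ?G = "\<lambda>s. - (m0 + m / (s + 2) + k / ((s + 2) * (s + 4))) / 2 + n * (s + 1) / (8 * (s + 2))"
  have "((\<lambda>s::complex. exp (- s * ln 2)) has_field_derivative - ln 2) (at 0)"
    by (auto intro!: derivative_eq_intros)
  then have 1: "((\<lambda>s::complex. 2 powr (- s)) has_field_derivative - ln 2) (at 0)"
    by (simp add: powr_def)
  have 2: "(?G has_field_derivative m / 8 + 3 * k / 64 + n / 32) (at 0)"
    by (auto intro!: derivative_eq_intros simp: field_simps)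
  define g where "g = ?G 0"
  have "((\<lambda>s. 2 powr (- s) * ?G s / (2 * pi)) has_field_derivative
     (2 powr (- 0) * (m / 8 + 3 * k / 64 + n / 32) + - ln 2 * ?G 0) / (2 * pi)) (at 0)"
    by (intro DERIV_cdivide DERIV_mult' 1 2)
  moreover have "J2_profile m0 m k n = (\<lambda>s. 2 powr (- s) * ?G s / (2 * pi))"
    by (simp add: J2_profile_def fun_eq_iff)
  ultimately have "deriv (J2_profile m0 m k n) 0 =
     (2 powr (- 0) * (m / 8 + 3 * k / 64 + n / 32) + - ln 2 * g) / (2 * pi)"
    by (simp only: DERIV_imp_deriv g_def)
  moreover have "J2_profile m0 m k n 0 = g / (2 * pi)"
    by (simp add: J2_profile_def g_def)
  moreover have "(2 powr (- 0) * B + - l * g) / c = - l * (g / c) + B / c" for B l c :: complex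
    by (simp add: diff_divide_distrib)
  ultimately show ?thesis by (simp only:)
qed

section \<open>Evaluation and continuation of the integral\<close>

context
  fixes h :: "real \<Rightarrow> real^2 \<Rightarrow> real^2^2"
    and w :: "3 \<Rightarrow> real \<Rightarrow> real^2 \<Rightarrow> complex^'r::finite^'r"
    and e :: "real \<Rightarrow> real^2 \<Rightarrow> complex^'r^'r"
    and \<gamma> :: "real^2 \<Rightarrow> real \<Rightarrow> complex"
    and m0 m11 m12 m22 k11 k12 k22 n11 n12 n22 :: complex
  assumes adm: "admissible_contours h \<gamma>"
    and root: "\<And>\<xi>. root1 h 1 0 0 \<xi> = of_real (rho \<xi>)"
    and tr: "\<And>\<xi> \<mu>. \<mu> \<noteq> 2 * of_real (rho \<xi>) \<Longrightarrow>
      trace (r_minus3 h w e 1 \<mu> 0 \<xi>) =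
        (m0 + (m11 * of_real ((\<xi> $ 1)\<^sup>2) + m12 * of_real (\<xi> $ 1 * \<xi> $ 2) + m22 * of_real ((\<xi> $ 2)\<^sup>2)) / (of_real (rho \<xi>))\<^sup>2
          + (k11 * of_real ((\<xi> $ 1)^4) + k12 * of_real ((\<xi> $ 1)\<^sup>2 * (\<xi> $ 2)\<^sup>2) + k22 * of_real ((\<xi> $ 2)^4)) / of_real (rho \<xi>)^4)
        / of_real (rho \<xi>) / (\<mu> - 2 * of_real (rho \<xi>))\<^sup>2
        + (n11 * of_real ((\<xi> $ 1)\<^sup>2) + n12 * of_real (\<xi> $ 1 * \<xi> $ 2) + n22 * of_real ((\<xi> $ 2)\<^sup>2)) / (of_real (rho \<xi>))\<^sup>2
        / (\<mu> - 2 * of_real (rho \<xi>)) ^ 3"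
begin

text \<open>Each pair of coordinate factors comes with two inverse powers of \<open>rho\<close>, so
  every term is one of the moments above. The factors \<open>- 1/2\<close> and
  \<open>(s + 1) / 8\<close> collect the powers of 2 from \<open>2 powr (- s - 1)\<close> and from
  half of \<open>2 powr (- s - 2)\<close>.\<close>

private lemma density:
  "J2_density h w e \<gamma> s \<xi> = s * 2 powr (- s) * (- (1/2) *
     (m0 * of_real (rho \<xi>) powr (- s - 2)
      + (m11 * (of_real ((\<xi> $ 1)\<^sup>2) * of_real (rho \<xi>) powr (- s - 4))
         + m12 * (of_real (\<xi> $ 1 * \<xi> $ 2) * of_real (rho \<xi>) powr (- s - 4))
         + m22 * (of_real ((\<xi> $ 2)\<^sup>2) * of_real (rho \<xi>) powr (- s - 4)))
      + (k11 * (of_real ((\<xi> $ 1)^4) * of_real (rho \<xi>) powr (- s - 6))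
         + k12 * (of_real ((\<xi> $ 1)\<^sup>2 * (\<xi> $ 2)\<^sup>2) * of_real (rho \<xi>) powr (- s - 6))
         + k22 * (of_real ((\<xi> $ 2)^4) * of_real (rho \<xi>) powr (- s - 6))))
     + (s + 1) / 8 * (n11 * (of_real ((\<xi> $ 1)\<^sup>2) * of_real (rho \<xi>) powr (- s - 4))
         + n12 * (of_real (\<xi> $ 1 * \<xi> $ 2) * of_real (rho \<xi>) powr (- s - 4))
         + n22 * (of_real ((\<xi> $ 2)\<^sup>2) * of_real (rho \<xi>) powr (- s - 4))))"
proof -
  define a where "a = complex_of_real (rho \<xi>)"
  have a: "a \<noteq> 0" using rho_pos[of \<xi>] by (simp add: a_def)
  have pw: "a powr (z - 1) = a powr z / a" "a powr (z - 2) = a powr z / a\<^sup>2"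
    "a powr (z - 4) = a powr z / a ^ 4" "a powr (z - 6) = a powr z / a ^ 6" for z
    using a by (simp_all add: powr_diff powr_nat')
  have 2: "(2 * a) powr z = 2 powr z * a powr z" for z
    unfolding a_def using rho_pos[of \<xi>] powr_times_real[of "2" "of_real (rho \<xi>)" z] by simp
  have two: "(2::complex) powr (- s - 1) = 2 powr (- s) / 2" "(2::complex) powr (- s - 2) = 2 powr (- s) / 4"
    by (simp_all add: powr_diff powr_nat')
  from adm have adm': "valid_path (\<gamma> \<xi>)" "pathfinish (\<gamma> \<xi>) = pathstart (\<gamma> \<xi>)"
    "path_image (\<gamma> \<xi>) \<subseteq> - (\<real>\<^sub>\<le>\<^sub>0 \<union> {2 * a})" "winding_number (\<gamma> \<xi>) (2 * a) = 1"
    by (auto simp: admissible_contours_def root a_def)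
  have "2 * a = complex_of_real (2 * rho \<xi>)" by (simp add: a_def)
  then have pos: "2 * a \<notin> \<real>\<^sub>\<le>\<^sub>0" using rho_pos[of \<xi>] by (simp only: nonpos_Reals_of_real_iff)
  have "J2_density h w e \<gamma> s \<xi> = 
    (m0 + (m11 * of_real ((\<xi> $ 1)\<^sup>2) + m12 * of_real (\<xi> $ 1 * \<xi> $ 2) + m22 * of_real ((\<xi> $ 2)\<^sup>2)) / a\<^sup>2
          + (k11 * of_real ((\<xi> $ 1)^4) + k12 * of_real ((\<xi> $ 1)\<^sup>2 * (\<xi> $ 2)\<^sup>2) + k22 * of_real ((\<xi> $ 2)^4)) / a^4) / a
     * (- s * (2 * a) powr (- s - 1)) +
    (n11 * of_real ((\<xi> $ 1)\<^sup>2) + n12 * of_real (\<xi> $ 1 * \<xi> $ 2) + n22 * of_real ((\<xi> $ 2)\<^sup>2)) / a\<^sup>2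
     * (s * (s + 1) / 2 * (2 * a) powr (- s - 2))"
    unfolding J2_density_def
    by (rule contour_integral_powr_two_poles[OF adm' pos]) (simp add: tr a_def)
  also have "\<dots> = s * 2 powr (- s) * a powr (- s) * (- (1/2) *
     (m0 / a\<^sup>2 
      + (m11 * of_real ((\<xi> $ 1)\<^sup>2) + m12 * of_real (\<xi> $ 1 * \<xi> $ 2) + m22 * of_real ((\<xi> $ 2)\<^sup>2)) / a^4
      + (k11 * of_real ((\<xi> $ 1)^4) + k12 * of_real ((\<xi> $ 1)\<^sup>2 * (\<xi> $ 2)\<^sup>2) + k22 * of_real ((\<xi> $ 2)^4)) / a^6)
     + (s + 1) / 8 * (n11 * of_real ((\<xi> $ 1)\<^sup>2) + n12 * of_real (\<xi> $ 1 * \<xi> $ 2) + n22 * of_real ((\<xi> $ 2)\<^sup>2)) / a^4)"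
    unfolding 2 two pw using a by (simp add: power2_eq_square eval_nat_numeral field_simps)
  finally show ?thesis unfolding a_def[symmetric] pw by (simp add: algebra_simps add_divide_distrib)
qed

text \<open>All moments share the factor \<open>1 / s\<close>, which the prefactor \<open>s\<close>
  of the density cancels. The mixed quadratic moments vanish, and the weights 3, 1, 3 are the
  quartic averages.\<close>

private lemma has_bochner_integral_density:
  assumes s: "0 < Re s"
  shows "has_bochner_integral lborel (J2_density h w e \<gamma> s)
     ((2 * pi)\<^sup>2 * J2_profile m0 (m11 + m22) (3 * k11 + k12 + 3 * k22) (n11 + n22) s)"
proof -
  have nz: "s \<noteq> 0" "s + 2 \<noteq> 0" "s + 4 \<noteq> 0" using s by (auto simp: complex_eq_iff)
  note Q = has_bochner_integral_rho_quadratic[OF s] and R = has_bochner_integral_rho_quartic[OF s]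
    and P = has_bochner_integral_rho[OF s]
  define I2 where "I2 = 2 * pi / (s * (s + 2))"
  define I4 where "I4 = 2 * pi / (s * (s + 2) * (s + 4))"
  have "has_bochner_integral lborel (J2_density h w e \<gamma> s)
     (s * 2 powr (- s) * (- (1/2) * (m0 * (2 * pi / s) + (m11 * I2 + m12 * 0 + m22 * I2)
       + (k11 * (3 * I4) + k12 * I4 + k22 * (3 * I4))) + (s + 1) / 8 * (n11 * I2 + n12 * 0 + n22 * I2)))"
    unfolding density I2_def I4_def
    by (intro has_bochner_integral_add has_bochner_integral_mult_right P Q R)
  moreover have "s * 2 powr (- s) * (- (1/2) * (m0 * (2 * pi / s) + (m11 * I2 + m12 * 0 + m22 * I2)
       + (k11 * (3 * I4) + k12 * I4 + k22 * (3 * I4))) + (s + 1) / 8 * (n11 * I2 + n12 * 0 + n22 * I2)) =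
     (2 * pi)\<^sup>2 * J2_profile m0 (m11 + m22) (3 * k11 + k12 + 3 * k22) (n11 + n22) s"
  proof -
    have I0: "s * (2 * complex_of_real pi / s) = 2 * complex_of_real pi"
      using nz by simp
    have I: "s * I2 = 2 * pi / (s + 2)" "s * I4 = 2 * pi / ((s + 2) * (s + 4))"
      using nz by (simp_all add: I2_def I4_def)
    have "s * 2 powr (- s) * (- (1/2) * (m0 * (2 * pi / s) + (m11 * I2 + m12 * 0 + m22 * I2)
       + (k11 * (3 * I4) + k12 * I4 + k22 * (3 * I4))) + (s + 1) / 8 * (n11 * I2 + n12 * 0 + n22 * I2)) =
       2 powr (- s) * (- (1/2) * (m0 * (s * (2 * pi / s)) + (m11 + m22) * (s * I2)
        + (3 * k11 + k12 + 3 * k22) * (s * I4)) + (s + 1) / 8 * ((n11 + n22) * (s * I2)))"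
      by (simp add: field_simps)
    also have "\<dots> = (2 * pi)\<^sup>2 * J2_profile m0 (m11 + m22) (3 * k11 + k12 + 3 * k22) (n11 + n22) s"
    proof -
      have alg: "P * (- (1/2) * (m0 * (2 * c) + m * (2 * c / u) + k * (2 * c / (u * v))) + (s + 1) / 8 * (n * (2 * c / u))) =
         (2 * c)\<^sup>2 * (P / (2 * c) * (- (m0 + m / u + k / (u * v)) / 2 + n * (s + 1) / (8 * u)))"
        if "c \<noteq> 0" "u \<noteq> 0" "v \<noteq> 0" for P c u v m k n :: complex
        using that by (simp add: field_simps power2_eq_square)
      show ?thesis
        unfolding I J2_profile_def of_real_mult of_real_numeral of_real_power I0 by (rule alg) (use nz in auto)
    qed
    finally show ?thesis .
  qed
  ultimately show ?thesis by simp
qed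

lemma is_J2_profile:
  defines "F \<equiv> J2_profile m0 (m11 + m22) (3 * k11 + k12 + 3 * k22) (n11 + n22)"
  shows "\<exists>J. is_J2 h w e \<gamma> J"
    and "is_J2 h w e \<gamma> J \<Longrightarrow> eventually (\<lambda>s. J s = F s) (nhds 0)"
proof -
  have F: "integrable lborel (J2_density h w e \<gamma> s)"
    "1 / (2 * pi)\<^sup>2 * (LINT \<xi>|lborel. J2_density h w e \<gamma> s \<xi>) = F s" if "0 < Re s" for s
    using has_bochner_integral_density[OF that] by (auto simp: has_bochner_integral_iff F_def)
  \<comment> \<open>At -2 and -4 the profile divides by zero and has merely conventional values
    there. Removing singularities makes it nicely meromorphic and changes nothing in the right
    half-plane.\<close>
  have "is_J2 h w e \<gamma> (remove_sings F)"
    unfolding is_J2_def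
  proof (intro conjI exI[of _ 0] allI impI)
    show "remove_sings F nicely_meromorphic_on UNIV"
      by (intro remove_sings_nicely_meromorphic) (simp add: F_def J2_profile_meromorphic)
    fix s :: complex assume s: "0 < Re s"
    then have "s \<noteq> -2" "s \<noteq> -4" by auto
    then have "F analytic_on {s}" unfolding F_def by (rule J2_profile_analytic)
    then show "remove_sings F s = 1 / (2 * pi)\<^sup>2 * (LINT \<xi>|lborel. J2_density h w e \<gamma> s \<xi>)"
      using F(2)[OF s] by simp
  qed (use F in auto)
  then show "\<exists>J. is_J2 h w e \<gamma> J" by blast
  assume "is_J2 h w e \<gamma> J"
  then obtain s0 where J: "J nicely_meromorphic_on UNIV"
    "\<And>s. s0 < Re s \<Longrightarrow> J s = 1 / (2 * pi)\<^sup>2 * (LINT \<xi>|lborel. J2_density h w e \<gamma> s \<xi>)"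
    by (auto simp: is_J2_def)
  show "eventually (\<lambda>s. J s = F s) (nhds 0)"
  proof (rule nicely_meromorphic_eq_near[OF J(1), of _ _ "max 0 s0"])
    show "F meromorphic_on UNIV" "F analytic_on {0}"
      unfolding F_def by (auto intro: J2_profile_meromorphic J2_profile_analytic)
  qed (use J F in auto)
qed

end


section \<open>Derivatives along coordinate lines\<close>

text \<open>The relational companion of \<open>pd\<close>. It includes the existence of the
  derivative, which a value of \<open>pd\<close> does not guarantee, so that product and quotient
  rules can be composed.\<close>

definition has_pd :: "'n \<Rightarrow> (real^'n \<Rightarrow> 'b::real_normed_vector) \<Rightarrow> 'b \<Rightarrow> real^'n \<Rightarrow> bool" where
  "has_pd i f D x \<longleftrightarrow> ((\<lambda>t. f (x + t *\<^sub>R axis i 1)) has_vector_derivative D) (at 0)"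

lemma pd_eq: "has_pd i f D x \<Longrightarrow> pd i f x = D"
  unfolding has_pd_def pd_def by (rule vector_derivative_at)

lemma has_pd_eq_rhs: "has_pd i f D x \<Longrightarrow> D = D' \<Longrightarrow> has_pd i f D' x"
  by simp

lemma has_pd_transform:
  assumes "has_pd i f D x" "open U" "x \<in> U" "\<And>y. y \<in> U \<Longrightarrow> f y = g y"
  shows "has_pd i g D x"
proof -
  have "continuous (at 0) (\<lambda>t. x + t *\<^sub>R axis i 1)"
    by (intro continuous_intros)
  then have "eventually (\<lambda>t. x + t *\<^sub>R axis i 1 \<in> U) (nhds 0)"
    using assms(2,3) by (simp add: continuous_within tendsto_def eventually_nhds_conv_at)
  then obtain T where T: "open T" "0 \<in> T" "\<And>t. t \<in> T \<Longrightarrow> x + t *\<^sub>R axis i 1 \<in> U"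
    unfolding eventually_nhds by blast
  show ?thesis
    using assms(1) unfolding has_pd_def
    by (rule has_vector_derivative_transform_within_open[OF _ T(1,2)]) (use T(3) assms(4) in auto)
qed

lemma has_pd_frechet:
  assumes "(f has_derivative f') (at x)"
  shows "has_pd i f (f' (axis i 1)) x"
proof -
  have "((\<lambda>t::real. x + t *\<^sub>R axis i 1) has_derivative (\<lambda>t. t *\<^sub>R axis i 1)) (at 0)"
    by (auto intro!: derivative_eq_intros)
  from has_derivative_compose[OF this, of f f'] assms
  have "((\<lambda>t. f (x + t *\<^sub>R axis i 1)) has_derivative (\<lambda>t. f' (t *\<^sub>R axis i 1))) (at 0)"
    by simp
  then show ?thesis
    unfolding has_pd_def has_vector_derivative_def
    using linear_scale[OF has_derivative_linear[OF assms]] by simp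
qed

lemma has_pd_const: "has_pd i (\<lambda>_. c) 0 x"
  by (simp add: has_pd_def)

lemma has_pd_add: "has_pd i f D x \<Longrightarrow> has_pd i g E x \<Longrightarrow> has_pd i (\<lambda>y. f y + g y) (D + E) x"
  unfolding has_pd_def by (rule has_vector_derivative_add)

lemma has_pd_diff: "has_pd i f D x \<Longrightarrow> has_pd i g E x \<Longrightarrow> has_pd i (\<lambda>y. f y - g y) (D - E) x"
  unfolding has_pd_def by (rule has_vector_derivative_diff)

lemma has_pd_minus: "has_pd i f D x \<Longrightarrow> has_pd i (\<lambda>y. - f y) (- D) x"
  unfolding has_pd_def by (rule has_vector_derivative_minus)

lemma has_pd_sum: "(\<And>a. a \<in> I \<Longrightarrow> has_pd i (f a) (D a) x) \<Longrightarrow> has_pd i (\<lambda>y. \<Sum>a\<in>I. f a y) (\<Sum>a\<in>I. D a) x"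
  unfolding has_pd_def by (rule has_vector_derivative_sum)

lemma has_pd_linear: "bounded_linear L \<Longrightarrow> has_pd i f D x \<Longrightarrow> has_pd i (\<lambda>y. L (f y)) (L D) x"
  unfolding has_pd_def by (rule bounded_linear.has_vector_derivative)

lemma has_pd_bilinear:
  assumes "bounded_bilinear b" "has_pd i f D x" "has_pd i g E x"
  shows "has_pd i (\<lambda>y. b (f y) (g y)) (b (f x) E + b D (g x)) x"
  using bounded_bilinear.has_vector_derivative[OF assms(1) assms(2,3)[unfolded has_pd_def]]
  by (simp add: has_pd_def)

lemma has_pd_mult:
  fixes f g :: "real^'n \<Rightarrow> 'b::real_normed_algebra"
  shows "has_pd i f D x \<Longrightarrow> has_pd i g E x \<Longrightarrow> has_pd i (\<lambda>y. f y * g y) (f x * E + D * g x) x"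
  by (rule has_pd_bilinear[OF bounded_bilinear_mult])

lemma has_pd_scaleR:
  "has_pd i f D x \<Longrightarrow> has_pd i g E x \<Longrightarrow> has_pd i (\<lambda>y. f y *\<^sub>R g y) (f x *\<^sub>R E + D *\<^sub>R g x) x"
  by (rule has_pd_bilinear[OF bounded_bilinear_scaleR])

lemma has_pd_of_real:
  "has_pd i f D x \<Longrightarrow> has_pd i (\<lambda>y. complex_of_real (f y)) (complex_of_real D) x"
  by (rule has_pd_linear[OF bounded_linear_of_real])

lemma has_pd_compose_field:
  assumes "has_pd i f D x" "(\<phi> has_field_derivative d) (at (f x))"
  shows "has_pd i (\<lambda>y. \<phi> (f y)) (D * d) x"
  using field_vector_diff_chain_at[of "\<lambda>t. f (x + t *\<^sub>R axis i 1)" D 0 \<phi> d] assms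
  by (simp add: has_pd_def o_def)

lemma has_pd_divide:
  fixes f g :: "real^'n \<Rightarrow> 'b::real_normed_field"
  assumes "has_pd i f D x" "has_pd i g E x" "g x \<noteq> 0"
  shows "has_pd i (\<lambda>y. f y / g y) ((D * g x - f x * E) / (g x)\<^sup>2) x"
proof -
  have "has_pd i (\<lambda>y. inverse (g y)) (E * - (inverse (g x) ^ Suc (Suc 0))) x"
    by (rule has_pd_compose_field[OF assms(2) DERIV_inverse[OF assms(3)]])
  from has_pd_mult[OF assms(1) this]
  have "has_pd i (\<lambda>y. f y * inverse (g y)) (f x * (E * - (inverse (g x) ^ Suc (Suc 0))) + D * inverse (g x)) x" .
  moreover have "f x * (E * - (inverse (g x) ^ Suc (Suc 0))) + D * inverse (g x) = (D * g x - f x * E) / (g x)\<^sup>2"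
    using assms(3) by (simp add: field_simps power2_eq_square)
  ultimately show ?thesis by (simp add: divide_inverse)
qed

lemma has_pd_component: "has_pd i (\<lambda>y. y $ j) (if j = i then 1 else 0) x"
proof -
  have "has_pd i (\<lambda>y. y $ j) (axis i 1 $ j) x"
    by (rule has_pd_frechet) (auto intro!: bounded_linear_imp_has_derivative bounded_linear_vec_nth)
  then show ?thesis by (simp add: axis_def)
qed

lemma has_pd_sqrt:
  "has_pd i f D x \<Longrightarrow> 0 < f x \<Longrightarrow> has_pd i (\<lambda>y. sqrt (f y)) (D / (2 * sqrt (f x))) x"
  by (rule has_pd_eq_rhs[OF has_pd_compose_field[OF _ DERIV_real_sqrt]]) (auto simp: field_simps)

lemma has_pd_ln:
  "has_pd i f D x \<Longrightarrow> 0 < f x \<Longrightarrow> has_pd i (\<lambda>y. ln (f y)) (D / f x) x" for f :: "real^'n \<Rightarrow> real"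
  by (rule has_pd_eq_rhs[OF has_pd_compose_field[OF _ DERIV_ln]]) (auto simp: field_simps)

lemmas has_pd_intros = has_pd_const has_pd_add has_pd_diff has_pd_minus has_pd_mult has_pd_scaleR
  has_pd_of_real has_pd_divide has_pd_component


section \<open>Matrices\<close>

lemma linear_mat: "linear (mat :: complex \<Rightarrow> complex^'r^'r)"
  by (auto simp: linear_iff vec_eq_iff mat_def)

lemma bounded_bilinear_matrix_mult:
  "bounded_bilinear ((**) :: complex^'r^'r \<Rightarrow> complex^'r^'r \<Rightarrow> complex^'r::finite^'r)"
  unfolding bilinear_conv_bounded_bilinear[symmetric] bilinear_def linear_iff
  by (auto simp: vec_eq_iff matrix_matrix_mult_def sum.distrib algebra_simps scaleR_sum_right)

lemma has_pd_mat: "has_pd i f D x \<Longrightarrow> has_pd i (\<lambda>y. mat (f y) :: complex^'r::finite^'r) (mat D) x"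
  using has_pd_linear[of mat] linear_mat linear_conv_bounded_linear by blast

lemma has_pd_matrix_mult:
  fixes f g :: "real^'n \<Rightarrow> complex^'r::finite^'r"
  shows "has_pd i f D x \<Longrightarrow> has_pd i g E x \<Longrightarrow> has_pd i (\<lambda>y. f y ** g y) (f x ** E + D ** g x) x"
  by (rule has_pd_bilinear[OF bounded_bilinear_matrix_mult])

text \<open>Scalar multiples, complex or real, are turned into products with scalar matrices. One
  bilinear product then serves for all terms, and \<open>mat_ring\<close> is its normal
  form.\<close>

lemma cscale_eq_mat_mult: "z *\<^sub>c B = mat z ** B" for B :: "complex^'r::finite^'r"
proof -
  have "(\<Sum>k\<in>UNIV. (if i = k then z else 0) * B $ k $ j) = z * B $ i $ j" for i j
    by (simp add: if_distrib[where f = "\<lambda>x. x * _"] cong: if_cong)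
  then show ?thesis
    by (simp add: vec_eq_iff cscale_def map_matrix_def matrix_matrix_mult_def mat_def)
qed

lemma scaleR_eq_mat_mult: "a *\<^sub>R B = mat (of_real a) ** B" for B :: "complex^'r::finite^'r"
  by (simp add: cscale_eq_mat_mult[symmetric] vec_eq_iff cscale_def map_matrix_def
        scaleR_conv_of_real[where 'a = complex])

lemma mat_mult_mat: "mat a ** mat b = (mat (a * b) :: complex^'r::finite^'r)"
  by (simp only: cscale_eq_mat_mult[symmetric]) (simp add: vec_eq_iff cscale_def map_matrix_def mat_def)

lemma mat_add: "mat a + mat b = (mat (a + b) :: complex^'r::finite^'r)"
  and mat_diff: "mat a - mat b = (mat (a - b) :: complex^'r::finite^'r)"
  and mat_uminus: "- mat a = (mat (- a) :: complex^'r::finite^'r)"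
  by (simp_all add: vec_eq_iff mat_def)

text \<open>\<open>matrix_inv\<close> is a choice among two-sided inverses; their uniqueness forces
  the choice.\<close>

lemma matrix_inv_eqI:
  fixes A B :: "'a::semiring_1^'n^'n"
  assumes AB: "A ** B = mat 1" and BA: "B ** A = mat 1"
  shows "matrix_inv A = B"
proof -
  have "A ** matrix_inv A = mat 1 \<and> matrix_inv A ** A = mat 1"
    unfolding matrix_inv_def by (rule someI[of _ B]) (use assms in auto)
  then have "matrix_inv A = (B ** A) ** matrix_inv A" "A ** matrix_inv A = mat 1"
    by (simp_all add: BA)
  then show ?thesis by (simp add: matrix_mul_assoc[symmetric])
qed

lemma matrix_inv_mat:
  assumes "z \<noteq> 0"
  shows "matrix_inv (mat z) = (mat (1 / z) :: complex^'r::finite^'r)"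
  by (rule matrix_inv_eqI) (use assms in \<open>simp_all add: mat_mult_mat\<close>)

lemma trace_mat_mult: "trace (mat z ** B) = z * trace B" for B :: "complex^'r::finite^'r"
  by (simp only: cscale_eq_mat_mult[symmetric]) (simp add: trace_def cscale_def map_matrix_def sum_distrib_left)

lemma trace_mat: "trace (mat z :: complex^'r::finite^'r) = of_nat CARD('r) * z"
  by (simp add: trace_def mat_def)

lemma trace_uminus: "trace (- B) = - trace B" for B :: "complex^'r::finite^'r"
  by (simp add: trace_def sum_negf)

lemma multi_indices_2: "{m :: nat \<times> nat. fst m + snd m = 2} = {(2, 0), (1, 1), (0, 2)}"
  by auto

section \<open>Boundary coordinates\<close>

lemma pt_components [simp]: "pt x t $ 1 = x $ 1" "pt x t $ 2 = x $ 2" "pt x t $ 3 = t"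
  by (simp_all add: pt_def)

lemma pt_0 [simp]: "pt 0 0 = 0"
  by (simp add: vec_eq_iff forall_3)

lemma tn_simps [simp]: "tn 1 = 1" "tn 2 = 2"
  by (simp_all add: tn_def)

text \<open>A coordinate line of a slice is a coordinate line of the ambient space. Hence tangential
  and normal derivatives of the local data are all partial derivatives of functions of one variable
  \<open>y\<close> in 3-space.\<close>

lemma pt_add_axis: "pt (x + s *\<^sub>R axis a 1) t = pt x t + s *\<^sub>R axis (tn a) 1"
  by (cases a rule: exhaust_2[THEN disjE]) (auto simp: vec_eq_iff forall_3 axis_def)

lemma pt_add_normal: "pt x (t + s) = pt x t + s *\<^sub>R axis 3 1"
  by (auto simp: vec_eq_iff forall_3 axis_def)

lemma has_pd_pt: "has_pd a (\<lambda>x. F (pt x t)) D x \<longleftrightarrow> has_pd (tn a) F D (pt x t)"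
  by (simp add: has_pd_def pt_add_axis)

lemma has_vector_derivative_pt:
  "((\<lambda>s. F (pt x s)) has_vector_derivative D) (at t) \<longleftrightarrow> has_pd 3 F D (pt x t)"
  by (simp add: has_pd_def pt_add_normal[symmetric] has_vector_derivative_def has_derivative_at)

lemma continuous_pt: "continuous (at x) (\<lambda>x. pt x t)" "continuous (at t) (\<lambda>t. pt x t)"
proof -
  have eq: "pt x t = (\<chi> i. if i = 1 then x $ 1 else if i = 2 then x $ 2 else t)" for x t
    by (simp add: vec_eq_iff forall_3)
  have "continuous_on UNIV (\<lambda>x. pt x t)"
    unfolding eq proof (rule continuous_on_vec_lambda)
    fix i :: 3 show "continuous_on UNIV (\<lambda>x::real^2. if i = 1 then x $ 1 else if i = 2 then x $ 2 else t)"
      by (cases "i = 1"; cases "i = 2") (simp_all add: continuous_on_component)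
  qed
  then show "continuous (at x) (\<lambda>x. pt x t)" by (simp add: continuous_on_eq_continuous_at)
  have "continuous_on UNIV (\<lambda>t. pt x t)"
    unfolding eq proof (rule continuous_on_vec_lambda)
    fix i :: 3 show "continuous_on UNIV (\<lambda>t. if i = 1 then x $ 1 else if i = 2 then x $ 2 else t)"
      by (cases "i = 1"; cases "i = 2") (simp_all add: continuous_on_component)
  qed
  then show "continuous (at t) (\<lambda>t. pt x t)" by (simp add: continuous_on_eq_continuous_at)
qed

interpretation matrix_mult: bounded_bilinear "(**) :: complex^'r^'r \<Rightarrow> complex^'r^'r \<Rightarrow> complex^'r::finite^'r"
  by (rule bounded_bilinear_matrix_mult)

lemma mat_mult_assoc: "mat a ** (mat b ** X) = mat (a * b) ** X" for X :: "complex^'r::finite^'r"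
  by (simp add: matrix_mul_assoc mat_mult_mat)

lemma mat_commute: "X ** mat a = mat a ** X" for X :: "complex^'r::finite^'r"
proof -
  have "(\<Sum>k\<in>UNIV. X $ i $ k * (if k = j then a else 0)) = a * X $ i $ j" for i j
    by (simp add: if_distrib[where f = "\<lambda>x. _ * x"] cong: if_cong)
  then show ?thesis
    unfolding cscale_eq_mat_mult[symmetric]
    by (simp add: vec_eq_iff cscale_def map_matrix_def matrix_matrix_mult_def mat_def)
qed

lemmas mat_ring = matrix_mult.add_left matrix_mult.add_right matrix_mult.diff_left matrix_mult.diff_right
  matrix_mult.minus_left matrix_mult.minus_right mat_mult_mat mat_mult_assoc

lemma has_pd_ext:
  "has_pd i f D x \<Longrightarrow> (\<And>y. f y = g y) \<Longrightarrow> D = D' \<Longrightarrow> has_pd i g D' x"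
  by (metis ext)


section \<open>The symbol of the Dirichlet-to-Neumann operator\<close>

text \<open>
  The local data are functions of $y = (x, t)$. Here \<open>u\<close> is the inverse of the slice metrics, \<open>L1\<close> the tangential
  gradient of $\ln |g|$ and \<open>A\<close> the coefficient $A$. The suffixes 1 and 2 mark first partial derivatives and second
  partial derivatives at the origin; the index of the last differentiation comes last.
\<close>

locale dn_symbol =
  fixes h :: "real \<Rightarrow> real^2 \<Rightarrow> real^2^2"
    and W :: "3 \<Rightarrow> real^3 \<Rightarrow> complex^'r::finite^'r"
    and e :: "real \<Rightarrow> real^2 \<Rightarrow> complex^'r^'r"
    and V :: "(real^3) set"
    and u :: "2 \<Rightarrow> 2 \<Rightarrow> real^3 \<Rightarrow> real" and u1 :: "2 \<Rightarrow> 2 \<Rightarrow> 3 \<Rightarrow> real^3 \<Rightarrow> real"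
    and u2 :: "2 \<Rightarrow> 2 \<Rightarrow> 3 \<Rightarrow> 3 \<Rightarrow> real"
    and L1 :: "2 \<Rightarrow> real^3 \<Rightarrow> real" and L2 :: "2 \<Rightarrow> 3 \<Rightarrow> real"
    and A :: "real^3 \<Rightarrow> real" and A1 :: "3 \<Rightarrow> real"
    and W1 :: "3 \<Rightarrow> 3 \<Rightarrow> complex^'r^'r"
  assumes V: "open V" "0 \<in> V"
    and ginv_eq: "pt x t \<in> V \<Longrightarrow> ginv h a b t x = u a b (pt x t)"
    and Acoef_eq: "pt x t \<in> V \<Longrightarrow> Acoef h t x = A (pt x t)"
    and lndet: "pt x t \<in> V \<Longrightarrow> pd a (\<lambda>y. ln (det (h t y))) x = L1 a (pt x t)"
    and u_sym: "u a b y = u b a y"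
    and u_cont: "continuous_on V (u a b)"
    and u_nonneg: "y \<in> V \<Longrightarrow> 0 \<le> (\<Sum>a\<in>UNIV. \<Sum>b\<in>UNIV. u a b y * \<xi> $ a * \<xi> $ b)"
    and pd_u: "y \<in> V \<Longrightarrow> has_pd i (u a b) (u1 a b i y) y"
    and pd_u1: "has_pd j (u1 a b i) (u2 a b i j) 0"
    and pd_L1: "has_pd j (L1 a) (L2 a j) 0"
    and pd_A: "has_pd j A (A1 j) 0"
    and pd_W: "has_pd i (W j) (W1 j i) 0"
    and u_0: "u a b 0 = (if a = b then 1 else 0)"
    and u1_0: "u1 a b (tn c) 0 = 0"
    and L1_0: "L1 a 0 = 0"
    and christoffel_0: "christoffel (h 0) k a b 0 = 0"
begin

abbreviation w :: "3 \<Rightarrow> real \<Rightarrow> real^2 \<Rightarrow> complex^'r^'r" where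
  "w \<equiv> \<lambda>j t x. W j (pt x t)"

text \<open>
  In terms of the symbols, \<open>R\<close> is $\alpha_1$ and \<open>S\<close> is $\partial_\xi \alpha_1 \cdot \partial_x \alpha_1$, \<open>X1\<close> and \<open>X2\<close> are
  derivatives of $\alpha_1$ in $\xi$, \<open>P\<close> is $p_1$, \<open>T\<close> is $\alpha_0 + \beta_0$ and \<open>d\<close> is
  $(\alpha_0 - \beta_0)/2$.
\<close>

definition N :: "real^3 \<Rightarrow> real^2 \<Rightarrow> real" where
  "N y \<xi> = (\<Sum>a\<in>UNIV. \<Sum>b\<in>UNIV. u a b y * \<xi> $ a * \<xi> $ b)"

definition N1 :: "3 \<Rightarrow> real^3 \<Rightarrow> real^2 \<Rightarrow> real" where
  "N1 i y \<xi> = (\<Sum>a\<in>UNIV. \<Sum>b\<in>UNIV. u1 a b i y * \<xi> $ a * \<xi> $ b)"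

definition N2 :: "3 \<Rightarrow> 3 \<Rightarrow> real^2 \<Rightarrow> real" where
  "N2 i j \<xi> = (\<Sum>a\<in>UNIV. \<Sum>b\<in>UNIV. u2 a b i j * \<xi> $ a * \<xi> $ b)"

definition R :: "real^3 \<Rightarrow> real^2 \<Rightarrow> real" where
  "R y \<xi> = sqrt (N y \<xi> + 1)"

definition R1 :: "3 \<Rightarrow> real^3 \<Rightarrow> real^2 \<Rightarrow> real" where
  "R1 i y \<xi> = N1 i y \<xi> / (2 * R y \<xi>)"

definition R2 :: "3 \<Rightarrow> 3 \<Rightarrow> real^2 \<Rightarrow> real" where
  "R2 i j \<xi> = (N2 i j \<xi> - 2 * R1 i 0 \<xi> * R1 j 0 \<xi>) / (2 * R 0 \<xi>)"

definition X1 :: "2 \<Rightarrow> real^3 \<Rightarrow> real^2 \<Rightarrow> real" where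
  "X1 a y \<xi> = (\<Sum>b\<in>UNIV. u a b y * \<xi> $ b) / R y \<xi>"

definition X11 :: "2 \<Rightarrow> 3 \<Rightarrow> real^2 \<Rightarrow> real" where
  "X11 a i \<xi> = (\<Sum>b\<in>UNIV. u1 a b i 0 * \<xi> $ b) / R 0 \<xi> - \<xi> $ a * R1 i 0 \<xi> / (R 0 \<xi>)\<^sup>2"

definition S :: "real^3 \<Rightarrow> real^2 \<Rightarrow> real" where
  "S y \<xi> = (\<Sum>a\<in>UNIV. X1 a y \<xi> * R1 (tn a) y \<xi>)"

definition S1 :: "3 \<Rightarrow> real^2 \<Rightarrow> real" where
  "S1 i \<xi> = (\<Sum>a\<in>UNIV. X1 a 0 \<xi> * R2 (tn a) i \<xi> + X11 a i \<xi> * R1 (tn a) 0 \<xi>)"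

definition B :: "real^3 \<Rightarrow> real^2 \<Rightarrow> real" where
  "B y \<xi> = (\<Sum>a\<in>UNIV. \<Sum>b\<in>UNIV. (1/2 * u a b y * L1 a y + u1 a b (tn a) y) * \<xi> $ b)"

definition B1 :: "3 \<Rightarrow> real^2 \<Rightarrow> real" where
  "B1 i \<xi> = (\<Sum>a\<in>UNIV. \<Sum>b\<in>UNIV. (1/2 * u a b 0 * L2 a i + u2 a b (tn a) i) * \<xi> $ b)"

definition P :: "real^3 \<Rightarrow> real^2 \<Rightarrow> complex^'r^'r" where
  "P y \<xi> = mat (- \<i> * B y \<xi>) - mat (2 * \<i>) ** (\<Sum>a\<in>UNIV. \<Sum>b\<in>UNIV. (u a b y * \<xi> $ b) *\<^sub>R W (tn a) y)"

definition P1 :: "3 \<Rightarrow> real^2 \<Rightarrow> complex^'r^'r" where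
  "P1 i \<xi> = mat (- \<i> * B1 i \<xi>) - mat (2 * \<i>) **
     (\<Sum>a\<in>UNIV. \<Sum>b\<in>UNIV. (u a b 0 * \<xi> $ b) *\<^sub>R W1 (tn a) i + (u1 a b i 0 * \<xi> $ b) *\<^sub>R W (tn a) 0)"

definition T :: "real^3 \<Rightarrow> real^2 \<Rightarrow> complex^'r^'r" where
  "T y \<xi> = mat (1 / R y \<xi>) ** (P y \<xi> + mat (\<i> * S y \<xi>))"

definition T1 :: "3 \<Rightarrow> real^2 \<Rightarrow> complex^'r^'r" where
  "T1 i \<xi> = mat (1 / R 0 \<xi>) ** (P1 i \<xi> + mat (\<i> * S1 i \<xi>)) +
     mat (- R1 i 0 \<xi> / (R 0 \<xi>)\<^sup>2) ** (P 0 \<xi> + mat (\<i> * S 0 \<xi>))"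

definition d :: "real^3 \<Rightarrow> real^2 \<Rightarrow> real" where
  "d y \<xi> = A y / 2 - R1 3 y \<xi> / (2 * R y \<xi>)"

definition d1 :: "3 \<Rightarrow> real^2 \<Rightarrow> real" where
  "d1 i \<xi> = A1 i / 2 - (R2 3 i \<xi> * R 0 \<xi> - R1 3 0 \<xi> * R1 i 0 \<xi>) / (2 * (R 0 \<xi>)\<^sup>2)"

lemma R_pos: "y \<in> V \<Longrightarrow> 0 < R y \<xi>"
  unfolding R_def N_def using u_nonneg[of y \<xi>] by simp

lemma has_pd_N: "y \<in> V \<Longrightarrow> has_pd i (\<lambda>y. N y \<xi>) (N1 i y \<xi>) y"
  unfolding N_def N1_def mult.assoc
  by (intro has_pd_sum has_pd_eq_rhs[OF has_pd_mult[OF pd_u has_pd_const]]) auto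

lemma has_pd_N1: "has_pd j (\<lambda>y. N1 i y \<xi>) (N2 i j \<xi>) 0"
  unfolding N1_def N2_def mult.assoc
  by (intro has_pd_sum has_pd_eq_rhs[OF has_pd_mult[OF pd_u1 has_pd_const]]) auto

lemma has_pd_R: "y \<in> V \<Longrightarrow> has_pd i (\<lambda>y. R y \<xi>) (R1 i y \<xi>) y"
proof -
  assume y: "y \<in> V"
  then have "0 < N y \<xi> + 1" using u_nonneg[OF y, of \<xi>] by (simp add: N_def)
  from has_pd_sqrt[OF has_pd_add[OF has_pd_N[OF y] has_pd_const] this]
  show ?thesis unfolding R_def R1_def by simp
qed

text \<open>The formula for \<open>R2\<close> is the second derivative of
  \<open>R^2 = N + 1\<close>, namely \<open>2 * R * R2 + 2 * R1 * R1 = N2\<close>.\<close>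

lemma has_pd_R1: "has_pd j (\<lambda>y. R1 i y \<xi>) (R2 i j \<xi>) 0"
  unfolding R1_def[of i _ \<xi>, abs_def]
  apply (rule has_pd_eq_rhs)
   apply (rule has_pd_divide[OF has_pd_N1 has_pd_mult[OF has_pd_const has_pd_R[OF V(2)]]])
  using R_pos[OF V(2), of \<xi>] by (auto simp: R2_def R1_def field_simps power2_eq_square)

lemma has_pd_X1: "has_pd i (\<lambda>y. X1 a y \<xi>) (X11 a i \<xi>) 0"
  unfolding X1_def
  apply (rule has_pd_eq_rhs)
   apply (rule has_pd_divide[OF has_pd_sum[OF has_pd_mult[OF pd_u[OF V(2)] has_pd_const]] has_pd_R[OF V(2)]])
  using R_pos[OF V(2), of \<xi>]
    exhaust_2[of a] by (auto simp: X11_def u_0 sum_2 field_simps power2_eq_square)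

lemma has_pd_S: "has_pd i (\<lambda>y. S y \<xi>) (S1 i \<xi>) 0"
  unfolding S_def S1_def by (intro has_pd_sum has_pd_mult has_pd_X1 has_pd_R1)

text \<open>The product rule would also give a term \<open>u1 * L1\<close>; it is absent from
  \<open>B1\<close> because \<open>L1\<close> vanishes at the origin.\<close>

lemma has_pd_B: "has_pd i (\<lambda>y. B y \<xi>) (B1 i \<xi>) 0"
proof -
  have "has_pd i (\<lambda>y. (1/2 * u a b y * L1 a y + u1 a b (tn a) y) * \<xi> $ b)
     ((1/2 * u a b 0 * L2 a i + u2 a b (tn a) i) * \<xi> $ b) 0" for a b
    by (rule has_pd_eq_rhs[OF has_pd_mult[OF has_pd_add[OF has_pd_mult[OF has_pd_mult[OF has_pd_const pd_u[OF V(2)]] pd_L1]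
            pd_u1] has_pd_const]]) (simp add: L1_0)
  then show ?thesis unfolding B_def B1_def by (intro has_pd_sum)
qed

lemma has_pd_P: "has_pd i (\<lambda>y. P y \<xi>) (P1 i \<xi>) 0"
proof -
  have "has_pd i (\<lambda>y. (u a b y * \<xi> $ b) *\<^sub>R W (tn a) y)
     ((u a b 0 * \<xi> $ b) *\<^sub>R W1 (tn a) i + (u1 a b i 0 * \<xi> $ b) *\<^sub>R W (tn a) 0) 0" for a b
    by (rule has_pd_eq_rhs[OF has_pd_scaleR[OF has_pd_mult[OF pd_u[OF V(2)] has_pd_const] pd_W]]) simp
  then have "has_pd i (\<lambda>y. \<Sum>a\<in>UNIV. \<Sum>b\<in>UNIV. (u a b y * \<xi> $ b) *\<^sub>R W (tn a) y)
     (\<Sum>a\<in>UNIV. \<Sum>b\<in>UNIV. (u a b 0 * \<xi> $ b) *\<^sub>R W1 (tn a) i + (u1 a b i 0 * \<xi> $ b) *\<^sub>R W (tn a) 0) 0"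
    by (intro has_pd_sum)
  from has_pd_diff[OF has_pd_mat[OF has_pd_mult[OF has_pd_const[of i "- \<i>"] has_pd_of_real[OF has_pd_B[of i \<xi>]]]]
      has_pd_matrix_mult[OF has_pd_const[of i "mat (2 * \<i>)"] this]]
  show ?thesis unfolding P_def P1_def by simp
qed

lemma has_pd_T: "has_pd i (\<lambda>y. T y \<xi>) (T1 i \<xi>) 0"
proof -
  have "has_pd i (\<lambda>y. complex_of_real (1 / R y \<xi>)) (of_real (- R1 i 0 \<xi> / (R 0 \<xi>)\<^sup>2)) 0"
    by (rule has_pd_of_real[OF has_pd_eq_rhs[OF has_pd_divide[OF has_pd_const has_pd_R[OF V(2)]]]])
       (use R_pos[OF V(2), of \<xi>] in auto)
  from has_pd_matrix_mult[OF has_pd_mat[OF this]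
      has_pd_add[OF has_pd_P has_pd_mat[OF has_pd_mult[OF has_pd_const has_pd_of_real[OF has_pd_S]]]]]
  show ?thesis unfolding T_def T1_def by simp
qed

lemma has_pd_d: "has_pd i (\<lambda>y. d y \<xi>) (d1 i \<xi>) 0"
  unfolding d_def
  apply (rule has_pd_eq_rhs)
   apply (rule has_pd_diff[OF has_pd_divide[OF pd_A has_pd_const]
      has_pd_divide[OF has_pd_R1 has_pd_mult[OF has_pd_const has_pd_R[OF V(2)]]]])
  using R_pos[OF V(2), of \<xi>] by (auto simp: d1_def field_simps power2_eq_square)

text \<open>The closed forms of the symbols hold only where \<open>pt x t\<close> lies in an open
  set. The slice of this set is open again, which is enough for differentiating there.\<close>

lemma pd_pt_eq:
  assumes "open U" "pt x t \<in> U" "\<And>x'. pt x' t \<in> U \<Longrightarrow> F x' = G (pt x' t)" "has_pd (tn a) G D (pt x t)"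
  shows "pd a F x = D"
proof (rule pd_eq, rule has_pd_transform)
  show "has_pd a (\<lambda>x. G (pt x t)) D x" using assms(4) by (simp add: has_pd_pt)
  have "continuous_on UNIV (\<lambda>x. pt x t)"
    by (simp add: continuous_on_eq_continuous_at continuous_pt)
  then show "open ((\<lambda>x. pt x t) -` U)"
    using assms(1) by (simp add: continuous_on_open_vimage)
qed (use assms in auto)

lemma dx_eq:
  assumes "open U" "pt x t \<in> U" "\<And>x'. pt x' t \<in> U \<Longrightarrow> F x' \<xi> = G (pt x' t)" "has_pd (tn a) G D (pt x t)"
  shows "dx a F x \<xi> = D"
  unfolding dx_def by (rule pd_pt_eq) (use assms in auto)

lemma vd_eq:
  assumes "open U" "pt x t \<in> U" "\<And>t'. pt x t' \<in> U \<Longrightarrow> F t' = G (pt x t')" "has_pd 3 G D (pt x t)"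
  shows "vector_derivative F (at t) = D"
proof (rule vector_derivative_at, rule has_vector_derivative_transform_within_open)
  show "((\<lambda>s. G (pt x s)) has_vector_derivative D) (at t)"
    using assms(4) by (simp add: has_vector_derivative_pt)
  have "continuous_on UNIV (\<lambda>t. pt x t)"
    by (simp add: continuous_on_eq_continuous_at continuous_pt)
  then show "open ((\<lambda>t. pt x t) -` U)"
    using assms(1) by (simp add: continuous_on_open_vimage)
qed (use assms in auto)

section \<open>Symbols of order 1 and 0 near the origin\<close>

lemma root1_eq: "pt x t \<in> V \<Longrightarrow> root1 h 1 t x \<xi> = of_real (R (pt x t) \<xi>)"
  by (simp add: root1_def normsq_def R_def N_def ginv_eq)

lemma alpha1_eq: "pt x t \<in> V \<Longrightarrow> alpha1 h 1 t x \<xi> = mat (of_real (R (pt x t) \<xi>))"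
  by (simp add: alpha1_def root1_eq cscale_eq_mat_mult)

lemma beta1_alpha1: "beta1 h = alpha1 h"
  by (simp add: fun_eq_iff alpha1_def beta1_def)

lemma has_pd_N_xi: "has_pd c (\<lambda>\<xi>. N y \<xi>) (2 * (\<Sum>b\<in>UNIV. u c b y * \<xi> $ b)) \<xi>"
proof -
  have "has_pd c (\<lambda>\<xi>. N y \<xi>) (\<Sum>a\<in>UNIV. \<Sum>b\<in>UNIV. (u a b y * \<xi> $ a) * (if b = c then 1 else 0)
      + (u a b y * (if a = c then 1 else 0) + 0 * \<xi> $ a) * \<xi> $ b) \<xi>"
    unfolding N_def by (intro has_pd_sum has_pd_intros)
  then show ?thesis
    by (rule has_pd_eq_rhs)
       (use u_sym[of 1 2 y] exhaust_2[of c] in \<open>auto simp: sum_2 algebra_simps\<close>)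
qed

lemma has_pd_R_xi:
  assumes y: "y \<in> V"
  shows "has_pd c (\<lambda>\<xi>. R y \<xi>) (X1 c y \<xi>) \<xi>"
proof -
  have "0 < N y \<xi> + 1" using u_nonneg[OF y, of \<xi>] by (simp add: N_def)
  from has_pd_sqrt[OF has_pd_add[OF has_pd_N_xi has_pd_const] this]
  show ?thesis unfolding R_def X1_def by (simp add: add.commute)
qed

lemma X1_0: "X1 a 0 \<xi> = \<xi> $ a / R 0 \<xi>"
  using exhaust_2[of a] by (auto simp: X1_def u_0 sum_2)

definition X2 :: "2 \<Rightarrow> 2 \<Rightarrow> real^2 \<Rightarrow> real" where
  "X2 a b \<xi> = ((if a = b then 1 else 0) - \<xi> $ a * \<xi> $ b / (R 0 \<xi>)\<^sup>2) / R 0 \<xi>"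

lemma has_pd_X1_xi: "has_pd b (\<lambda>\<xi>. X1 a 0 \<xi>) (X2 a b \<xi>) \<xi>"
  unfolding X1_0
  apply (rule has_pd_eq_rhs)
   apply (rule has_pd_divide[OF has_pd_component has_pd_R_xi[OF V(2)]])
  using R_pos[OF V(2), of \<xi>]
  by (auto simp: X2_def X1_0 field_simps power2_eq_square)

lemma dx_alpha1: "pt x t \<in> V \<Longrightarrow> dx a (alpha1 h 1 t) x \<xi> = mat (of_real (R1 (tn a) (pt x t) \<xi>))"
  by (rule dx_eq[OF V(1) _ _ has_pd_mat[OF has_pd_of_real[OF has_pd_R]]]) (auto simp: alpha1_eq)

lemma dxi_alpha1: "pt x t \<in> V \<Longrightarrow> dxi a (alpha1 h 1 t) x \<xi> = mat (of_real (X1 a (pt x t) \<xi>))"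
  unfolding dxi_def
  by (rule pd_eq, rule has_pd_ext[OF has_pd_mat[OF has_pd_of_real[OF has_pd_R_xi]]]) (auto simp: alpha1_eq)

lemma contr1_alpha1: "pt x t \<in> V \<Longrightarrow> contr1 dx (alpha1 h 1 t) (alpha1 h 1 t) x \<xi> = mat (of_real (S (pt x t) \<xi>))"
  by (simp add: contr1_def dx_alpha1 dxi_alpha1 mat_ring sum_2 mat_add S_def)

lemma dt_alpha1: "pt x t \<in> V \<Longrightarrow> vector_derivative (\<lambda>s. alpha1 h 1 s x \<xi>) (at t) = mat (of_real (R1 3 (pt x t) \<xi>))"
  by (rule vd_eq[OF V(1) _ _ has_pd_mat[OF has_pd_of_real[OF has_pd_R]]]) (auto simp: alpha1_eq)


lemma p1_eq:
  assumes y: "pt x t \<in> V"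
  shows "p1 h w t x \<xi> = P (pt x t) \<xi>"
proof -
  have "pd a (ginv h a b t) x = u1 a b (tn a) (pt x t)" for a b
    by (rule pd_pt_eq[OF V(1) y _ pd_u[OF y]]) (simp add: ginv_eq)
  then show ?thesis
    unfolding p1_def P_def
    by (simp add: lndet y ginv_eq cscale_eq_mat_mult B_def mat_ring)
qed

lemma alpha0_eq:
  assumes y: "pt x t \<in> V"
  shows "alpha0 h w 1 t x \<xi> = mat (1/2) ** T (pt x t) \<xi> + mat (of_real (d (pt x t) \<xi>))"
    and "beta0 h w 1 t x \<xi> = mat (1/2) ** T (pt x t) \<xi> - mat (of_real (d (pt x t) \<xi>))"
proof -
  have nz: "complex_of_real (R (pt x t) \<xi>) \<noteq> 0" using R_pos[OF y, of \<xi>] by simp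
  show "alpha0 h w 1 t x \<xi> = mat (1/2) ** T (pt x t) \<xi> + mat (of_real (d (pt x t) \<xi>))"
    unfolding alpha0_def root1_eq[OF y] p1_eq[OF y] Acoef_eq[OF y] alpha1_eq[OF y] contr1_alpha1[OF y] dt_alpha1[OF y]
      cscale_eq_mat_mult scaleR_eq_mat_mult T_def d_def
    using nz by (simp add: mat_ring mat_add[symmetric] mat_diff[symmetric])
  show "beta0 h w 1 t x \<xi> = mat (1/2) ** T (pt x t) \<xi> - mat (of_real (d (pt x t) \<xi>))"
    unfolding beta0_def root1_eq[OF y] p1_eq[OF y] Acoef_eq[OF y] alpha1_eq[OF y] contr1_alpha1[OF y] dt_alpha1[OF y]
      cscale_eq_mat_mult scaleR_eq_mat_mult T_def d_def
    using nz by (simp add: mat_ring mat_add[symmetric] mat_diff[symmetric])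
qed

section \<open>Symbols of order -1 at the origin\<close>

lemma pt00: "pt 0 0 \<in> V" by (simp add: V)

lemma dx_alpha0:
  "dx a (alpha0 h w 1 0) 0 \<xi> = mat (1/2) ** T1 (tn a) \<xi> + mat (of_real (d1 (tn a) \<xi>))"
  "dx a (beta0 h w 1 0) 0 \<xi> = mat (1/2) ** T1 (tn a) \<xi> - mat (of_real (d1 (tn a) \<xi>))"
proof -
  have 1: "has_pd i (\<lambda>y. mat (1/2) ** T y \<xi>) (mat (1/2) ** T1 i \<xi>) (pt 0 0)" for i
    using has_pd_matrix_mult[OF has_pd_const[of i "mat (1/2)"] has_pd_T] by simp
  have 2: "has_pd i (\<lambda>y. mat (of_real (d y \<xi>))) (mat (of_real (d1 i \<xi>)) :: complex^'r^'r) (pt 0 0)" for i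
    using has_pd_mat[OF has_pd_of_real[OF has_pd_d]] by simp
  show "dx a (alpha0 h w 1 0) 0 \<xi> = mat (1/2) ** T1 (tn a) \<xi> + mat (of_real (d1 (tn a) \<xi>))"
    by (rule dx_eq[OF V(1) pt00 _ has_pd_add[OF 1 2]]) (rule alpha0_eq)
  show "dx a (beta0 h w 1 0) 0 \<xi> = mat (1/2) ** T1 (tn a) \<xi> - mat (of_real (d1 (tn a) \<xi>))"
    by (rule dx_eq[OF V(1) pt00 _ has_pd_diff[OF 1 2]]) (rule alpha0_eq)
qed

lemma dt_alpha0:
  "vector_derivative (\<lambda>s. alpha0 h w 1 s 0 \<xi>) (at 0) = mat (1/2) ** T1 3 \<xi> + mat (of_real (d1 3 \<xi>))"
  "vector_derivative (\<lambda>s. beta0 h w 1 s 0 \<xi>) (at 0) = mat (1/2) ** T1 3 \<xi> - mat (of_real (d1 3 \<xi>))"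
proof -
  have 1: "has_pd i (\<lambda>y. mat (1/2) ** T y \<xi>) (mat (1/2) ** T1 i \<xi>) (pt 0 0)" for i
    using has_pd_matrix_mult[OF has_pd_const[of i "mat (1/2)"] has_pd_T] by simp
  have 2: "has_pd i (\<lambda>y. mat (of_real (d y \<xi>))) (mat (of_real (d1 i \<xi>)) :: complex^'r^'r) (pt 0 0)" for i
    using has_pd_mat[OF has_pd_of_real[OF has_pd_d]] by simp
  show "vector_derivative (\<lambda>s. alpha0 h w 1 s 0 \<xi>) (at 0) = mat (1/2) ** T1 3 \<xi> + mat (of_real (d1 3 \<xi>))"
    by (rule vd_eq[OF V(1) pt00 _ has_pd_add[OF 1 2]]) (rule alpha0_eq)
  show "vector_derivative (\<lambda>s. beta0 h w 1 s 0 \<xi>) (at 0) = mat (1/2) ** T1 3 \<xi> - mat (of_real (d1 3 \<xi>))"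
    by (rule vd_eq[OF V(1) pt00 _ has_pd_diff[OF 1 2]]) (rule alpha0_eq)
qed

text \<open>The contraction over multi-indices of order 2 at the origin; the weights 1/2, 1, 1/2 are
  the inverse factorials of (2,0), (1,1) and (0,2).\<close>

definition C2 :: "real^2 \<Rightarrow> real" where
  "C2 \<xi> = X2 1 1 \<xi> * R2 1 1 \<xi> / 2 + X2 2 1 \<xi> * R2 2 1 \<xi> + X2 2 2 \<xi> * R2 2 2 \<xi> / 2"

lemma dxi_dxi_alpha1: "dxi a (dxi b (alpha1 h 1 0)) 0 \<xi> = mat (of_real (X2 b a \<xi>))"
  unfolding dxi_def[of a]
  by (rule pd_eq, rule has_pd_ext[OF has_pd_mat[OF has_pd_of_real[OF has_pd_X1_xi]]]) (simp_all add: dxi_alpha1 V)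

lemma dx_dx_alpha1: "dx a (dx b (alpha1 h 1 0)) 0 \<xi> = mat (of_real (R2 (tn b) (tn a) \<xi>))"
  by (rule dx_eq[OF V(1) pt00, of _ _ "\<lambda>y. mat (of_real (R1 (tn b) y \<xi>))"])
     (simp_all only: dx_alpha1 pt_0 has_pd_mat has_pd_of_real has_pd_R1)

lemma contr2_alpha1: "contr2 dx (alpha1 h 1 0) (alpha1 h 1 0) 0 \<xi> = mat (of_real (C2 \<xi>))"
  unfolding contr2_def multi_indices_2
  by (simp add: mderiv_def numeral_2_eq_2 dxi_dxi_alpha1 dx_dx_alpha1 scaleR_eq_mat_mult
      mat_mult_mat mat_add C2_def add.commute add.left_commute)

lemma R1_0: "R1 (tn c) 0 \<xi> = 0"
  by (simp add: R1_def N1_def u1_0)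

lemma S_0: "S 0 \<xi> = 0"
  by (simp add: S_def R1_0)

text \<open>Under the trace each commutator with \<open>W 3\<close> vanishes by cyclicity. The terms
  \<open>d * T\<close>, \<open>A * T\<close>, the normal derivative of \<open>T\<close> and the
  tangential derivatives of \<open>d\<close> have opposite signs in the two summands and cancel.
  Contractions with tangential derivatives of \<open>alpha1\<close> vanish at the origin, where
  \<open>R1\<close> is zero.\<close>

lemma trace_theta_minus1:
  "trace (theta_minus1 h w e 1 0 \<xi>) = 1 / (2 * R 0 \<xi>) *
     (of_nat CARD('r) * of_real (2 * C2 \<xi> - 2 * (d 0 \<xi>)\<^sup>2 + 2 * A 0 * d 0 \<xi> - 2 * d1 3 \<xi>)
      + \<i> * (\<Sum>a\<in>UNIV. X1 a 0 \<xi> * trace (T1 (tn a) \<xi>)) - trace (T 0 \<xi> ** T 0 \<xi>) / 2 + 2 * trace (p0 h w e 0 0))"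
proof -
  define c where "c = 1 / (2 * complex_of_real (R 0 \<xi>))"
  define t where "t = T 0 \<xi>"
  define t' where "t' a = T1 a \<xi>" for a
  define x where "x a = complex_of_real (X1 a 0 \<xi>)" for a
  define D where "D = complex_of_real (d 0 \<xi>)"
  define D' where "D' a = complex_of_real (d1 a \<xi>)" for a
  define q where "q = complex_of_real (C2 \<xi>)"
  define s where "s = complex_of_real (A 0)"
  define p where "p = p0 h w e 0 0"
  have c: "complex_of_real (1 / (2 * R 0 \<xi>)) = c" by (simp add: c_def)
  have m: "mat z ** X = z *\<^sub>c X" for z and X :: "complex^'r^'r" by (simp add: cscale_eq_mat_mult)
  have comm: "t ** mat z = mat z ** t" "W 3 0 ** mat z = mat z ** W 3 0" for z
    by (rule mat_commute)+
  have tr: "trace (W 3 0 ** t) = trace (t ** W 3 0)" "trace (W 3 0 ** (mat z ** t)) = z * trace (t ** W 3 0)"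
     "trace (mat z ** t ** W 3 0) = z * trace (t ** W 3 0)" "trace (mat z ** t ** mat y) = z * y * trace t" for z y
  proof -
    show "trace (mat z ** t ** mat y) = z * y * trace t" for y z
      by (simp add: matrix_mul_assoc[symmetric] comm mat_mult_assoc trace_mat_mult)
    show 1: "trace (W 3 0 ** t) = trace (t ** W 3 0)" by (rule trace_mul_sym)
    show 2: "trace (mat z ** t ** W 3 0) = z * trace (t ** W 3 0)" for z
      by (simp add: matrix_mul_assoc[symmetric] trace_mat_mult)
    show "trace (W 3 0 ** (mat z ** t)) = z * trace (t ** W 3 0)"
      by (subst trace_mul_sym) (rule 2)
  qed
  have sq: "mat (1/2) ** t ** (mat (1/2) ** t) = mat (1/4) ** (t ** t)"
  proof -
    have "mat (1/2) ** t ** (mat (1/2) ** t) = mat (1/2) ** (t ** mat (1/2)) ** t"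
      by (simp add: matrix_mul_assoc)
    then show ?thesis by (simp add: comm matrix_mul_assoc[symmetric] mat_mult_assoc)
  qed
  have ta: "trace (alpha_minus1 h w e 1 0 0 \<xi>) = c * (of_nat CARD('r) * q
      + \<i> * (\<Sum>a\<in>UNIV. x a * (trace (t' (tn a)) / 2 + of_nat CARD('r) * D' (tn a)))
      - (trace (t ** t) / 4 + D * trace t + of_nat CARD('r) * D\<^sup>2) + trace p
      + s * (trace t / 2 + of_nat CARD('r) * D) - (trace (t' 3) / 2 + of_nat CARD('r) * D' 3))"
    unfolding alpha_minus1_def
      alpha0_eq[OF pt00] root1_eq[OF pt00] Acoef_eq[OF pt00] dt_alpha0 contr2_alpha1 cscale_eq_mat_mult scaleR_eq_mat_mult
      contr1_def dx_alpha1[OF pt00] dxi_alpha1[OF pt00] dx_alpha0 pt_0 R1_0 c_def[symmetric] t_def[symmetric] t'_def[symmetric]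
      x_def[symmetric] D_def[symmetric] D'_def[symmetric] q_def[symmetric] s_def[symmetric] p_def[symmetric]
    by (simp add: mat_ring sq comm trace_add trace_sub trace_mat_mult trace_mat tr sum_2)
       (simp add: c_def algebra_simps power2_eq_square)
  have tb: "trace (beta_minus1 h w e 1 0 0 \<xi>) = c * (of_nat CARD('r) * q
      + \<i> * (\<Sum>a\<in>UNIV. x a * (trace (t' (tn a)) / 2 - of_nat CARD('r) * D' (tn a)))
      - (trace (t ** t) / 4 - D * trace t + of_nat CARD('r) * D\<^sup>2) + trace p
      - s * (trace t / 2 - of_nat CARD('r) * D) + (trace (t' 3) / 2 - of_nat CARD('r) * D' 3))"
    unfolding beta_minus1_def beta1_alpha1
      alpha0_eq[OF pt00] root1_eq[OF pt00] Acoef_eq[OF pt00] dt_alpha0 contr2_alpha1 cscale_eq_mat_mult scaleR_eq_mat_mult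
      contr1_def dx_alpha1[OF pt00] dxi_alpha1[OF pt00] dx_alpha0 pt_0 R1_0 c_def[symmetric] t_def[symmetric] t'_def[symmetric]
      x_def[symmetric] D_def[symmetric] D'_def[symmetric] q_def[symmetric] s_def[symmetric] p_def[symmetric]
    by (simp add: mat_ring sq comm trace_add trace_sub trace_mat_mult trace_mat tr sum_2)
       (simp add: c_def algebra_simps power2_eq_square)
  show ?thesis
    unfolding theta_minus1_def trace_add ta tb c t_def[symmetric] t'_def[symmetric] x_def[symmetric] p_def[symmetric]
      of_real_add of_real_diff of_real_mult of_real_power of_real_numeral
      D_def[symmetric] D'_def[symmetric] q_def[symmetric] s_def[symmetric]
    by (simp add: sum_2 field_simps power2_eq_square)
qed

end


section \<open>The symbol of the resolvent\<close>

lemma mat_zero: "(mat 0 :: complex^'r::finite^'r) ** X = 0"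
  by (simp add: vec_eq_iff mat_def matrix_matrix_mult_def)

context dn_symbol
begin

text \<open>For fixed \<xi> and \<mu> this is where \<open>mat \<mu> - theta1\<close> is invertible.
  Its openness permits differentiating the closed forms of the resolvent symbols.\<close>

definition V' :: "real^2 \<Rightarrow> complex \<Rightarrow> (real^3) set" where
  "V' \<xi> \<mu> = {y \<in> V. \<mu> \<noteq> 2 * of_real (R y \<xi>)}"

definition rr :: "complex \<Rightarrow> real^3 \<Rightarrow> real^2 \<Rightarrow> complex" where
  "rr \<mu> y \<xi> = 1 / (\<mu> - 2 * of_real (R y \<xi>))"

lemma V'_subset: "y \<in> V' \<xi> \<mu> \<Longrightarrow> y \<in> V"
  by (simp add: V'_def)

lemma open_V': "open (V' \<xi> \<mu>)"
proof -
  have "continuous_on V (\<lambda>y. R y \<xi>)"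
    unfolding R_def N_def by (intro continuous_intros u_cont)
  then have "continuous_on V (\<lambda>y. \<mu> - 2 * complex_of_real (R y \<xi>))"
    by (intro continuous_intros)
  then have "open (V \<inter> (\<lambda>y. \<mu> - 2 * complex_of_real (R y \<xi>)) -` (- {0}))"
    by (intro continuous_open_preimage V) auto
  moreover have "V' \<xi> \<mu> = V \<inter> (\<lambda>y. \<mu> - 2 * complex_of_real (R y \<xi>)) -` (- {0})"
    by (auto simp: V'_def)
  ultimately show ?thesis by simp
qed

lemma has_pd_rr:
  assumes y: "y \<in> V' \<xi> \<mu>"
  shows "has_pd i (\<lambda>y. rr \<mu> y \<xi>) (2 * (rr \<mu> y \<xi>)\<^sup>2 * of_real (R1 i y \<xi>)) y"
proof -
  have nz: "\<mu> - 2 * of_real (R y \<xi>) \<noteq> 0" using y by (simp add: V'_def)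
  show ?thesis
    unfolding rr_def
    by (rule has_pd_eq_rhs[OF has_pd_divide[OF has_pd_const has_pd_diff[OF has_pd_const
              has_pd_mult[OF has_pd_const has_pd_of_real[OF has_pd_R[OF V'_subset[OF y]]]]] nz]])
       (use nz in \<open>simp add: power_divide\<close>)
qed

lemma theta1_eq: "pt x 0 \<in> V \<Longrightarrow> theta1 h 1 x \<xi> = mat (2 * of_real (R (pt x 0) \<xi>))"
  by (simp add: theta1_def alpha1_eq beta1_alpha1 mat_add)

lemma theta0_eq:
  assumes "pt x 0 \<in> V"
  shows "theta0 h w 1 x \<xi> = T (pt x 0) \<xi>"
proof -
  have "theta0 h w 1 x \<xi> = mat (1/2) ** T (pt x 0) \<xi> + mat (1/2) ** T (pt x 0) \<xi>"
    by (simp add: theta0_def alpha0_eq[OF assms])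
  also have "\<dots> = (mat (1/2) + mat (1/2)) ** T (pt x 0) \<xi>"
    by (simp only: matrix_mult.add_left)
  finally show ?thesis by (simp add: mat_add)
qed

lemma dxi_theta1: "pt x 0 \<in> V \<Longrightarrow> dxi a (theta1 h 1) x \<xi> = mat (2 * of_real (X1 a (pt x 0) \<xi>))"
  unfolding dxi_def
  by (rule pd_eq, rule has_pd_ext[OF has_pd_mat[OF has_pd_mult[OF has_pd_const[of _ "2::complex"] has_pd_of_real[OF has_pd_R_xi]]]])
     (simp_all add: theta1_eq)

lemma dxi_dxi_theta1: "dxi a (dxi b (theta1 h 1)) 0 \<xi> = mat (2 * of_real (X2 b a \<xi>))"
  unfolding dxi_def[of a]
  by (rule pd_eq, rule has_pd_ext[OF has_pd_mat[OF has_pd_mult[OF has_pd_const[of _ "2::complex"] has_pd_of_real[OF has_pd_X1_xi]]]])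
     (simp_all add: dxi_theta1 V)

lemma r_minus1_eq:
  assumes "pt x 0 \<in> V' \<xi> \<mu>"
  shows "r_minus1 h 1 \<mu> x \<xi> = (mat (rr \<mu> (pt x 0) \<xi>) :: complex^'r^'r)"
  unfolding r_minus1_def rr_def theta1_eq[OF V'_subset[OF assms]] mat_diff
  by (rule matrix_inv_mat) (use assms in \<open>simp add: V'_def\<close>)

lemma Dx_r_minus1:
  assumes "pt x 0 \<in> V' \<xi> \<mu>"
  shows "Dx a (r_minus1 h 1 \<mu>) x \<xi> =
    (mat (- 2 * \<i> * (rr \<mu> (pt x 0) \<xi>)\<^sup>2 * of_real (R1 (tn a) (pt x 0) \<xi>)) :: complex^'r^'r)"
proof -
  have "dx a (r_minus1 h 1 \<mu>) x \<xi> = (mat (2 * (rr \<mu> (pt x 0) \<xi>)\<^sup>2 * of_real (R1 (tn a) (pt x 0) \<xi>)) :: complex^'r^'r)"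
    by (rule dx_eq[OF open_V' assms _ has_pd_mat[OF has_pd_rr[OF assms]]]) (rule r_minus1_eq)
  then show ?thesis
    by (simp add: Dx_def cscale_eq_mat_mult mat_mult_mat mult_ac)
qed

lemma r_minus2_eq:
  assumes y: "pt x 0 \<in> V' \<xi> \<mu>"
  shows "r_minus2 h w 1 \<mu> x \<xi> = mat (- 4 * \<i> * rr \<mu> (pt x 0) \<xi> ^ 3 * of_real (S (pt x 0) \<xi>))
    + mat (rr \<mu> (pt x 0) \<xi> ^ 2) ** T (pt x 0) \<xi>"
proof -
  note v = V'_subset[OF y]
  show ?thesis
    unfolding r_minus2_def contr1_def Dx_r_minus1[OF y] dxi_theta1[OF v] r_minus1_eq[OF y] theta0_eq[OF v]
      mat_commute[of "T (pt x 0) \<xi>"]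
    by (simp add: mat_ring sum_2 mat_add mat_diff S_def power2_eq_square power3_eq_cube)
       (simp add: algebra_simps)
qed

context
  fixes \<xi> :: "real^2" and \<mu> :: complex
  assumes \<mu>: "\<mu> \<noteq> 2 * of_real (R 0 \<xi>)"
begin

lemma zero_V': "pt 0 0 \<in> V' \<xi> \<mu>"
  using \<mu> by (simp add: V'_def V)

lemma Dx_r_minus2:
  "Dx a (r_minus2 h w 1 \<mu>) 0 \<xi> = mat (- 4 * rr \<mu> 0 \<xi> ^ 3 * of_real (S1 (tn a) \<xi>))
    + mat (- \<i> * rr \<mu> 0 \<xi> ^ 2) ** T1 (tn a) \<xi>"
proof -
  have r: "has_pd i (\<lambda>y. rr \<mu> y \<xi>) (2 * (rr \<mu> 0 \<xi>)\<^sup>2 * of_real (R1 i 0 \<xi>)) 0" for i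
    using has_pd_rr[OF zero_V'] by simp
  \<comment> \<open>Tangential derivatives of \<open>rr\<close> are multiples of \<open>R1\<close>
    and vanish at the origin, so in the product rule only \<open>S\<close> and \<open>T\<close> get
    differentiated.\<close>
  have r0: "has_pd (tn a) (\<lambda>y. rr \<mu> y \<xi>) 0 0"
    using r[of "tn a"] by (simp add: R1_0)
  have r2: "has_pd (tn a) (\<lambda>y. rr \<mu> y \<xi> ^ 2) 0 0"
    unfolding power2_eq_square using has_pd_mult[OF r0 r0] by simp
  have r3: "has_pd (tn a) (\<lambda>y. - 4 * \<i> * rr \<mu> y \<xi> ^ 3) 0 0"
    unfolding power3_eq_cube using has_pd_mult[OF has_pd_const[of _ "- 4 * \<i>"] has_pd_mult[OF has_pd_mult[OF r0 r0] r0]] by simp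
  have hp: "has_pd (tn a) (\<lambda>y. mat (- 4 * \<i> * rr \<mu> y \<xi> ^ 3 * of_real (S y \<xi>)) + mat (rr \<mu> y \<xi> ^ 2) ** T y \<xi>)
     (mat (- 4 * \<i> * rr \<mu> 0 \<xi> ^ 3 * of_real (S1 (tn a) \<xi>)) + mat (rr \<mu> 0 \<xi> ^ 2) ** T1 (tn a) \<xi>) (pt 0 0)"
    using has_pd_add[OF has_pd_mat[OF has_pd_mult[OF r3 has_pd_of_real[OF has_pd_S[of _ \<xi>]]]]
        has_pd_matrix_mult[OF has_pd_mat[OF r2] has_pd_T[of _ \<xi>]]]
    by (simp add: mat_zero)
  have "dx a (r_minus2 h w 1 \<mu>) 0 \<xi> =
     mat (- 4 * \<i> * rr \<mu> 0 \<xi> ^ 3 * of_real (S1 (tn a) \<xi>)) + mat (rr \<mu> 0 \<xi> ^ 2) ** T1 (tn a) \<xi>"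
    by (rule dx_eq[OF open_V' zero_V' _ hp]) (rule r_minus2_eq)
  then show ?thesis
    by (simp add: Dx_def cscale_eq_mat_mult mat_ring mult_ac)
qed

lemma Dx_Dx_r_minus1:
  "Dx a (Dx b (r_minus1 h 1 \<mu>)) 0 \<xi> = (mat (- 2 * (rr \<mu> 0 \<xi>)\<^sup>2 * of_real (R2 (tn b) (tn a) \<xi>)) :: complex^'r^'r)"
proof -
  have r: "has_pd i (\<lambda>y. rr \<mu> y \<xi>) (2 * (rr \<mu> 0 \<xi>)\<^sup>2 * of_real (R1 i 0 \<xi>)) 0" for i
    using has_pd_rr[OF zero_V'] by simp
  have r0: "has_pd (tn a) (\<lambda>y. rr \<mu> y \<xi>) 0 0"
    using r[of "tn a"] by (simp add: R1_0)
  have r2: "has_pd (tn a) (\<lambda>y. - 2 * \<i> * rr \<mu> y \<xi> ^ 2) 0 0"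
    unfolding power2_eq_square using has_pd_mult[OF has_pd_const[of _ "- 2 * \<i>"] has_pd_mult[OF r0 r0]] by simp
  have hp: "has_pd (tn a) (\<lambda>y. mat (- 2 * \<i> * (rr \<mu> y \<xi>)\<^sup>2 * of_real (R1 (tn b) y \<xi>)))
     (mat (- 2 * \<i> * (rr \<mu> 0 \<xi>)\<^sup>2 * of_real (R2 (tn b) (tn a) \<xi>)) :: complex^'r^'r) (pt 0 0)"
    using has_pd_mat[OF has_pd_mult[OF r2 has_pd_of_real[OF has_pd_R1]]] by simp
  have "dx a (Dx b (r_minus1 h 1 \<mu>)) 0 \<xi> =
     (mat (- 2 * \<i> * (rr \<mu> 0 \<xi>)\<^sup>2 * of_real (R2 (tn b) (tn a) \<xi>)) :: complex^'r^'r)"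
    by (rule dx_eq[OF open_V' zero_V' _ hp]) (rule Dx_r_minus1)
  then show ?thesis
    by (simp add: Dx_def[of a] cscale_eq_mat_mult mat_ring mult_ac)
qed

lemma contr2_r_minus1:
  "contr2 Dx (theta1 h 1) (r_minus1 h 1 \<mu>) 0 \<xi> = (mat (- 4 * (rr \<mu> 0 \<xi>)\<^sup>2 * of_real (C2 \<xi>)) :: complex^'r^'r)"
  unfolding contr2_def multi_indices_2
  by (simp add: mderiv_def numeral_2_eq_2 dxi_dxi_theta1 Dx_Dx_r_minus1 scaleR_eq_mat_mult
      mat_mult_mat mat_add C2_def) (rule arg_cong[where f = mat], algebra)

text \<open>The contraction of \<open>theta0\<close> with \<open>r_minus1\<close> vanishes because
  the tangential derivatives of \<open>r_minus1\<close> are zero at the origin. The fourth order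
  term comes solely from the derivative of \<open>S\<close> in \<open>r_minus2\<close>: its factor 8
  is 2 from \<open>theta1\<close> times 4 from \<open>r_minus2\<close>.\<close>

lemma trace_r_minus3:
  fixes r :: complex
  defines "r \<equiv> rr \<mu> 0 \<xi>"
  shows "trace (r_minus3 h w e 1 \<mu> 0 \<xi>) =
    r\<^sup>2 * trace (theta_minus1 h w e 1 0 \<xi>)
    + r ^ 3 * (- 4 * of_nat CARD('r) * of_real (C2 \<xi>) - 2 * \<i> * (\<Sum>a\<in>UNIV. X1 a 0 \<xi> * trace (T1 (tn a) \<xi>))
        + trace (T 0 \<xi> ** T 0 \<xi>))
    - 8 * r ^ 4 * of_nat CARD('r) * (\<Sum>a\<in>UNIV. X1 a 0 \<xi> * S1 (tn a) \<xi>)"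
proof -
  define th where "th = theta_minus1 h w e 1 0 \<xi>"
  define t where "t = T 0 \<xi>"
  have comm: "X ** mat r = mat r ** X" for X :: "complex^'r^'r" by (rule mat_commute)
  have tt: "t ** (mat z ** t) = mat z ** (t ** t)" for z
    using mat_commute[of t z] by (simp add: matrix_mul_assoc)
  have r1: "r_minus1 h 1 \<mu> 0 \<xi> = (mat r :: complex^'r^'r)"
    using r_minus1_eq[OF zero_V'] by (simp add: r_def)
  have r2: "r_minus2 h w 1 \<mu> 0 \<xi> = mat (r\<^sup>2) ** t"
    using r_minus2_eq[OF zero_V'] by (simp add: r_def S_0 t_def)
  have d1: "Dx a (r_minus1 h 1 \<mu>) 0 \<xi> = (0 :: complex^'r^'r)" for a
    using Dx_r_minus1[OF zero_V'] by (simp add: R1_0)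
  show ?thesis
    unfolding r_minus3_def contr2_r_minus1 contr1_def r1 r2 d1 Dx_r_minus2 dxi_theta1[OF pt00] theta0_eq[OF pt00] pt_0
      r_def[symmetric] th_def[symmetric] t_def[symmetric] comm
    by (simp add: mat_ring trace_add trace_sub trace_mat_mult trace_mat tt sum_2)
       (simp add: algebra_simps eval_nat_numeral)
qed

end

end


section \<open>The symbol at the centre of boundary normal coordinates\<close>

text \<open>The tangential values are the 2-jet at the centre of geodesic normal coordinates with
  Gauss curvature \<open>K\<close>: the inverse metric has diagonal entries
  \<open>1 + K/3 * x2^2\<close>, \<open>1 + K/3 * x1^2\<close> and off-diagonal entry
  \<open>- K/3 * x1 * x2\<close>, and the logarithm of the determinant is
  \<open>- K/3 * (x1^2 + x2^2)\<close>. The normal derivative of the inverse metric is twice the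
  shape operator.\<close>

locale dn_symbol_normal = dn_symbol h W e V u u1 u2 L1 L2 A A1 W1
  for h :: "real \<Rightarrow> real^2 \<Rightarrow> real^2^2" and W :: "3 \<Rightarrow> real^3 \<Rightarrow> complex^'r::finite^'r"
    and e V u u1 u2 L1 L2 A A1 W1 +
  fixes \<kappa>1 \<kappa>2 K A' :: real
  assumes u1_sym: "u1 a b i y = u1 b a i y" and u2_sym: "u2 a b i j = u2 b a i j"
    and u1_normal: "u1 1 1 3 0 = 2 * \<kappa>1" "u1 1 2 3 0 = 0" "u1 2 2 3 0 = 2 * \<kappa>2"
    and u2_11: "u2 1 1 1 1 = 0" "u2 1 1 1 2 = 0" "u2 1 1 2 1 = 0" "u2 1 1 2 2 = 2 * K / 3"
    and u2_12: "u2 1 2 1 1 = 0" "u2 1 2 1 2 = - K / 3" "u2 1 2 2 1 = - K / 3" "u2 1 2 2 2 = 0"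
    and u2_22: "u2 2 2 1 1 = 2 * K / 3" "u2 2 2 1 2 = 0" "u2 2 2 2 1 = 0" "u2 2 2 2 2 = 0"
    and L2_eq: "L2 1 1 = - 2 * K / 3" "L2 1 2 = 0" "L2 2 1 = 0" "L2 2 2 = - 2 * K / 3"
    and A_0: "A 0 = \<kappa>1 + \<kappa>2" and A1_3: "A1 3 = A'"
begin

lemma u2_21: "u2 2 1 i j = u2 1 2 i j" by (rule u2_sym)
lemma u1_21: "u1 2 1 i y = u1 1 2 i y" by (rule u1_sym)

lemmas u2_values = u2_11 u2_12 u2_22 u2_21

lemma R_0: "R 0 \<xi> = rho \<xi>"
  unfolding rho_def norm_square_2 by (simp add: R_def N_def u_0 sum_2 power2_eq_square add.commute)

lemma root1_rho: "root1 h 1 0 0 \<xi> = of_real (rho \<xi>)"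
  using root1_eq[OF pt00] by (simp add: R_0)

text \<open>These are the second derivatives of \<open>K/3 * (x1 * \<xi>2 - x2 * \<xi>1)^2\<close>,
  the tangential second order part of \<open>N\<close>.\<close>

lemma N2_values:
  "N2 1 1 \<xi> = 2 * K / 3 * (\<xi> $ 2)\<^sup>2" "N2 2 2 \<xi> = 2 * K / 3 * (\<xi> $ 1)\<^sup>2"
  "N2 1 2 \<xi> = - 2 * K / 3 * (\<xi> $ 1 * \<xi> $ 2)" "N2 2 1 \<xi> = - 2 * K / 3 * (\<xi> $ 1 * \<xi> $ 2)"
  by (simp_all add: N2_def sum_2 u2_values power2_eq_square)

lemma R1_tangential: "R1 1 0 \<xi> = 0" "R1 2 0 \<xi> = 0"
  using R1_0[of 1 \<xi>] R1_0[of 2 \<xi>] by simp_all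

lemma R2_values:
  "R2 1 1 \<xi> = K / (3 * rho \<xi>) * (\<xi> $ 2)\<^sup>2" "R2 2 2 \<xi> = K / (3 * rho \<xi>) * (\<xi> $ 1)\<^sup>2"
  "R2 1 2 \<xi> = - K / (3 * rho \<xi>) * (\<xi> $ 1 * \<xi> $ 2)" "R2 2 1 \<xi> = - K / (3 * rho \<xi>) * (\<xi> $ 1 * \<xi> $ 2)"
  using rho_pos[of \<xi>] by (simp_all add: R2_def N2_values R1_tangential R_0)

lemma C2_eq: "C2 \<xi> = K * ((\<xi> $ 1)\<^sup>2 + (\<xi> $ 2)\<^sup>2) / (6 * (rho \<xi>)\<^sup>2)"
  using rho_pos[of \<xi>] by (simp add: C2_def X2_def R2_values R_0 field_simps power2_eq_square)

text \<open>The quadratic form \<open>(x1 * \<xi>2 - x2 * \<xi>1)^2\<close> does not change when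
  \<open>x\<close> moves in the direction \<xi>, so contracting its second derivatives with \<xi>
  gives zero. This removes the fourth order pole.\<close>

lemma S1_tangential: "S1 1 \<xi> = 0" "S1 2 \<xi> = 0"
  by (simp_all add: S1_def sum_2 X1_0 R2_values R1_tangential R_0 power2_eq_square)

lemma B_0: "B 0 \<xi> = 0"
  using u1_0[of _ _ 1] u1_0[of _ _ 2] by (simp add: B_def sum_2 L1_0)

lemma B1_values: "B1 1 \<xi> = - 2 * K / 3 * \<xi> $ 1" "B1 2 \<xi> = - 2 * K / 3 * \<xi> $ 2"
  by (simp_all add: B1_def sum_2 u_0 L2_eq u2_values)

lemma trace_T1:
  "trace (T1 1 \<xi>) = - \<i> / of_real (rho \<xi>) * (of_nat CARD('r) * of_real (- 2 * K / 3 * \<xi> $ 1)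
     + 2 * (of_real (\<xi> $ 1) * trace (W1 1 1) + of_real (\<xi> $ 2) * trace (W1 2 1)))"
  "trace (T1 2 \<xi>) = - \<i> / of_real (rho \<xi>) * (of_nat CARD('r) * of_real (- 2 * K / 3 * \<xi> $ 2)
     + 2 * (of_real (\<xi> $ 1) * trace (W1 1 2) + of_real (\<xi> $ 2) * trace (W1 2 2)))"
  using u1_0[of _ _ 1] u1_0[of _ _ 2] rho_pos[of \<xi>]
  by (simp_all add: T1_def S1_tangential R1_tangential R_0 mat_zero P1_def sum_2 u_0 B1_values trace_mat_mult trace_add
      trace_sub trace_mat scaleR_eq_mat_mult)
     (simp_all add: field_simps)

definition WW :: "2 \<Rightarrow> 2 \<Rightarrow> complex" where
  "WW a b = trace (W (tn a) 0 ** W (tn b) 0)"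

lemma trace_TT:
  "trace (T 0 \<xi> ** T 0 \<xi>) = - 4 / (of_real (rho \<xi>))\<^sup>2 *
    ((of_real (\<xi> $ 1))\<^sup>2 * WW 1 1 + of_real (\<xi> $ 1 * \<xi> $ 2) * (WW 1 2 + WW 2 1) + (of_real (\<xi> $ 2))\<^sup>2 * WW 2 2)"
proof -
  have T: "T 0 \<xi> = mat (- 2 * \<i> / of_real (rho \<xi>)) **
    (mat (of_real (\<xi> $ 1)) ** W 1 0 + mat (of_real (\<xi> $ 2)) ** W 2 0)"
    by (simp add: T_def P_def R_0 B_0 S_0 sum_2 u_0 scaleR_eq_mat_mult mat_ring mat_add mat_diff
        mat_uminus[symmetric] mult_ac)
  have ab: "trace ((mat a ** X) ** (mat b ** Y)) = a * b * trace (X ** Y)" for a b and X Y :: "complex^'r^'r"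
  proof -
    have "(mat a ** X) ** (mat b ** Y) = mat a ** (X ** mat b) ** Y" by (simp add: matrix_mul_assoc)
    also have "\<dots> = mat (a * b) ** (X ** Y)" by (simp add: mat_commute[of X] mat_mult_assoc matrix_mul_assoc mat_mult_mat)
    finally show ?thesis by (simp add: trace_mat_mult)
  qed
  show ?thesis
    unfolding T ab by (simp add: mat_ring trace_add ab WW_def)
      (simp add: power2_eq_square field_simps)
qed

lemma trace_p0:
  "trace (p0 h w e 0 0) = - (trace (W1 1 1) + WW 1 1 + trace (W1 2 2) + WW 2 2) - trace (e 0 0)"
proof -
  have "pd a (w (tn b) 0) 0 = W1 (tn b) (tn a)" for a b
    by (rule pd_pt_eq[OF open_UNIV]) (use pd_W in auto)
  then have "p0 h w e 0 0 = - (W1 1 1 + W 1 0 ** W 1 0 + (W1 2 2 + W 2 0 ** W 2 0)) - e 0 0"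
    using ginv_eq[OF pt00] by (simp add: p0_def sum_2 u_0 christoffel_0)
  then show ?thesis
    by (simp add: trace_add trace_sub trace_uminus WW_def)
qed

lemma N1_3: "N1 3 0 \<xi> = 2 * (\<kappa>1 * (\<xi> $ 1)\<^sup>2 + \<kappa>2 * (\<xi> $ 2)\<^sup>2)"
  by (simp add: N1_def sum_2 u1_normal u1_21 power2_eq_square)

lemma N2_33: "N2 3 3 \<xi> = u2 1 1 3 3 * (\<xi> $ 1)\<^sup>2 + 2 * u2 1 2 3 3 * (\<xi> $ 1 * \<xi> $ 2) + u2 2 2 3 3 * (\<xi> $ 2)\<^sup>2"
  by (simp add: N2_def sum_2 u2_21 power2_eq_square)

text \<open>The cross terms between the mean curvature and \<open>k\<close> cancel between
  \<open>- 2 * d^2\<close> and \<open>2 * A * d\<close>. The coefficient -5/2 is -1/2 from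
  \<open>- 2 * d^2\<close> plus -2 from the normal derivative of \<open>d\<close>.\<close>

lemma normal_terms:
  "- 2 * (d 0 \<xi>)\<^sup>2 + 2 * A 0 * d 0 \<xi> - 2 * d1 3 \<xi> =
     (\<kappa>1 + \<kappa>2)\<^sup>2 / 2 - A' + N2 3 3 \<xi> / (2 * (rho \<xi>)\<^sup>2)
       - 5/2 * (\<kappa>1 * (\<xi> $ 1)\<^sup>2 + \<kappa>2 * (\<xi> $ 2)\<^sup>2)\<^sup>2 / (rho \<xi>)^4"
proof -
  define k where "k = \<kappa>1 * (\<xi> $ 1)\<^sup>2 + \<kappa>2 * (\<xi> $ 2)\<^sup>2"
  define \<rho> where "\<rho> = rho \<xi>"
  have \<rho>: "\<rho> \<noteq> 0" using rho_pos[of \<xi>] by (simp add: \<rho>_def)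
  have R1: "R1 3 0 \<xi> = k / \<rho>"
    unfolding R1_def N1_3 k_def[symmetric] R_0 \<rho>_def[symmetric] by simp
  have d0: "d 0 \<xi> = (\<kappa>1 + \<kappa>2) / 2 - k / (2 * \<rho>\<^sup>2)"
    by (simp add: d_def A_0 R1 R_0 \<rho>_def[symmetric] power2_eq_square)
  have R2: "R2 3 3 \<xi> = N2 3 3 \<xi> / (2 * \<rho>) - k\<^sup>2 / \<rho>^3"
    using \<rho> unfolding R2_def R1 R_0 \<rho>_def[symmetric] by (simp add: field_simps eval_nat_numeral)
  have d1: "d1 3 \<xi> = A' / 2 - N2 3 3 \<xi> / (4 * \<rho>\<^sup>2) + k\<^sup>2 / \<rho>^4"
    using \<rho> unfolding d1_def R2 R1 R_0 A1_3 \<rho>_def[symmetric] by (simp add: field_simps eval_nat_numeral)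
  show ?thesis
    unfolding d0 d1 A_0 k_def[symmetric] \<rho>_def[symmetric] using \<rho>
    by (simp add: field_simps eval_nat_numeral)
qed

text \<open>Together with \<open>Q22\<close> and \<open>Q12\<close>, the symmetric part of the trace
  of the derivative of the connection form plus its square. The connection enters the trace of
  \<open>r_minus3\<close> only through these three numbers.\<close>

definition "Q11 = trace (W1 1 1) + WW 1 1"
definition "Q22 = trace (W1 2 2) + WW 2 2"
definition "Q12 = trace (W1 1 2) + trace (W1 2 1) + WW 1 2 + WW 2 1"

lemma trace_r_minus3_normal:
  fixes n :: complex
  assumes \<mu>: "\<mu> \<noteq> 2 * of_real (rho \<xi>)"
  defines "n \<equiv> of_nat CARD('r)"
  shows "trace (r_minus3 h w e 1 \<mu> 0 \<xi>) =
     ((n / 2 * of_real ((\<kappa>1 + \<kappa>2)\<^sup>2 / 2 - A') - (Q11 + Q22) - trace (e 0 0))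
      + ((n / 2 * of_real (u2 1 1 3 3 / 2 - K / 3) + Q11) * of_real ((\<xi> $ 1)\<^sup>2)
         + (n / 2 * of_real (u2 1 2 3 3) + Q12) * of_real (\<xi> $ 1 * \<xi> $ 2)
         + (n / 2 * of_real (u2 2 2 3 3 / 2 - K / 3) + Q22) * of_real ((\<xi> $ 2)\<^sup>2)) / (of_real (rho \<xi>))\<^sup>2
      + (- 5/4 * n * of_real (\<kappa>1\<^sup>2) * of_real ((\<xi> $ 1)^4)
         + - 5/2 * n * of_real (\<kappa>1 * \<kappa>2) * of_real ((\<xi> $ 1)\<^sup>2 * (\<xi> $ 2)\<^sup>2)
         + - 5/4 * n * of_real (\<kappa>2\<^sup>2) * of_real ((\<xi> $ 2)^4)) / of_real (rho \<xi>)^4)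
       / of_real (rho \<xi>) / (\<mu> - 2 * of_real (rho \<xi>))\<^sup>2
     + ((n * of_real (2 * K / 3) - 4 * Q11) * of_real ((\<xi> $ 1)\<^sup>2) + - 4 * Q12 * of_real (\<xi> $ 1 * \<xi> $ 2)
        + (n * of_real (2 * K / 3) - 4 * Q22) * of_real ((\<xi> $ 2)\<^sup>2)) / (of_real (rho \<xi>))\<^sup>2
       / (\<mu> - 2 * of_real (rho \<xi>)) ^ 3"
proof -
  define \<rho> where "\<rho> = complex_of_real (rho \<xi>)"
  define x where "x = complex_of_real (\<xi> $ 1)"
  define y where "y = complex_of_real (\<xi> $ 2)"
  define r where "r = 1 / (\<mu> - 2 * \<rho>)"
  define N where "N = complex_of_real (N2 3 3 \<xi>)"
  define q where "q = x\<^sup>2 * Q11 + x * y * Q12 + y\<^sup>2 * Q22"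
  define k where "k = of_real \<kappa>1 * x\<^sup>2 + of_real \<kappa>2 * y\<^sup>2"
  define m where "m = complex_of_real ((\<kappa>1 + \<kappa>2)\<^sup>2 / 2 - A')"
  define c where "c = complex_of_real K"
  have \<rho>: "\<rho> \<noteq> 0" using rho_pos[of \<xi>] by (simp add: \<rho>_def)
  have \<mu>': "\<mu> \<noteq> 2 * of_real (R 0 \<xi>)" using \<mu> by (simp add: R_0)
  have rr: "rr \<mu> 0 \<xi> = r" by (simp add: rr_def r_def R_0 \<rho>_def)
  have C2: "complex_of_real (C2 \<xi>) = c * (x\<^sup>2 + y\<^sup>2) / (6 * \<rho>\<^sup>2)"
    by (simp add: C2_eq c_def x_def y_def \<rho>_def)
  have S: "(\<Sum>a\<in>UNIV. X1 a 0 \<xi> * S1 (tn a) \<xi>) = 0" by (simp add: sum_2 S1_tangential)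
  \<comment> \<open>With \<open>s\<close> and \<open>t\<close> as defined below, the order zero
    symbol \<open>T\<close> contributes \<open>\<i> * s - t / 2\<close> to the double pole and
    \<open>- 2 * \<i> * s + t\<close> to the triple pole. Both are multiples of
    \<open>s + \<i> / 2 * t\<close>, so only this combination is needed.\<close>
  have XT: "(\<Sum>a\<in>UNIV. of_real (X1 a 0 \<xi>) * trace (T1 (tn a) \<xi>)) + \<i> / 2 * trace (T 0 \<xi> ** T 0 \<xi>) =
      - \<i> / \<rho>\<^sup>2 * (- 2/3 * c * n * (x\<^sup>2 + y\<^sup>2) + 2 * q)"
    using \<rho> by (simp add: sum_2 trace_T1 X1_0 R_0 trace_TT n_def[symmetric] \<rho>_def[symmetric] x_def[symmetric] y_def[symmetric]
        c_def[symmetric] q_def Q11_def Q22_def Q12_def)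
      (simp add: field_simps power2_eq_square)
  define s where "s = (\<Sum>a\<in>UNIV. complex_of_real (X1 a 0 \<xi>) * trace (T1 (tn a) \<xi>))"
  define t where "t = trace (T 0 \<xi> ** T 0 \<xi>)"
  have s: "s = - \<i> / \<rho>\<^sup>2 * (- 2/3 * c * n * (x\<^sup>2 + y\<^sup>2) + 2 * q) - \<i> / 2 * t"
    using XT by (simp add: s_def t_def algebra_simps)
  have th: "trace (theta_minus1 h w e 1 0 \<xi>) = 1 / (2 * \<rho>) *
     (n * (c * (x\<^sup>2 + y\<^sup>2) / (3 * \<rho>\<^sup>2) + m + N / (2 * \<rho>\<^sup>2) - 5/2 * k\<^sup>2 / \<rho>^4)
      + \<i> * s - t / 2 - 2 * (Q11 + Q22) - 2 * trace (e 0 0))"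
  proof -
    have "complex_of_real (2 * C2 \<xi> - 2 * (d 0 \<xi>)\<^sup>2 + 2 * A 0 * d 0 \<xi> - 2 * d1 3 \<xi>) =
        complex_of_real (2 * C2 \<xi> + (- 2 * (d 0 \<xi>)\<^sup>2 + 2 * A 0 * d 0 \<xi> - 2 * d1 3 \<xi>))"
      by simp
    also have "\<dots> = c * (x\<^sup>2 + y\<^sup>2) / (3 * \<rho>\<^sup>2) + m + N / (2 * \<rho>\<^sup>2) - 5/2 * k\<^sup>2 / \<rho>^4"
      unfolding normal_terms C2_eq
      by (simp add: m_def N_def k_def c_def x_def y_def \<rho>_def)
    finally show ?thesis
      unfolding trace_theta_minus1 trace_p0 s_def t_def n_def R_0 Q11_def Q22_def
      by (simp add: \<rho>_def)
  qed
  have N: "N = of_real (u2 1 1 3 3) * x\<^sup>2 + 2 * of_real (u2 1 2 3 3) * (x * y) + of_real (u2 2 2 3 3) * y\<^sup>2"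
    by (simp add: N_def N2_33 x_def y_def)
  have "trace (r_minus3 h w e 1 \<mu> 0 \<xi>) =
     r\<^sup>2 * (1 / (2 * \<rho>) * (n * (- (c * (x\<^sup>2 + y\<^sup>2) / (3 * \<rho>\<^sup>2)) + m + N / (2 * \<rho>\<^sup>2) - 5/2 * k\<^sup>2 / \<rho>^4)
        + 2 * q / \<rho>\<^sup>2 - 2 * (Q11 + Q22) - 2 * trace (e 0 0)))
     + r ^ 3 * (n * (2/3 * c) * (x\<^sup>2 + y\<^sup>2) / \<rho>\<^sup>2 - 4 * q / \<rho>\<^sup>2)"
    unfolding trace_r_minus3[OF \<mu>'] rr S th C2 n_def[symmetric] s_def[symmetric] t_def[symmetric] s
    using \<rho> by (simp add: field_simps power2_eq_square)
  also have "1 / (2 * \<rho>) * (n * (- (c * (x\<^sup>2 + y\<^sup>2) / (3 * \<rho>\<^sup>2)) + m + N / (2 * \<rho>\<^sup>2) - 5/2 * k\<^sup>2 / \<rho>^4)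
        + 2 * q / \<rho>\<^sup>2 - 2 * (Q11 + Q22) - 2 * trace (e 0 0)) =
     ((n / 2 * m - (Q11 + Q22) - trace (e 0 0))
      + ((n / 2 * (of_real (u2 1 1 3 3) / 2 - c / 3) + Q11) * x\<^sup>2
         + (n / 2 * of_real (u2 1 2 3 3) + Q12) * (x * y)
         + (n / 2 * (of_real (u2 2 2 3 3) / 2 - c / 3) + Q22) * y\<^sup>2) / \<rho>\<^sup>2
      + (- 5/4 * n * of_real \<kappa>1 ^ 2 * x ^ 4
         + - 5/2 * n * (of_real \<kappa>1 * of_real \<kappa>2) * (x\<^sup>2 * y\<^sup>2)
         + - 5/4 * n * of_real \<kappa>2 ^ 2 * y ^ 4) / \<rho>^4) / \<rho>"
    unfolding N k_def q_def using \<rho> by (simp add: field_simps eval_nat_numeral)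
  also have "n * (2/3 * c) * (x\<^sup>2 + y\<^sup>2) / \<rho>\<^sup>2 - 4 * q / \<rho>\<^sup>2 =
    ((n * (2 * c / 3) - 4 * Q11) * x\<^sup>2 + - 4 * Q12 * (x * y) + (n * (2 * c / 3) - 4 * Q22) * y\<^sup>2) / \<rho>\<^sup>2"
    unfolding q_def using \<rho> by (simp add: field_simps)
  finally show ?thesis
    unfolding m_def c_def \<rho>_def[symmetric] of_real_mult of_real_power of_real_diff of_real_divide of_real_numeral
      x_def[symmetric] y_def[symmetric] 
    by (simp only: r_def power_divide power_one times_divide_eq_left mult_1)
qed

end


section \<open>Symmetry of second derivatives\<close>

lemma has_pd_line:
  "((\<lambda>s. f (y + s *\<^sub>R axis i 1)) has_vector_derivative D) (at s) \<longleftrightarrow> has_pd i f D (y + s *\<^sub>R axis i 1)"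
  by (simp add: has_pd_def has_vector_derivative_def has_derivative_at scaleR_add_left add.assoc)

lemma has_pd_unique: "has_pd i f D x \<Longrightarrow> has_pd i f D' x \<Longrightarrow> D = D'"
  unfolding has_pd_def by (rule vector_derivative_unique_at)

lemma MVT_pd:
  fixes f :: "real^'n \<Rightarrow> real"
  assumes "0 < h" "\<And>s. 0 \<le> s \<Longrightarrow> s \<le> h \<Longrightarrow> has_pd i f (f' (y + s *\<^sub>R axis i 1)) (y + s *\<^sub>R axis i 1)"
  obtains s where "0 < s" "s < h" "f (y + h *\<^sub>R axis i 1) - f y = h * f' (y + s *\<^sub>R axis i 1)"
proof -
  have "\<exists>z. 0 < z \<and> z < h \<and> f (y + h *\<^sub>R axis i 1) - f (y + 0 *\<^sub>R axis i 1) = (h - 0) * f' (y + z *\<^sub>R axis i 1)"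
    by (rule MVT2[OF assms(1)])
       (use assms(2) in \<open>auto simp: has_pd_line[symmetric] has_real_derivative_iff_has_vector_derivative\<close>)
  then show thesis using that by auto
qed

text \<open>Applying the mean value theorem twice to the second difference over a square of side
  \<open>h\<close>, in either order, writes it as \<open>h^2\<close> times \<open>fij\<close> at one
  nearby point and as \<open>h^2\<close> times \<open>fji\<close> at another. Continuity at
  \<open>x\<close> alone then forces equality.\<close>

lemma pd_commute:
  fixes f :: "real^'n \<Rightarrow> real"
  assumes V: "open V" "x \<in> V"
    and i: "\<And>y. y \<in> V \<Longrightarrow> has_pd i f (fi y) y" and j: "\<And>y. y \<in> V \<Longrightarrow> has_pd j f (fj y) y"
    and ij: "\<And>y. y \<in> V \<Longrightarrow> has_pd j fi (fij y) y" and ji: "\<And>y. y \<in> V \<Longrightarrow> has_pd i fj (fji y) y"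
    and cont: "isCont fij x" "isCont fji x"
  shows "fij x = fji x"
proof (rule ccontr)
  assume ne: "fij x \<noteq> fji x"
  define \<epsilon> where "\<epsilon> = dist (fij x) (fji x) / 2"
  have \<epsilon>: "0 < \<epsilon>" using ne by (simp add: \<epsilon>_def)
  obtain r1 where r1: "0 < r1" "\<And>y. dist y x < r1 \<Longrightarrow> dist (fij y) (fij x) < \<epsilon>"
    using cont(1) \<epsilon> unfolding continuous_at_eps_delta by metis
  obtain r2 where r2: "0 < r2" "\<And>y. dist y x < r2 \<Longrightarrow> dist (fji y) (fji x) < \<epsilon>"
    using cont(2) \<epsilon> unfolding continuous_at_eps_delta by metis
  obtain r3 where r3: "0 < r3" "ball x r3 \<subseteq> V"
    using V open_contains_ball by blast
  \<comment> \<open>A third of the radius, since two steps of length at most \<open>h\<close> must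
    stay strictly inside the ball.\<close>
  define h where "h = min r1 (min r2 r3) / 3"
  have h: "0 < h" using r1 r2 r3 by (simp add: h_def)
  have near: "dist (x + s *\<^sub>R axis i 1 + t *\<^sub>R axis j 1) x < min r1 (min r2 r3)"
    if "0 \<le> s" "s \<le> h" "0 \<le> t" "t \<le> h" for s t
  proof -
    have "dist (x + s *\<^sub>R axis i 1 + t *\<^sub>R axis j 1) x = norm (s *\<^sub>R axis i (1::real) + t *\<^sub>R axis j 1)"
      by (simp add: dist_norm add.assoc)
    also have "\<dots> \<le> s + t"
      using that norm_triangle_ineq[of "s *\<^sub>R axis i (1::real)" "t *\<^sub>R axis j 1"] by simp
    also have "\<dots> < min r1 (min r2 r3)" using that h by (simp add: h_def)
    finally show ?thesis .
  qed
  have inV: "x + s *\<^sub>R axis i 1 + t *\<^sub>R axis j 1 \<in> V" if "0 \<le> s" "s \<le> h" "0 \<le> t" "t \<le> h" for s t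
    using near[OF that] r3 by (auto simp: dist_commute)
  have inV': "x + t *\<^sub>R axis j 1 + s *\<^sub>R axis i 1 \<in> V" if "0 \<le> s" "s \<le> h" "0 \<le> t" "t \<le> h" for s t
    using inV[OF that] by (simp add: ac_simps)
  have shift: "has_pd k (\<lambda>y. g (y + c)) D y" if "has_pd k g D (y + c)" for k and g :: "real^'n \<Rightarrow> real" and D y c
    using that by (simp add: has_pd_def ac_simps)
  obtain s1 where s1: "0 < s1" "s1 < h"
    "(f (x + h *\<^sub>R axis i 1 + h *\<^sub>R axis j 1) - f (x + h *\<^sub>R axis i 1)) - (f (x + h *\<^sub>R axis j 1) - f x) =
       h * (fi (x + s1 *\<^sub>R axis i 1 + h *\<^sub>R axis j 1) - fi (x + s1 *\<^sub>R axis i 1))"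
    by (rule MVT_pd[OF h, of i "\<lambda>y. f (y + h *\<^sub>R axis j 1) - f y" "\<lambda>y. fi (y + h *\<^sub>R axis j 1) - fi y" x])
       (use inV[of _ h] inV[of _ 0] h in \<open>auto intro!: has_pd_diff shift i\<close>)
  obtain t1 where t1: "0 < t1" "t1 < h"
    "fi (x + s1 *\<^sub>R axis i 1 + h *\<^sub>R axis j 1) - fi (x + s1 *\<^sub>R axis i 1) =
       h * fij (x + s1 *\<^sub>R axis i 1 + t1 *\<^sub>R axis j 1)"
    by (rule MVT_pd[OF h, of j fi fij "x + s1 *\<^sub>R axis i 1"]) (use inV s1 in \<open>auto intro!: ij\<close>)
  obtain t2 where t2: "0 < t2" "t2 < h"
    "(f (x + h *\<^sub>R axis j 1 + h *\<^sub>R axis i 1) - f (x + h *\<^sub>R axis j 1)) - (f (x + h *\<^sub>R axis i 1) - f x) =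
       h * (fj (x + t2 *\<^sub>R axis j 1 + h *\<^sub>R axis i 1) - fj (x + t2 *\<^sub>R axis j 1))"
    by (rule MVT_pd[OF h, of j "\<lambda>y. f (y + h *\<^sub>R axis i 1) - f y" "\<lambda>y. fj (y + h *\<^sub>R axis i 1) - fj y" x])
       (use inV'[of h] inV'[of 0] h in \<open>auto intro!: has_pd_diff shift j\<close>)
  obtain s2 where s2: "0 < s2" "s2 < h"
    "fj (x + t2 *\<^sub>R axis j 1 + h *\<^sub>R axis i 1) - fj (x + t2 *\<^sub>R axis j 1) =
       h * fji (x + t2 *\<^sub>R axis j 1 + s2 *\<^sub>R axis i 1)"
    by (rule MVT_pd[OF h, of i fj fji "x + t2 *\<^sub>R axis j 1"]) (use inV' t2 in \<open>auto intro!: ji\<close>)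
  have "h * (h * fij (x + s1 *\<^sub>R axis i 1 + t1 *\<^sub>R axis j 1)) = h * (h * fji (x + t2 *\<^sub>R axis j 1 + s2 *\<^sub>R axis i 1))"
    unfolding s1(3)[unfolded t1(3), symmetric] t2(3)[unfolded s2(3), symmetric] by (simp add: ac_simps)
  then have "fij (x + s1 *\<^sub>R axis i 1 + t1 *\<^sub>R axis j 1) = fji (x + s2 *\<^sub>R axis i 1 + t2 *\<^sub>R axis j 1)"
    using h by (simp add: ac_simps)
  moreover have "dist (fij (x + s1 *\<^sub>R axis i 1 + t1 *\<^sub>R axis j 1)) (fij x) < \<epsilon>"
    using near[of s1 t1] s1 t1 by (intro r1) auto
  moreover have "dist (fji (x + s2 *\<^sub>R axis i 1 + t2 *\<^sub>R axis j 1)) (fji x) < \<epsilon>"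
    using near[of s2 t2] s2 t2 by (intro r2) auto
  ultimately have "dist (fij x) (fji x) < \<epsilon> + \<epsilon>"
    by (metis dist_commute dist_triangle_less_add)
  then show False by (simp add: \<epsilon>_def)
qed

section \<open>Curvature at a point where the metric is Euclidean\<close>

text \<open>Curvature differentiates the Christoffel symbols once, so the inverse metric is needed
  only to first order. Its first derivatives are kept because those of the ambient metric in the
  normal direction do not vanish at the origin.\<close>

locale metric_jet =
  fixes G :: "real^'n \<Rightarrow> real^'n^'n" and V iv iv1 G1 G2
  assumes V: "open V" "0 \<in> V"
    and inv: "\<And>y k l. y \<in> V \<Longrightarrow> matrix_inv (G y) $ k $ l = iv k l y"
    and iv_0: "\<And>k l. iv k l 0 = (if k = l then 1 else 0)"
    and pd_iv: "\<And>k l m. has_pd m (iv k l) (iv1 k l m) 0"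
    and pd_G: "\<And>y i j k. y \<in> V \<Longrightarrow> has_pd k (\<lambda>y. G y $ i $ j) (G1 i j k y) y"
    and pd_G1: "\<And>i j k l. has_pd l (G1 i j k) (G2 i j k l) 0"
begin

definition chr :: "'n \<Rightarrow> 'n \<Rightarrow> 'n \<Rightarrow> real^'n \<Rightarrow> real" where
  "chr l i j y = (G1 l j i y + G1 l i j y - G1 i j l y) / 2"

definition dchr :: "'n \<Rightarrow> 'n \<Rightarrow> 'n \<Rightarrow> 'n \<Rightarrow> real" where
  "dchr k i j m = (\<Sum>l\<in>UNIV. iv1 k l m * chr l i j 0) + (G2 k j i m + G2 k i j m - G2 i j k m) / 2"

lemma christoffel_eq: "y \<in> V \<Longrightarrow> christoffel G k i j y = (\<Sum>l\<in>UNIV. iv k l y * chr l i j y)"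
  by (simp add: christoffel_def inv pd_eq[OF pd_G] chr_def sum_distrib_left mult_ac)

lemma christoffel_0: "christoffel G k i j 0 = chr k i j 0"
  by (simp add: christoffel_eq V iv_0 if_distrib[where f = "\<lambda>x. x * _"] cong: if_cong)

lemma pd_christoffel: "pd m (christoffel G k i j) 0 = dchr k i j m"
proof (rule pd_eq, rule has_pd_transform[OF _ V])
  have "has_pd m (chr l i j) ((G2 l j i m + G2 l i j m - G2 i j l m) / 2) 0" for l
    unfolding chr_def
    by (rule has_pd_eq_rhs[OF has_pd_divide[OF has_pd_diff[OF has_pd_add[OF pd_G1 pd_G1] pd_G1] has_pd_const]])
       simp_all
  then have "has_pd m (\<lambda>y. \<Sum>l\<in>UNIV. iv k l y * chr l i j y)
     (\<Sum>l\<in>UNIV. iv k l 0 * ((G2 l j i m + G2 l i j m - G2 i j l m) / 2) + iv1 k l m * chr l i j 0) 0"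
    by (intro has_pd_sum has_pd_mult pd_iv)
  then show "has_pd m (\<lambda>y. \<Sum>l\<in>UNIV. iv k l y * chr l i j y) (dchr k i j m) 0"
    by (rule has_pd_eq_rhs)
       (simp add: dchr_def iv_0 sum.distrib if_distrib[where f = "\<lambda>x. x * _"] if_distrib[where f = "\<lambda>x. x / 2"]
          cong: if_cong)
qed (simp add: christoffel_eq)

lemma scalar_curvature_0:
  "scalar_curvature G 0 = (\<Sum>k\<in>UNIV. \<Sum>i\<in>UNIV. dchr i k k i - dchr i i k k +
     (\<Sum>p\<in>UNIV. chr i i p 0 * chr p k k 0 - chr i k p 0 * chr p i k 0))"
  by (simp add: scalar_curvature_def ricci_def riemann_def pd_christoffel christoffel_0 inv V iv_0
      if_distrib[where f = "\<lambda>x. x * _"] cong: if_cong)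

lemma levi_civita_const_0:
  "levi_civita G X (\<lambda>_. c) 0 $ k = (\<Sum>i\<in>UNIV. \<Sum>j\<in>UNIV. chr k i j 0 * X $ i * c $ j)"
  by (simp add: levi_civita_def christoffel_0 pd_eq[OF has_pd_const])

end


section \<open>The jet of the metric in boundary normal coordinates\<close>

text \<open>The second derivatives are stored as a total derivative of \<open>G1\<close> rather than
  as partial ones, because the geodesic equation is differentiated along rays in arbitrary
  directions.\<close>

locale normal_metric =
  fixes G :: "real^3 \<Rightarrow> real^3^3" and V :: "(real^3) set"
    and G1 :: "3 \<Rightarrow> 3 \<Rightarrow> 3 \<Rightarrow> real^3 \<Rightarrow> real" and G2 :: "3 \<Rightarrow> 3 \<Rightarrow> 3 \<Rightarrow> 3 \<Rightarrow> real"
    and \<kappa>1 \<kappa>2 :: real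
  assumes V: "open V" "0 \<in> V"
    and pd_G: "y \<in> V \<Longrightarrow> has_pd k (\<lambda>y. G y $ i $ j) (G1 i j k y) y"
    and der_G1: "(G1 i j k has_derivative (\<lambda>v. \<Sum>l\<in>UNIV. v $ l * G2 i j k l)) (at 0)"
    and G2_comm: "G2 i j k l = G2 i j l k"
    and cont_G: "continuous_on V (\<lambda>y. G y $ i $ j)"
    and sym_G: "y \<in> V \<Longrightarrow> G y $ i $ j = G y $ j $ i"
    and pos_G: "y \<in> V \<Longrightarrow> v \<noteq> 0 \<Longrightarrow> 0 < v \<bullet> (G y *v v)"
    and G_33: "y \<in> V \<Longrightarrow> G y $ 3 $ 3 = 1"
    and G_13: "y \<in> V \<Longrightarrow> G y $ 1 $ 3 = 0" and G_23: "y \<in> V \<Longrightarrow> G y $ 2 $ 3 = 0"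
    and G_0: "tangential_metric G 0 0 = mat 1"
    and shape_1: "shape_operator G 0 (axis 1 1) = \<kappa>1 *\<^sub>R axis 1 1"
    and shape_2: "shape_operator G 0 (axis 2 1) = \<kappa>2 *\<^sub>R axis 2 1"
    and geodesics: "pt x 0 \<in> V \<Longrightarrow>
      (\<Sum>a\<in>UNIV. \<Sum>b\<in>UNIV. christoffel (tangential_metric G 0) c a b x * x $ a * x $ b) = 0"
begin

lemma pd_G1: "has_pd l (G1 i j k) (G2 i j k l) 0"
  using has_pd_frechet[OF der_G1, of l] by (simp add: axis_def if_distrib[where f = "\<lambda>x. x * _"] cong: if_cong)

lemma G1_sym: "y \<in> V \<Longrightarrow> G1 i j k y = G1 j i k y"
  using has_pd_unique[OF pd_G has_pd_transform[OF pd_G V(1)]] sym_G by metis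

lemma G2_cong:
  assumes "\<And>y. y \<in> V \<Longrightarrow> G1 i j k y = F y" "has_pd l F D 0"
  shows "G2 i j k l = D"
  using has_pd_unique[OF pd_G1 has_pd_transform[OF assms(2) V]] assms(1) by metis

lemma G2_sym: "G2 i j k l = G2 j i k l"
  by (rule G2_cong[OF G1_sym pd_G1])

lemma G1_normal: "y \<in> V \<Longrightarrow> G1 i 3 k y = 0" "y \<in> V \<Longrightarrow> G1 3 i k y = 0"
proof -
  have const: "G y $ i $ 3 = (if i = 3 then 1 else 0)" if "y \<in> V" for y
    using that G_33 G_13 G_23 exhaust_3[of i] by auto
  show *: "G1 i 3 k y = 0" if "y \<in> V" for y
    by (rule has_pd_unique[OF pd_G[OF that]], rule has_pd_transform[OF has_pd_const V(1) that])
       (simp add: const)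
  then show "y \<in> V \<Longrightarrow> G1 3 i k y = 0" using G1_sym by metis
qed

lemma G2_normal: "G2 i 3 k l = 0" "G2 3 i k l = 0"
  using G2_cong[OF G1_normal(1) has_pd_const] G2_sym by metis+

section \<open>Determinant and inverse of the slice metrics\<close>

definition g :: "2 \<Rightarrow> 2 \<Rightarrow> real^3 \<Rightarrow> real" where
  "g a b y = G y $ tn a $ tn b"

definition \<Delta> :: "real^3 \<Rightarrow> real" where
  "\<Delta> y = g 1 1 y * g 2 2 y - g 1 2 y * g 1 2 y"

definition \<Delta>1 :: "3 \<Rightarrow> real^3 \<Rightarrow> real" where
  "\<Delta>1 i y = G1 1 1 i y * g 2 2 y + g 1 1 y * G1 2 2 i y - 2 * g 1 2 y * G1 1 2 i y"

definition \<Delta>2 :: "3 \<Rightarrow> 3 \<Rightarrow> real" where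
  "\<Delta>2 i j = G2 1 1 i j + G2 2 2 i j + G1 1 1 i 0 * G1 2 2 j 0 + G1 1 1 j 0 * G1 2 2 i 0 - 2 * G1 1 2 i 0 * G1 1 2 j 0"

definition adj :: "2 \<Rightarrow> 2 \<Rightarrow> real^3 \<Rightarrow> real" where
  "adj a b y = (if a = b then (if a = 1 then g 2 2 y else g 1 1 y) else - g 1 2 y)"

definition adj1 :: "2 \<Rightarrow> 2 \<Rightarrow> 3 \<Rightarrow> real^3 \<Rightarrow> real" where
  "adj1 a b i y = (if a = b then (if a = 1 then G1 2 2 i y else G1 1 1 i y) else - G1 1 2 i y)"

definition adj2 :: "2 \<Rightarrow> 2 \<Rightarrow> 3 \<Rightarrow> 3 \<Rightarrow> real" where
  "adj2 a b i j = (if a = b then (if a = 1 then G2 2 2 i j else G2 1 1 i j) else - G2 1 2 i j)"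

definition u :: "2 \<Rightarrow> 2 \<Rightarrow> real^3 \<Rightarrow> real" where
  "u a b y = adj a b y / \<Delta> y"

definition u1 :: "2 \<Rightarrow> 2 \<Rightarrow> 3 \<Rightarrow> real^3 \<Rightarrow> real" where
  "u1 a b i y = (adj1 a b i y * \<Delta> y - adj a b y * \<Delta>1 i y) / (\<Delta> y)\<^sup>2"

text \<open>The second order quotient rule for \<open>adj / \<Delta>\<close>, simplified by
  \<open>\<Delta> = 1\<close> and \<open>adj\<close> being the identity at the origin.\<close>

definition u2 :: "2 \<Rightarrow> 2 \<Rightarrow> 3 \<Rightarrow> 3 \<Rightarrow> real" where
  "u2 a b i j = adj2 a b i j - adj1 a b i 0 * \<Delta>1 j 0 - adj1 a b j 0 * \<Delta>1 i 0
     - (if a = b then 1 else 0) * (\<Delta>2 i j - 2 * \<Delta>1 i 0 * \<Delta>1 j 0)"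

lemma g_0: "g a b 0 = (if a = b then 1 else 0)"
  using arg_cong[OF G_0, of "\<lambda>m. m $ a $ b"] by (simp add: tangential_metric_def g_def mat_def)

lemma g_21: "y \<in> V \<Longrightarrow> g 2 1 y = g 1 2 y"
  by (simp add: g_def sym_G)

lemma pd_g: "y \<in> V \<Longrightarrow> has_pd i (g a b) (G1 (tn a) (tn b) i y) y"
  unfolding g_def[abs_def] by (rule pd_G)

lemma pd_\<Delta>: "y \<in> V \<Longrightarrow> has_pd i \<Delta> (\<Delta>1 i y) y"
  unfolding \<Delta>_def[abs_def] \<Delta>1_def
  by (rule has_pd_eq_rhs[OF has_pd_diff[OF has_pd_mult[OF pd_g pd_g] has_pd_mult[OF pd_g pd_g]]]) simp_all

lemma pd_\<Delta>1: "has_pd j (\<Delta>1 i) (\<Delta>2 i j) 0"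
  unfolding \<Delta>1_def[abs_def] \<Delta>2_def
  by (rule has_pd_eq_rhs[OF has_pd_diff[OF has_pd_add[OF has_pd_mult[OF pd_G1 pd_g] has_pd_mult[OF pd_g pd_G1]]
        has_pd_mult[OF has_pd_mult[OF has_pd_const pd_g] pd_G1]]]) (simp_all add: V g_0)

lemma \<Delta>_0: "\<Delta> 0 = 1"
  by (simp add: \<Delta>_def g_0)

lemma quadratic_form_pos:
  assumes y: "y \<in> V" and \<xi>: "\<xi> \<noteq> (0::real^2)"
  shows "0 < g 1 1 y * (\<xi> $ 1)\<^sup>2 + 2 * g 1 2 y * \<xi> $ 1 * \<xi> $ 2 + g 2 2 y * (\<xi> $ 2)\<^sup>2"
proof -
  have "pt \<xi> 0 \<noteq> 0" using \<xi> by (auto simp: vec_eq_iff forall_2 forall_3)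
  from pos_G[OF y this] show ?thesis
    using sym_G[OF y, of 1 2] by (simp add: inner_vec_def matrix_vector_mult_def sum_3 g_def algebra_simps power2_eq_square)
qed

lemma g11_pos: "y \<in> V \<Longrightarrow> 0 < g 1 1 y" and g22_pos: "y \<in> V \<Longrightarrow> 0 < g 2 2 y"
  using quadratic_form_pos[of y "axis 1 1"] quadratic_form_pos[of y "axis 2 1"]
  by (auto simp: axis_def vec_eq_iff)

lemma \<Delta>_pos:
  assumes y: "y \<in> V"
  shows "0 < \<Delta> y"
proof -
  \<comment> \<open>On this vector the quadratic form of the metric equals
    \<open>g 1 1 y * \<Delta> y\<close>.\<close>
  have "vector [- g 1 2 y, g 1 1 y] \<noteq> (0::real^2)"
    using g11_pos[OF y] by (auto simp: vec_eq_iff forall_2)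
  from quadratic_form_pos[OF y this] have "0 < g 1 1 y * \<Delta> y"
    by (simp add: \<Delta>_def power2_eq_square algebra_simps)
  then show ?thesis using g11_pos[OF y] by (simp add: zero_less_mult_iff)
qed

lemma pd_adj: "y \<in> V \<Longrightarrow> has_pd i (adj a b) (adj1 a b i y) y"
proof -
  assume y: "y \<in> V"
  show ?thesis
    unfolding adj_def[abs_def] adj1_def
    using pd_g[OF y, of i 1 1] pd_g[OF y, of i 2 2] has_pd_minus[OF pd_g[OF y, of i 1 2]] by simp
qed

lemma pd_adj1: "has_pd j (adj1 a b i) (adj2 a b i j) 0"
  unfolding adj1_def[abs_def] adj2_def using pd_G1 has_pd_minus[OF pd_G1[of j 1 2 i]] by simp

lemma adj_0: "adj a b 0 = (if a = b then 1 else 0)"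
  by (simp add: adj_def g_0)

lemma pd_u: "y \<in> V \<Longrightarrow> has_pd i (u a b) (u1 a b i y) y"
  unfolding u_def[abs_def] u1_def using \<Delta>_pos[of y]
  by (intro has_pd_divide pd_adj pd_\<Delta>) auto

lemma pd_u1: "has_pd j (u1 a b i) (u2 a b i j) 0"
  unfolding u1_def[abs_def] power2_eq_square
  apply (rule has_pd_eq_rhs)
   apply (rule has_pd_divide[OF has_pd_diff[OF has_pd_mult[OF pd_adj1 pd_\<Delta>[OF V(2)]] has_pd_mult[OF pd_adj[OF V(2)] pd_\<Delta>1]]
         has_pd_mult[OF pd_\<Delta>[OF V(2)] pd_\<Delta>[OF V(2)]]])
  by (simp_all add: \<Delta>_0 adj_0 u2_def algebra_simps)

lemma det_h: "pt x t \<in> V \<Longrightarrow> det (tangential_metric G t x) = \<Delta> (pt x t)"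
  using g_21[of "pt x t"] by (simp add: det_2 tangential_metric_def \<Delta>_def g_def)

lemma ginv_eq:
  assumes y: "pt x t \<in> V"
  shows "ginv (tangential_metric G) a b t x = u a b (pt x t)"
proof -
  let ?B = "\<chi> a b. u a b (pt x t)"
  have \<Delta>: "\<Delta> (pt x t) \<noteq> 0" "g 1 1 (pt x t) * g 2 2 (pt x t) - g 1 2 (pt x t) * g 1 2 (pt x t) \<noteq> 0"
    using \<Delta>_pos[OF y] by (auto simp: \<Delta>_def)
  have h: "tangential_metric G t x $ a $ b = g a b (pt x t)" for a b
    by (simp add: tangential_metric_def g_def)
  have "tangential_metric G t x ** ?B = mat 1" "?B ** tangential_metric G t x = mat 1"
    using \<Delta> g_21[OF y]
    by (auto simp: vec_eq_iff forall_2 matrix_matrix_mult_def sum_2 mat_def h u_def adj_def add_divide_distrib[symmetric]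
        diff_divide_distrib[symmetric] divide_eq_eq) (simp_all add: \<Delta>_def algebra_simps)
  from matrix_inv_eqI[OF this] show ?thesis by (simp add: ginv_def)
qed

definition L1 :: "2 \<Rightarrow> real^3 \<Rightarrow> real" where "L1 a y = \<Delta>1 (tn a) y / \<Delta> y"
definition L2 :: "2 \<Rightarrow> 3 \<Rightarrow> real" where "L2 a i = \<Delta>2 (tn a) i - \<Delta>1 (tn a) 0 * \<Delta>1 i 0"
definition A :: "real^3 \<Rightarrow> real" where "A y = - 1/2 * (\<Delta>1 3 y / \<Delta> y)"
definition A1 :: "3 \<Rightarrow> real" where "A1 i = - 1/2 * (\<Delta>2 3 i - \<Delta>1 3 0 * \<Delta>1 i 0)"

lemma pd_log_\<Delta>: "has_pd j (\<lambda>y. \<Delta>1 i y / \<Delta> y) (\<Delta>2 i j - \<Delta>1 i 0 * \<Delta>1 j 0) 0"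
  by (rule has_pd_eq_rhs[OF has_pd_divide[OF pd_\<Delta>1 pd_\<Delta>[OF V(2)]]]) (simp_all add: \<Delta>_0)

lemma preimage_pt: "open ((\<lambda>x. pt x t) -` V)" "open ((\<lambda>t. pt x t) -` V)"
proof -
  have "continuous_on UNIV (\<lambda>x. pt x t)" "continuous_on UNIV (\<lambda>t. pt x t)"
    by (simp_all add: continuous_on_eq_continuous_at continuous_pt)
  then show "open ((\<lambda>x. pt x t) -` V)" "open ((\<lambda>t. pt x t) -` V)"
    using V(1) by (simp_all add: continuous_on_open_vimage)
qed

lemma lndet:
  assumes y: "pt x t \<in> V"
  shows "pd a (\<lambda>y. ln (det (tangential_metric G t y))) x = L1 a (pt x t)"
proof (rule pd_eq, rule has_pd_transform[OF _ preimage_pt(1)])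
  have "has_pd (tn a) (\<lambda>y. ln (\<Delta> y)) (L1 a (pt x t)) (pt x t)"
    unfolding L1_def by (rule has_pd_ln[OF pd_\<Delta>[OF y] \<Delta>_pos[OF y]])
  then show "has_pd a (\<lambda>x. ln (\<Delta> (pt x t))) (L1 a (pt x t)) x"
    by (simp add: has_pd_pt[of a "\<lambda>y. ln (\<Delta> y)"])
qed (use y det_h in auto)

text \<open>Jacobi's formula: the trace of the inverse metric times its normal derivative is the
  logarithmic derivative of the determinant.\<close>

lemma Acoef_eq:
  assumes y: "pt x t \<in> V"
  shows "Acoef (tangential_metric G) t x = A (pt x t)"
proof -
  have "vector_derivative (\<lambda>s. tangential_metric G s x $ a $ b) (at t) = G1 (tn a) (tn b) 3 (pt x t)" for a b
    by (rule vector_derivative_at)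
       (simp add: tangential_metric_def has_vector_derivative_pt[of "\<lambda>y. G y $ tn a $ tn b"] pd_G y)
  then show ?thesis
    using G1_sym[OF y, of 2 1 3] g_21[OF y]
    by (simp add: Acoef_def ginv_eq y sum_2 A_def \<Delta>1_def u_def adj_def add_divide_distrib diff_divide_distrib algebra_simps)
qed

end

context normal_metric
begin

lemma g_u:
  assumes y: "y \<in> V"
  shows "g a 1 y * u 1 b y + g a 2 y * u 2 b y = (if a = b then 1 else 0)"
proof -
  have "\<Delta> y \<noteq> 0" using \<Delta>_pos[OF y] by simp
  then show ?thesis
    using g_21[OF y] exhaust_2[of a] exhaust_2[of b]
    by (auto simp: u_def adj_def add_divide_distrib[symmetric] diff_divide_distrib[symmetric] divide_eq_eq)
       (simp_all add: \<Delta>_def algebra_simps)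
qed

sublocale slice: metric_jet "tangential_metric G 0" "(\<lambda>x. pt x 0) -` V" "\<lambda>k l x. u k l (pt x 0)"
  "\<lambda>k l m. u1 k l (tn m) 0" "\<lambda>a b c x. G1 (tn a) (tn b) (tn c) (pt x 0)"
  "\<lambda>a b c d. G2 (tn a) (tn b) (tn c) (tn d)"
proof
  show "open ((\<lambda>x. pt x 0) -` V)" by (rule preimage_pt)
  show "0 \<in> (\<lambda>x. pt x 0) -` V" using V by simp
  show "matrix_inv (tangential_metric G 0 y) $ k $ l = u k l (pt y 0)" if "y \<in> (\<lambda>x. pt x 0) -` V" for y k l
    using ginv_eq[of y 0 k l] that by (simp add: ginv_def)
  show "u k l (pt 0 0) = (if k = l then 1 else 0)" for k l
    by (simp add: u_def adj_0 \<Delta>_0)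
  show "has_pd m (\<lambda>x. u k l (pt x 0)) (u1 k l (tn m) 0) 0" for k l m
    using pd_u[OF V(2)] by (simp add: has_pd_pt[of m "u k l"])
  show "has_pd k (\<lambda>y. tangential_metric G 0 y $ i $ j) (G1 (tn i) (tn j) (tn k) (pt y 0)) y"
    if "y \<in> (\<lambda>x. pt x 0) -` V" for y i j k
    using pd_G[of "pt y 0"] that by (simp add: tangential_metric_def has_pd_pt[of k "\<lambda>y. G y $ tn i $ tn j"])
  show "has_pd l (\<lambda>x. G1 (tn i) (tn j) (tn k) (pt x 0)) (G2 (tn i) (tn j) (tn k) (tn l)) 0" for i j k l
    using pd_G1 by (simp add: has_pd_pt[of l "G1 (tn i) (tn j) (tn k)"])
qed

section \<open>The tangential jet from radial geodesics\<close>

lemma lowered_geodesics: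
  assumes x: "pt x 0 \<in> V"
  shows "(\<Sum>a\<in>UNIV. \<Sum>b\<in>UNIV. slice.chr l a b x * x $ a * x $ b) = 0"
proof -
  define F where "F l = (\<Sum>a\<in>UNIV. \<Sum>b\<in>UNIV. slice.chr l a b x * x $ a * x $ b)" for l
  have 0: "u c 1 (pt x 0) * F 1 + u c 2 (pt x 0) * F 2 = 0" for c
    using geodesics[OF x, of c] x by (simp add: slice.christoffel_eq sum_2 F_def algebra_simps)
  \<comment> \<open>Inserting the identity as the product of \<open>g\<close> and \<open>u\<close>
    recovers the lowered sums \<open>F\<close> from the raised ones, which vanish by the geodesic
    equation.\<close>
  have "F l = (g l 1 (pt x 0) * u 1 1 (pt x 0) + g l 2 (pt x 0) * u 2 1 (pt x 0)) * F 1
     + (g l 1 (pt x 0) * u 1 2 (pt x 0) + g l 2 (pt x 0) * u 2 2 (pt x 0)) * F 2"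
    unfolding g_u[OF x] using exhaust_2[of l] by auto
  also have "\<dots> = g l 1 (pt x 0) * (u 1 1 (pt x 0) * F 1 + u 1 2 (pt x 0) * F 2)
     + g l 2 (pt x 0) * (u 2 1 (pt x 0) * F 1 + u 2 2 (pt x 0) * F 2)"
    by (simp add: algebra_simps)
  finally have "F l = 0" by (simp add: 0)
  then show ?thesis by (simp add: F_def)
qed

text \<open>Along the ray through \<open>v\<close> the geodesic equation says that
  \<open>s^2 * \<phi> s = 0\<close>. Hence \<phi> vanishes near 0, and its value and its derivative
  at 0 give a quadratic and a cubic identity in \<open>v\<close>.\<close>

lemma geodesic_jets:
  fixes v :: "real^2"
  shows "(\<Sum>a\<in>UNIV. \<Sum>b\<in>UNIV. slice.chr l a b 0 * v $ a * v $ b) = 0"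
    and "(\<Sum>a\<in>UNIV. \<Sum>b\<in>UNIV. (\<Sum>m\<in>UNIV. v $ m * (G2 (tn l) (tn b) (tn a) (tn m) + G2 (tn l) (tn a) (tn b) (tn m)
       - G2 (tn a) (tn b) (tn l) (tn m))) / 2 * v $ a * v $ b) = 0"
proof -
  define \<phi> where "\<phi> s = (\<Sum>a\<in>UNIV. \<Sum>b\<in>UNIV. slice.chr l a b (s *\<^sub>R v) * v $ a * v $ b)" for s
  define D where "D = (\<Sum>a\<in>UNIV. \<Sum>b\<in>UNIV. (\<Sum>m\<in>UNIV. v $ m * (G2 (tn l) (tn b) (tn a) (tn m) + G2 (tn l) (tn a) (tn b) (tn m)
       - G2 (tn a) (tn b) (tn l) (tn m))) / 2 * v $ a * v $ b)"
  have pt: "pt (s *\<^sub>R v) 0 = s *\<^sub>R pt v 0" for s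
    by (simp add: vec_eq_iff forall_3)
  have dG: "((\<lambda>s. G1 i j k (pt (s *\<^sub>R v) 0)) has_real_derivative (\<Sum>m\<in>UNIV. v $ m * G2 i j k (tn m))) (at 0)" for i j k
  proof -
    have "((\<lambda>s. s *\<^sub>R pt v 0) has_derivative (\<lambda>s. s *\<^sub>R pt v 0)) (at 0)"
      by (auto intro!: derivative_eq_intros)
    from has_derivative_compose[OF this, of "G1 i j k" "\<lambda>v. \<Sum>l\<in>UNIV. v $ l * G2 i j k l"] der_G1
    have "((\<lambda>s. G1 i j k (pt (s *\<^sub>R v) 0)) has_derivative (\<lambda>s. \<Sum>l\<in>UNIV. (s *\<^sub>R pt v 0) $ l * G2 i j k l)) (at 0)"
      by (simp add: pt)
    then show ?thesis
      unfolding has_field_derivative_def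
      by (rule has_derivative_eq_rhs) (simp add: fun_eq_iff sum_2 sum_3 algebra_simps)
  qed
  have d\<phi>: "(\<phi> has_real_derivative D) (at 0)"
    unfolding \<phi>_def[abs_def] slice.chr_def D_def
    by (intro DERIV_sum DERIV_cmult_right[of _ _ 0] DERIV_cdivide)
       (rule DERIV_cong[OF DERIV_diff[OF DERIV_add[OF dG dG] dG]], simp add: algebra_simps sum.distrib sum_subtractf)
  have "isCont (\<lambda>s. pt (s *\<^sub>R v) 0) 0"
    unfolding pt by (intro continuous_intros)
  then have "eventually (\<lambda>s. pt (s *\<^sub>R v) 0 \<in> V) (nhds 0)"
    using V by (simp add: isCont_def tendsto_def eventually_nhds_conv_at)
  then obtain \<delta> where \<delta>: "0 < \<delta>" "\<And>s. \<bar>s\<bar> < \<delta> \<Longrightarrow> pt (s *\<^sub>R v) 0 \<in> V"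
    by (auto simp: eventually_nhds_metric dist_real_def)
  have \<phi>0: "\<phi> s = 0" if "\<bar>s\<bar> < \<delta>" "s \<noteq> 0" for s
  proof -
    have "s\<^sup>2 * \<phi> s = (\<Sum>a\<in>UNIV. \<Sum>b\<in>UNIV. slice.chr l a b (s *\<^sub>R v) * (s *\<^sub>R v) $ a * (s *\<^sub>R v) $ b)"
      by (simp add: \<phi>_def sum_2 power2_eq_square algebra_simps)
    also have "\<dots> = 0" by (rule lowered_geodesics[OF \<delta>(2)[OF that(1)]])
    finally show ?thesis using that by simp
  qed
  \<comment> \<open>At \<open>s = 0\<close> the equation scaled by \<open>s^2\<close> carries no
    information, so the value there is obtained by continuity.\<close>
  have ev: "eventually (\<lambda>s. \<phi> s = 0) (at 0)"
    unfolding eventually_at using \<delta>(1) \<phi>0 by (auto simp: dist_real_def)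
  have "\<phi> \<midarrow>0\<rightarrow> \<phi> 0" using DERIV_isCont[OF d\<phi>] by (simp add: isCont_def)
  moreover have "\<phi> \<midarrow>0\<rightarrow> 0" using tendsto_cong[OF ev] by simp
  ultimately have \<phi>00: "\<phi> 0 = 0" using LIM_unique by blast
  then show "(\<Sum>a\<in>UNIV. \<Sum>b\<in>UNIV. slice.chr l a b 0 * v $ a * v $ b) = 0"
    by (simp add: \<phi>_def)
  have "((\<lambda>_. 0) has_real_derivative D) (at 0)"
    by (rule has_field_derivative_transform_within[OF d\<phi> \<delta>(1)]) (use \<phi>0 \<phi>00 in \<open>force simp: dist_real_def\<close>)+
  then have "D = 0" using DERIV_unique DERIV_const by blast
  then show "(\<Sum>a\<in>UNIV. \<Sum>b\<in>UNIV. (\<Sum>m\<in>UNIV. v $ m * (G2 (tn l) (tn b) (tn a) (tn m) + G2 (tn l) (tn a) (tn b) (tn m)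
       - G2 (tn a) (tn b) (tn l) (tn m))) / 2 * v $ a * v $ b) = 0"
    by (simp add: D_def)
qed

lemma G1_21: "G1 2 1 k 0 = G1 1 2 k 0"
  using G1_sym[OF V(2)] .

text \<open>A quadratic form in two variables is zero once it vanishes on both axes and on the
  vector (1, 1). For the lowered Christoffel symbols, both lower indices symmetric, this gives all
  first derivatives.\<close>

lemma G1_tangential:
  "G1 1 1 1 0 = 0" "G1 1 1 2 0 = 0" "G1 1 2 1 0 = 0" "G1 1 2 2 0 = 0" "G1 2 2 1 0 = 0" "G1 2 2 2 0 = 0"
  using geodesic_jets(1)[of 1 "axis 1 1"] geodesic_jets(1)[of 1 "axis 2 1"] geodesic_jets(1)[of 1 "vector [1, 1]"]
    geodesic_jets(1)[of 2 "axis 1 1"] geodesic_jets(1)[of 2 "axis 2 1"] geodesic_jets(1)[of 2 "vector [1, 1]"]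
  by (simp_all add: slice.chr_def sum_2 axis_def G1_21)

lemma G2_21: "G2 2 1 k l = G2 1 2 k l" "G2 i j 2 1 = G2 i j 1 2"
  by (rule G2_sym, rule G2_comm)

text \<open>A cubic form in two variables is determined by its values on the axes and on (1, 1) and
  (1, -1). The resulting linear system leaves one free unknown, \<open>G2 1 1 2 2\<close>, which
  encodes the curvature.\<close>

lemma G2_tangential:
  "G2 1 1 1 1 = 0" "G2 1 1 1 2 = 0" "G2 1 2 1 1 = 0" "G2 1 2 2 2 = 0" "G2 2 2 1 2 = 0" "G2 2 2 2 2 = 0"
  "G2 2 2 1 1 = G2 1 1 2 2" "G2 1 2 1 2 = - G2 1 1 2 2 / 2"
proof -
  note J = geodesic_jets(2)
  have a: "G2 1 1 1 1 = 0" "2 * G2 1 2 2 2 = G2 2 2 1 2" "2 * G2 1 2 1 1 = G2 1 1 1 2" "G2 2 2 2 2 = 0"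
    using J[of "axis 1 1" 1] J[of "axis 2 1" 1] J[of "axis 1 1" 2] J[of "axis 2 1" 2]
    by (simp_all add: sum_2 axis_def G2_21)
  have b: "3 * G2 1 1 1 2 + 2 * G2 1 1 2 2 + 2 * G2 1 2 1 2 - G2 2 2 1 1 = 0"
    "- 3 * G2 1 1 1 2 + 2 * G2 1 1 2 2 + 2 * G2 1 2 1 2 - G2 2 2 1 1 = 0"
    "3 * G2 2 2 1 2 + 2 * G2 2 2 1 1 + 2 * G2 1 2 1 2 - G2 1 1 2 2 = 0"
    "3 * G2 2 2 1 2 - 2 * G2 2 2 1 1 - 2 * G2 1 2 1 2 + G2 1 1 2 2 = 0"
    using J[of "vector [1, 1]" 1] J[of "vector [1, - 1]" 1] J[of "vector [1, 1]" 2] J[of "vector [1, - 1]" 2] a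
    by (simp_all add: sum_2 G2_21 field_simps)
  show "G2 1 1 1 1 = 0" "G2 2 2 2 2 = 0" by (fact a)+
  show "G2 1 1 1 2 = 0" "G2 2 2 1 2 = 0" using b by linarith+
  then show "G2 1 2 1 1 = 0" "G2 1 2 2 2 = 0" using a by simp_all
  show "G2 2 2 1 1 = G2 1 1 2 2" using b by linarith
  then show "G2 1 2 1 2 = - G2 1 1 2 2 / 2" using b by linarith
qed

text \<open>The Gauss curvature of the hypersurface at the origin.\<close>

definition K :: real where "K = - 3/2 * G2 1 1 2 2"

lemma G2_K: "G2 1 1 2 2 = - 2 * K / 3" by (simp add: K_def)

lemma scalar_curvature_slice: "scalar_curvature (tangential_metric G 0) 0 = 2 * K"
  by (simp add: slice.scalar_curvature_0 slice.dchr_def slice.chr_def sum_2 G1_tangential G1_21 G2_21 G2_tangential G2_K)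

section \<open>The ambient metric and its scalar curvature\<close>

definition pr :: "3 \<Rightarrow> 2" where "pr k = (if k = 1 then 1 else 2)"

lemma tn_pr: "k \<noteq> 3 \<Longrightarrow> tn (pr k) = k"
  using exhaust_3[of k] by (auto simp: pr_def)

text \<open>The metric is block diagonal, the slice metric plus the square of the normal coordinate
  differential, and so is its inverse. The filler value \<open>pr 3 = 2\<close> is shielded by the
  case distinctions on the index 3.\<close>

sublocale ambient: metric_jet G V "\<lambda>k l y. if k = 3 \<or> l = 3 then (if k = l then 1 else 0) else u (pr k) (pr l) y"
  "\<lambda>k l m. if k = 3 \<or> l = 3 then 0 else u1 (pr k) (pr l) m 0" G1 G2
proof
  show "matrix_inv (G y) $ k $ l = (if k = 3 \<or> l = 3 then (if k = l then 1 else 0) else u (pr k) (pr l) y)"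
    if y: "y \<in> V" for y k l
  proof -
    let ?B = "\<chi> k l. if k = 3 \<or> l = 3 then (if k = l then 1 else 0) else u (pr k) (pr l) y"
    have u_sym: "u 2 1 y = u 1 2 y" by (simp add: u_def adj_def)
    have gG: "G y $ 1 $ 1 = g 1 1 y" "G y $ 1 $ 2 = g 1 2 y" "G y $ 2 $ 1 = g 1 2 y" "G y $ 2 $ 2 = g 2 2 y"
      "G y $ 1 $ 3 = 0" "G y $ 2 $ 3 = 0" "G y $ 3 $ 1 = 0" "G y $ 3 $ 2 = 0" "G y $ 3 $ 3 = 1"
      using sym_G[OF y] G_13[OF y] G_23[OF y] G_33[OF y] by (auto simp: g_def)
    have gu: "g 1 1 y * u 1 1 y + g 1 2 y * u 1 2 y = 1" "g 1 1 y * u 1 2 y + g 1 2 y * u 2 2 y = 0"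
      "g 1 2 y * u 1 1 y + g 2 2 y * u 1 2 y = 0" "g 1 2 y * u 1 2 y + g 2 2 y * u 2 2 y = 1"
      using g_u[OF y, of 1 1] g_u[OF y, of 1 2] g_u[OF y, of 2 1] g_u[OF y, of 2 2]
      by (simp_all add: g_21[OF y] u_sym)
    have ug: "u 1 1 y * g 1 1 y + u 1 2 y * g 1 2 y = 1" "u 1 2 y * g 1 1 y + u 2 2 y * g 1 2 y = 0"
      "u 1 1 y * g 1 2 y + u 1 2 y * g 2 2 y = 0" "u 1 2 y * g 1 2 y + u 2 2 y * g 2 2 y = 1"
      using gu by (simp_all only: mult.commute)
    have "G y ** ?B = mat 1" "?B ** G y = mat 1"
      by (simp_all add: vec_eq_iff forall_3 matrix_matrix_mult_def sum_3 mat_def gG u_sym pr_def gu ug)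
    from matrix_inv_eqI[OF this] show ?thesis by simp
  qed
  show "has_pd m (\<lambda>y. if k = 3 \<or> l = 3 then (if k = l then 1 else 0) else u (pr k) (pr l) y)
      (if k = 3 \<or> l = 3 then 0 else u1 (pr k) (pr l) m 0) 0" for k l m
    using pd_u[OF V(2)] by (auto simp: has_pd_const)
  show "(if k = 3 \<or> l = 3 then (if k = l then 1 else 0) else u (pr k) (pr l) 0) = (if k = l then 1 else 0)" for k l
    using tn_pr[of k] tn_pr[of l] by (simp add: u_def adj_0 \<Delta>_0) metis
qed (rule V pd_G pd_G1 | assumption)+

text \<open>Between a tangential and the normal coordinate field the lowered Christoffel symbol is
  half the normal derivative of the metric. With the sign in the shape operator, that derivative is
  -2 times the shape operator.\<close>

lemma G1_normal_derivative: "G1 1 1 3 0 = - 2 * \<kappa>1" "G1 1 2 3 0 = 0" "G1 2 2 3 0 = - 2 * \<kappa>2"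
proof -
  have S: "shape_operator G 0 X $ k = - (\<Sum>i\<in>UNIV. \<Sum>j\<in>UNIV. ambient.chr k i j 0 * X $ i * axis 3 1 $ j)" for X k
    by (simp add: shape_operator_def ambient.levi_civita_const_0)
  have "(\<kappa>1 *\<^sub>R axis 1 1) $ k = - (\<Sum>i\<in>UNIV. \<Sum>j\<in>UNIV. ambient.chr k i j 0 * axis 1 1 $ i * axis 3 1 $ j)"
    "(\<kappa>2 *\<^sub>R axis 2 1) $ k = - (\<Sum>i\<in>UNIV. \<Sum>j\<in>UNIV. ambient.chr k i j 0 * axis 2 1 $ i * axis 3 1 $ j)" for k
    using S[of "axis 1 1" k] S[of "axis 2 1" k] by (simp_all only: shape_1 shape_2)
  from this(1)[of 1] this(1)[of 2] this(2)[of 2]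
  show "G1 1 1 3 0 = - 2 * \<kappa>1" "G1 1 2 3 0 = 0" "G1 2 2 3 0 = - 2 * \<kappa>2"
    using G1_21 by (simp_all add: ambient.chr_def sum_3 axis_def G1_normal[OF V(2)])
qed

lemma u1_0: "u1 a b i 0 = - G1 (tn a) (tn b) i 0"
  using exhaust_2[of a] exhaust_2[of b]
  by (auto simp: u1_def \<Delta>_0 adj1_def adj_0 \<Delta>1_def g_0 G1_21)

text \<open>Second normal derivatives occur only through their trace, so this formula can be solved
  for the trace in terms of curvatures; the symbol computation needs no other combination of them
  after angular averaging.\<close>

lemma scalar_curvature_ambient:
  "scalar_curvature G 0 = 2 * K + 2 * (\<kappa>1\<^sup>2 + \<kappa>2\<^sup>2) - (G2 1 1 3 3 + G2 2 2 3 3) - 2 * \<kappa>1 * \<kappa>2"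
  by (simp add: ambient.scalar_curvature_0 ambient.dchr_def ambient.chr_def sum_3 u1_0 pr_def
      G1_normal_derivative G1_normal[OF V(2)] G2_normal G1_tangential G1_21 G2_21 G2_tangential G2_K
      power2_eq_square algebra_simps)

lemma G1_tn: "G1 (tn a) (tn b) (tn c) 0 = 0"
  using exhaust_2[of a] exhaust_2[of b] exhaust_2[of c] G1_21 by (auto simp: G1_tangential)

lemma \<Delta>1_tn: "\<Delta>1 (tn a) 0 = 0"
  using G1_tn[of 1 1 a] G1_tn[of 2 2 a] by (simp add: \<Delta>1_def g_0)

lemma u_sym: "u a b y = u b a y" and u1_sym: "u1 a b i y = u1 b a i y" and u2_sym: "u2 a b i j = u2 b a i j"
  by (auto simp: u_def u1_def u2_def adj_def adj1_def adj2_def)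

lemma u_0: "u a b 0 = (if a = b then 1 else 0)"
  by (simp add: u_def adj_0 \<Delta>_0)

lemma pd_L1: "has_pd j (L1 a) (L2 a j) 0" and pd_A: "has_pd j A (A1 j) 0"
  unfolding L1_def[abs_def] L2_def A_def[abs_def] A1_def
  using pd_log_\<Delta> has_pd_mult[OF has_pd_const[of j "- 1/2 :: real"] pd_log_\<Delta>] by simp_all

lemma christoffel_slice_0: "christoffel (tangential_metric G 0) k a b 0 = 0"
  by (simp add: slice.christoffel_0 slice.chr_def G1_tn)

lemma \<Delta>1_3: "\<Delta>1 3 0 = - 2 * (\<kappa>1 + \<kappa>2)"
  by (simp add: \<Delta>1_def g_0 G1_normal_derivative)

lemma A_0: "A 0 = \<kappa>1 + \<kappa>2"
  by (simp add: A_def \<Delta>_0 \<Delta>1_3 diff_divide_distrib)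

lemmas jet_simps = u2_def adj1_def adj2_def \<Delta>2_def G1_tangential G2_tangential G2_21 G2_K
  \<Delta>1_tn[of 1, simplified] \<Delta>1_tn[of 2, simplified]

lemma u2_tangential:
  "u2 1 1 1 1 = 0" "u2 1 1 1 2 = 0" "u2 1 1 2 1 = 0" "u2 1 1 2 2 = 2 * K / 3"
  "u2 1 2 1 1 = 0" "u2 1 2 1 2 = - K / 3" "u2 1 2 2 1 = - K / 3" "u2 1 2 2 2 = 0"
  "u2 2 2 1 1 = 2 * K / 3" "u2 2 2 1 2 = 0" "u2 2 2 2 1 = 0" "u2 2 2 2 2 = 0"
  by (simp_all add: jet_simps)

lemma L2_tangential: "L2 1 1 = - 2 * K / 3" "L2 1 2 = 0" "L2 2 1 = 0" "L2 2 2 = - 2 * K / 3"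
  by (simp_all add: L2_def jet_simps)

lemma A1_3: "A1 3 = 2 * (\<kappa>1 + \<kappa>2)\<^sup>2 - 4 * \<kappa>1 * \<kappa>2 - (G2 1 1 3 3 + G2 2 2 3 3) / 2"
  by (simp add: A1_def \<Delta>2_def \<Delta>1_3 G1_normal_derivative power2_eq_square algebra_simps)

lemma u2_normal: "u2 1 1 3 3 + u2 2 2 3 3 = 8 * (\<kappa>1\<^sup>2 + \<kappa>2\<^sup>2) - (G2 1 1 3 3 + G2 2 2 3 3)"
  by (simp add: u2_def adj1_def adj2_def \<Delta>2_def \<Delta>1_3 G1_normal_derivative power2_eq_square algebra_simps)

lemma dn_symbol_normal:
  fixes W :: "3 \<Rightarrow> real^3 \<Rightarrow> complex^'r::finite^'r"
  assumes W: "\<And>i j. has_pd i (W j) (W1 j i) 0"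
  shows "dn_symbol_normal (tangential_metric G) W V u u1 u2 L1 L2 A A1 W1 \<kappa>1 \<kappa>2 K
    (2 * (\<kappa>1 + \<kappa>2)\<^sup>2 - 4 * \<kappa>1 * \<kappa>2 - (G2 1 1 3 3 + G2 2 2 3 3) / 2)"
proof
  fix y :: "real^3" and \<xi> :: "real^2" assume y: "y \<in> V"
  have \<Delta>: "0 < \<Delta> y" by (rule \<Delta>_pos[OF y])
  \<comment> \<open>The adjugate form at \<xi> is the form of the metric at \<xi> rotated by a right
    angle, so nonnegativity carries over to the inverse.\<close>
  have "0 \<le> g 1 1 y * (\<xi> $ 2)\<^sup>2 + 2 * g 1 2 y * (- \<xi> $ 2) * \<xi> $ 1 + g 2 2 y * (\<xi> $ 1)\<^sup>2"
    using quadratic_form_pos[OF y, of "vector [- \<xi> $ 2, \<xi> $ 1]"] by (cases "\<xi> = 0") (auto simp: vec_eq_iff forall_2 less_imp_le)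
  then have "0 \<le> (g 1 1 y * (\<xi> $ 2)\<^sup>2 + 2 * g 1 2 y * (- \<xi> $ 2) * \<xi> $ 1 + g 2 2 y * (\<xi> $ 1)\<^sup>2) / \<Delta> y"
    using \<Delta> by simp
  then show "0 \<le> (\<Sum>a\<in>UNIV. \<Sum>b\<in>UNIV. u a b y * \<xi> $ a * \<xi> $ b)"
    by (simp add: sum_2 u_def adj_def add_divide_distrib diff_divide_distrib power2_eq_square algebra_simps)
next
  fix a b
  have "continuous_on V (adj a b)" "continuous_on V \<Delta>"
    unfolding adj_def[abs_def] \<Delta>_def[abs_def] g_def[abs_def]
    by (cases "a = b"; cases "a = 1"; auto intro!: continuous_intros cont_G)+
  then show "continuous_on V (u a b)"
    unfolding u_def[abs_def] using \<Delta>_pos by (intro continuous_on_divide) (auto simp: less_imp_neq[THEN not_sym])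
next
  show "has_pd j (u1 a b i) (u2 a b i j) 0" for a b i j by (rule pd_u1)
  show "has_pd j (L1 a) (L2 a j) 0" for a j by (rule pd_L1)
  show "has_pd j A (A1 j) 0" for j by (rule pd_A)
  show "u a b y = u b a y" "u1 a b i y = u1 b a i y" "u2 a b i j = u2 b a i j" for a b i j y
    by (rule u_sym u1_sym u2_sym)+
  show "u1 a b (tn c) 0 = 0" for a b c by (simp add: u1_0 G1_tn)
  show "L1 a 0 = 0" for a by (simp add: L1_def \<Delta>1_tn)
  show "christoffel (tangential_metric G 0) k a b 0 = 0" for k a b by (rule christoffel_slice_0)
  show "u1 1 1 3 0 = 2 * \<kappa>1" "u1 1 2 3 0 = 0" "u1 2 2 3 0 = 2 * \<kappa>2"
    by (simp_all add: u1_0 G1_normal_derivative)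
  show "open V" "0 \<in> V" by (rule V)+
  show "ginv (tangential_metric G) a b t x = u a b (pt x t)" "Acoef (tangential_metric G) t x = A (pt x t)"
    "pd a (\<lambda>y. ln (det (tangential_metric G t y))) x = L1 a (pt x t)" if "pt x t \<in> V" for a b x t
    using that by (rule ginv_eq Acoef_eq lndet)+
  show "has_pd i (u a b) (u1 a b i y) y" if "y \<in> V" for a b i y using that by (rule pd_u)
  show "has_pd i (W j) (W1 j i) 0" for i j by (rule W)
  show "u a b 0 = (if a = b then 1 else 0)" for a b by (rule u_0)
qed (simp_all only: u2_tangential L2_tangential A_0 A1_3)

end


section \<open>Smooth functions, charts and geodesics\<close>

lemma times_cont_diff_on_SucD:
  assumes "times_cont_diff_on (Suc k) F U" "open U" "y \<in> U"
  shows "(F has_derivative frechet_derivative F (at y)) (at y)"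
    and "times_cont_diff_on k (\<lambda>x. frechet_derivative F (at x) v) U"
  using assms by (auto simp: differentiable_on_eq_differentiable_at frechet_derivative_works)

text \<open>Smoothness on a set only provides a local extension; when the set is open, shrinking the
  neighbourhood makes the extension coincide with the function itself.\<close>

lemma smooth_on_interior:
  assumes "smooth_on f S" "open S" "x \<in> S"
  obtains U F where "open U" "x \<in> U" "U \<subseteq> S" "\<And>y. y \<in> U \<Longrightarrow> F y = f y" "\<And>k. times_cont_diff_on k F U"
proof -
  have mono: "times_cont_diff_on k F U \<Longrightarrow> U' \<subseteq> U \<Longrightarrow> times_cont_diff_on k F U'"
    for k and F :: "'a \<Rightarrow> 'b" and U U'
  proof (induction k arbitrary: F)
    case 0 then show ?case by (simp add: continuous_on_subset)
  next
    case (Suc k) then show ?case by simp (meson differentiable_on_subset)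
  qed
  have "\<exists>U F. open U \<and> x \<in> U \<and> (\<forall>k. times_cont_diff_on k F U) \<and> (\<forall>y\<in>U \<inter> S. F y = f y)"
    using assms(1)[unfolded smooth_on_def] assms(3) by (rule bspec)
  then obtain U F where UF: "open U \<and> x \<in> U \<and> (\<forall>k. times_cont_diff_on k F U) \<and> (\<forall>y\<in>U \<inter> S. F y = f y)"
    by (elim exE)
  show thesis
  proof (rule that[of "U \<inter> S" F])
    show "times_cont_diff_on k F (U \<inter> S)" for k
      by (rule mono[of k F U]) (use UF in simp_all)
  qed (use UF assms in auto)
qed

lemma has_derivative_components:
  fixes f' :: "real^'n \<Rightarrow> 'b::real_normed_vector"
  assumes "(f has_derivative f') (at x)"
  shows "f' v = (\<Sum>l\<in>UNIV. v $ l *\<^sub>R f' (axis l 1))"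
proof -
  interpret linear f' using has_derivative_linear[OF assms] .
  have "v = (\<Sum>l\<in>UNIV. v $ l *\<^sub>R axis l 1)"
    using basis_expansion[of v] by (simp add: scalar_mult_eq_scaleR)
  then have "f' v = f' (\<Sum>l\<in>UNIV. v $ l *\<^sub>R axis l 1)" by simp
  then show ?thesis by (simp add: sum scale)
qed

lemma has_derivative_matrix_component:
  fixes F :: "real^3 \<Rightarrow> real^'n^'m"
  assumes "(F has_derivative F') (at y)"
  shows "((\<lambda>y. F y $ i $ j) has_derivative (\<lambda>v. F' v $ i $ j)) (at y)"
  by (rule bounded_linear.has_derivative[OF bounded_linear_vec_nth
        bounded_linear.has_derivative[OF bounded_linear_vec_nth assms]])

text \<open>First and second derivatives are taken from iterated total derivatives of a smooth local
  extension, which agrees with the metric near 0. Continuity of the second derivatives then gives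
  their symmetry.\<close>

lemma smooth_metric_jets:
  fixes G :: "real^3 \<Rightarrow> real^3^3"
  assumes sm: "smooth_on G S" and S: "open S" "0 \<in> S"
  obtains V G1 G2 where "open V" "0 \<in> V" "V \<subseteq> S"
    "\<And>y i j k. y \<in> V \<Longrightarrow> has_pd k (\<lambda>y. G y $ i $ j) (G1 i j k y) y"
    "\<And>i j k. (G1 i j k has_derivative (\<lambda>v. \<Sum>l\<in>UNIV. v $ l * G2 i j k l)) (at 0)"
    "\<And>i j k l. G2 i j k l = G2 i j l k"
    "\<And>i j. continuous_on V (\<lambda>y. G y $ i $ j)"
proof -
  obtain V F where V: "open V" "0 \<in> V" "V \<subseteq> S"
    and FG: "\<And>y. y \<in> V \<Longrightarrow> F y = G y" and F: "\<And>k. times_cont_diff_on k F V"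
    by (rule smooth_on_interior[OF sm S]) (rule that)
  define F1 where "F1 k y = frechet_derivative F (at y) (axis k 1)" for k :: 3 and y
  define F2 where "F2 k l y = frechet_derivative (F1 k) (at y) (axis l 1)" for k l :: 3 and y
  have dF: "(F has_derivative frechet_derivative F (at y)) (at y)" if "y \<in> V" for y
    by (rule times_cont_diff_on_SucD(1)[OF F[of "Suc 0"] V(1) that])
  have F1: "times_cont_diff_on k' (F1 k) V" for k k'
    unfolding F1_def using times_cont_diff_on_SucD(2)[OF F[of "Suc k'"] V(1,2)] .
  have dF1: "(F1 k has_derivative frechet_derivative (F1 k) (at y)) (at y)" if "y \<in> V" for k y
    by (rule times_cont_diff_on_SucD(1)[OF F1[of "Suc 0"] V(1) that])
  have F2: "continuous_on V (F2 k l)" for k l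
    unfolding F2_def using times_cont_diff_on_SucD(2)[OF F1[of "Suc 0" k] V(1,2)] by simp
  have pF: "has_pd k (\<lambda>y. F y $ i $ j) (F1 k y $ i $ j) y" if "y \<in> V" for i j k y
    unfolding F1_def by (rule has_pd_frechet[OF has_derivative_matrix_component[OF dF[OF that]]])
  have pF1: "has_pd l (\<lambda>y. F1 k y $ i $ j) (F2 k l y $ i $ j) y" if "y \<in> V" for i j k l y
    unfolding F2_def by (rule has_pd_frechet[OF has_derivative_matrix_component[OF dF1[OF that]]])
  have cF2: "isCont (\<lambda>y. F2 k l y $ i $ j) 0" for i j k l
  proof -
    have "isCont (F2 k l) 0" using F2[of k l] V by (simp add: continuous_on_eq_continuous_at)
    then show ?thesis by (intro continuous_intros)
  qed
  show thesis
  proof (rule that[of V "\<lambda>i j k y. F1 k y $ i $ j" "\<lambda>i j k l. F2 k l 0 $ i $ j"])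
    show "has_pd k (\<lambda>y. G y $ i $ j) (F1 k y $ i $ j) y" if "y \<in> V" for y i j k
      by (rule has_pd_transform[OF pF[OF that] V(1) that]) (simp add: FG)
    show "((\<lambda>y. F1 k y $ i $ j) has_derivative (\<lambda>v. \<Sum>l\<in>UNIV. v $ l * F2 k l 0 $ i $ j)) (at 0)" for i j k
    proof (rule has_derivative_eq_rhs[OF has_derivative_matrix_component[OF dF1[OF V(2)]]])
      show "(\<lambda>v. frechet_derivative (F1 k) (at 0) v $ i $ j) = (\<lambda>v. \<Sum>l\<in>UNIV. v $ l * F2 k l 0 $ i $ j)"
        by (subst has_derivative_components[OF dF1[OF V(2)]]) (simp add: F2_def)
    qed
    show "F2 k l 0 $ i $ j = F2 l k 0 $ i $ j" for i j k l
      by (rule pd_commute[OF V(1,2) pF pF pF1 pF1 cF2 cF2])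
    show "continuous_on V (\<lambda>y. G y $ i $ j)" for i j
    proof (rule continuous_on_eq[of _ "\<lambda>y. F y $ i $ j"])
      have "continuous_on V F" using F[of 0] by simp
      then show "continuous_on V (\<lambda>y. F y $ i $ j)" by (intro continuous_intros)
    qed (simp add: FG)
  qed (rule V)+
qed

lemma smooth_on_has_pd:
  assumes "smooth_on f S" "open S" "x \<in> S"
  shows "\<exists>D. has_pd i f D x"
proof -
  obtain V F where V: "open V" "x \<in> V" "V \<subseteq> S"
    and Ff: "\<And>y. y \<in> V \<Longrightarrow> F y = f y" and F: "\<And>k. times_cont_diff_on k F V"
    by (rule smooth_on_interior[OF assms]) (rule that)
  have "(F has_derivative frechet_derivative F (at x)) (at x)"
    by (rule times_cont_diff_on_SucD(1)[OF F[of "Suc 0"] V(1,2)])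
  from has_pd_transform[OF has_pd_frechet[OF this] V(1,2) Ff] show ?thesis by blast
qed

text \<open>An affine curve has constant velocity and no acceleration, so only the Christoffel term
  of the geodesic equation remains. Nontriviality of \<open>at s within I\<close> makes the
  one-sided derivatives unique.\<close>

lemma geodesic_on_line:
  assumes "geodesic_on G u I" "t \<in> I" "at t within I \<noteq> bot"
    and lin: "\<And>s. u s = a + s *\<^sub>R b" and nt: "\<And>s. s \<in> I \<Longrightarrow> at s within I \<noteq> bot"
  shows "(\<Sum>i\<in>UNIV. \<Sum>j\<in>UNIV. christoffel G k i j (u t) * b $ i * b $ j) = 0"
proof -
  from assms(1) obtain u' u'' where u:
    "\<And>t. t \<in> I \<Longrightarrow> (u has_vector_derivative u' t) (at t within I)"
    "\<And>t. t \<in> I \<Longrightarrow> (u' has_vector_derivative u'' t) (at t within I)"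
    "\<And>t k. t \<in> I \<Longrightarrow> u'' t $ k + (\<Sum>i\<in>UNIV. \<Sum>j\<in>UNIV. christoffel G k i j (u t) * u' t $ i * u' t $ j) = 0"
    unfolding geodesic_on_def by blast
  have u': "u' s = b" if "s \<in> I" for s
  proof -
    have "(u has_vector_derivative b) (at s within I)"
      unfolding lin[abs_def] by (auto intro!: derivative_eq_intros)
    then show ?thesis
      using vector_derivative_unique_within[OF nt[OF that] u(1)[OF that]] by simp
  qed
  have "(u' has_vector_derivative 0) (at t within I)"
    by (rule has_vector_derivative_transform[OF assms(2) _ has_vector_derivative_const[of b]]) (simp add: u')
  then have "u'' t = 0"
    using vector_derivative_unique_within[OF nt[OF assms(2)] u(2)[OF assms(2)]] by simp
  then show ?thesis using u(3)[OF assms(2), of k] by (simp add: u'[OF assms(2)])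
qed


section \<open>The metric in a boundary normal chart\<close>

lemma at_within_closed_segment:
  assumes "s \<in> closed_segment 0 t" "t \<noteq> (0::real)"
  shows "at s within closed_segment 0 t \<noteq> bot"
proof -
  have "s islimpt closed_segment 0 t"
    using assms by (intro connected_imp_perfect) (auto simp: closed_segment_eq_real_ivl split: if_splits)
  then show ?thesis by (simp add: trivial_limit_within)
qed

lemma pos_def_mult_matrix_inv:
  fixes B :: "real^'n^'n"
  assumes "\<And>v. v \<noteq> 0 \<Longrightarrow> 0 < v \<bullet> (B *v v)"
  shows "B ** matrix_inv B = mat 1"
proof -
  have "x = 0" if "B *v x = 0" for x using assms[of x] that by force
  then have "invertible B"
    by (simp add: invertible_left_inverse matrix_left_invertible_ker)
  then have "\<exists>A'. B ** A' = mat 1 \<and> A' ** B = mat 1" by (simp add: invertible_def)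
  then show ?thesis unfolding matrix_inv_def by (rule someI2_ex) simp
qed

text \<open>This contains the Gauss lemma: the unit length of the third coordinate field and its
  orthogonality to the slices are given only on the hypersurface, and the normal geodesics propagate
  both through the chart.\<close>

lemma boundary_normal_chart_metric:
  assumes A: "smooth_structure M A" and rm: "riemannian_metric A g" and nf: "unit_normal_field A g N \<nu>"
    and bn: "boundary_normal_chart A g N \<nu> p c"
  shows "open (cimg c)" "0 \<in> cimg c" "smooth_on (g c) (cimg c)"
    and "y \<in> cimg c \<Longrightarrow> g c y $ i $ j = g c y $ j $ i"
    and "y \<in> cimg c \<Longrightarrow> v \<noteq> 0 \<Longrightarrow> 0 < v \<bullet> (g c y *v v)"
    and "y \<in> cimg c \<Longrightarrow> g c y $ 3 $ 3 = 1"
    and "y \<in> cimg c \<Longrightarrow> g c y $ 1 $ 3 = 0" and "y \<in> cimg c \<Longrightarrow> g c y $ 2 $ 3 = 0"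
    and "pt x 0 \<in> cimg c \<Longrightarrow>
      (\<Sum>a\<in>UNIV. \<Sum>b\<in>UNIV. christoffel (tangential_metric (g c) 0) d a b x * x $ a * x $ b) = 0"
proof -
  let ?G = "g c" and ?C = "cimg c"
  from bn have ad: "adapted_chart A N \<nu> c" and p: "p \<in> dom_of c" "cmap c p = 0"
    and seg: "\<And>x t s. pt x t \<in> ?C \<Longrightarrow> s \<in> closed_segment 0 t \<Longrightarrow> pt x s \<in> ?C"
    and geo_slice: "\<And>x. pt x 0 \<in> ?C \<Longrightarrow> geodesic_on (tangential_metric ?G 0) (\<lambda>s. s *\<^sub>R x) {0..1}"
    and geo_normal: "\<And>x t. pt x t \<in> ?C \<Longrightarrow> geodesic_on ?G (\<lambda>s. pt x s) (closed_segment 0 t)"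
    unfolding boundary_normal_chart_def by blast+
  from ad have cA: "c \<in> A" and C: "open ?C" and slice: "slice_chart A N c"
    and dN: "dom_of c \<inter> N = {q \<in> dom_of c. cmap c q $ 3 = 0}"
    and \<nu>: "\<And>q. q \<in> N \<inter> dom_of c \<Longrightarrow> \<nu> c q = axis 3 1"
    unfolding adapted_chart_def slice_chart_def by blast+
  show "open ?C" by (rule C)
  show "0 \<in> ?C" using p unfolding cimg_def by force
  from rm cA have G: "smooth_on ?G ?C" "\<And>y. y \<in> ?C \<Longrightarrow> transpose (?G y) = ?G y"
    and pos: "\<And>y v. y \<in> ?C \<Longrightarrow> v \<noteq> 0 \<Longrightarrow> 0 < v \<bullet> (?G y *v v)"
    unfolding riemannian_metric_def by blast+
  show "smooth_on ?G ?C" by (rule G)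
  show "0 < v \<bullet> (?G y *v v)" if "y \<in> ?C" "v \<noteq> 0" for y v using that by (rule pos)
  show sym: "?G y $ i $ j = ?G y $ j $ i" if "y \<in> ?C" for y i j
    using arg_cong[OF G(2)[OF that], of "\<lambda>B. B $ i $ j"] by (simp add: transpose_def)
  have slice_values: "?G (pt x 0) $ 3 $ 3 = 1" "?G (pt x 0) $ 1 $ 3 = 0" "?G (pt x 0) $ 2 $ 3 = 0"
    if x: "pt x 0 \<in> ?C" for x
  proof -
    from x obtain q where q: "q \<in> dom_of c" "cmap c q = pt x 0"
      unfolding cimg_def by force
    have "q \<in> {q \<in> dom_of c. cmap c q $ 3 = 0}" using q by simp
    then have qN: "q \<in> N \<inter> dom_of c" unfolding dN[symmetric] by simp
    have n: "\<nu> c q = axis 3 1" by (rule \<nu>[OF qN])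
    have "\<nu> c q \<bullet> (?G (cmap c q) *v \<nu> c q) = 1"
      using nf cA qN unfolding unit_normal_field_def by blast
    then show "?G (pt x 0) $ 3 $ 3 = 1"
      by (simp add: n q inner_vec_def matrix_vector_mult_def sum_3 axis_def)
    have o: "v \<bullet> (?G (cmap c q) *v \<nu> c q) = 0" if "v $ 3 = 0" for v
      using nf slice qN that unfolding unit_normal_field_def by blast
    show "?G (pt x 0) $ 1 $ 3 = 0"
      using o[of "axis 1 1"] by (simp add: n q inner_vec_def matrix_vector_mult_def sum_3 axis_def)
    show "?G (pt x 0) $ 2 $ 3 = 0"
      using o[of "axis 2 1"] by (simp add: n q inner_vec_def matrix_vector_mult_def sum_3 axis_def)
  qed
  have pd_ex: "\<exists>D. has_pd k (\<lambda>y. ?G y $ i $ j) D y" if y: "y \<in> ?C" for i j k y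
  proof -
    from smooth_on_has_pd[OF G(1) C y] obtain D where "has_pd k ?G D y" by blast
    from has_pd_linear[OF bounded_linear_vec_nth has_pd_linear[OF bounded_linear_vec_nth this]]
    show ?thesis by blast
  qed
  then have pd: "has_pd k (\<lambda>y. ?G y $ i $ j) (pd k (\<lambda>y. ?G y $ i $ j) y) y" if y: "y \<in> ?C" for i j k y
    using pd_eq pd_ex[OF y] by metis
  have split: "y = pt (vector [y $ 1, y $ 2]) (y $ 3)" for y :: "real^3"
    by (simp add: vec_eq_iff forall_3)
  have chr33: "christoffel ?G k 3 3 (pt x s) = 0" if x: "pt x t \<in> ?C" "s \<in> closed_segment 0 t" "t \<noteq> 0" for x s t k
  proof -
    have "(\<Sum>i\<in>UNIV. \<Sum>j\<in>UNIV. christoffel ?G k i j (pt x s) * axis 3 1 $ i * axis 3 1 $ j) = 0"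
      by (rule geodesic_on_line[OF geo_normal[OF x(1)] x(2), of "pt x 0"])
         (use at_within_closed_segment[OF _ x(3)] x(2) in \<open>auto simp: pt_add_normal[symmetric]\<close>)
    then show ?thesis by (simp add: sum_3 axis_def)
  qed
  have chr33: "christoffel ?G k 3 3 y = 0" if y: "y \<in> ?C" for k y
  proof (cases "y $ 3 = 0")
    case False
    then show ?thesis using chr33[of "vector [y $ 1, y $ 2]" "y $ 3" "y $ 3" k] y split[of y] by auto
  next
    case True
    \<comment> \<open>For a point of the hypersurface the segment to itself is degenerate and
      determines no derivative. A short normal segment starting at the point takes its
      place.\<close>
    have "isCont (\<lambda>t. y + t *\<^sub>R axis 3 (1::real)) 0" by (intro continuous_intros)
    then have "eventually (\<lambda>t. y + t *\<^sub>R axis 3 (1::real) \<in> ?C) (at 0)"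
      using C y by (simp add: isCont_def tendsto_def)
    then obtain \<delta> where \<delta>: "0 < \<delta>" "\<And>t. t \<noteq> 0 \<Longrightarrow> dist t 0 < \<delta> \<Longrightarrow> y + t *\<^sub>R axis 3 (1::real) \<in> ?C"
      unfolding eventually_at by blast
    have y': "y = pt (vector [y $ 1, y $ 2]) 0" using split[of y] True by simp
    have "pt (vector [y $ 1, y $ 2]) (\<delta> / 2) = y + (\<delta> / 2) *\<^sub>R axis 3 1"
      using pt_add_normal[of _ 0 "\<delta> / 2"] y' by simp
    then have "pt (vector [y $ 1, y $ 2]) (\<delta> / 2) \<in> ?C" using \<delta> by (simp add: dist_real_def)
    then have "christoffel ?G k 3 3 (pt (vector [y $ 1, y $ 2]) 0) = 0"
      by (rule chr33) (use \<delta> in auto)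
    then show ?thesis using y' by simp
  qed
  \<comment> \<open>Multiplying the vanishing Christoffel symbols by the metric lowers the index.
    The case \<open>l = 3\<close> makes the 3,3 entry constant along normal lines; once it is known
    to be 1, the other cases do the same for the mixed entries.\<close>
  have lowered: "2 * pd 3 (\<lambda>y. ?G y $ l $ 3) y = pd l (\<lambda>y. ?G y $ 3 $ 3) y" if y: "y \<in> ?C" for l y
  proof -
    define v where "v = (\<chi> l. 2 * pd 3 (\<lambda>y. ?G y $ l $ 3) y - pd l (\<lambda>y. ?G y $ 3 $ 3) y)"
    have "(matrix_inv (?G y) *v v) $ k = 2 * christoffel ?G k 3 3 y" for k
      by (simp add: christoffel_def matrix_vector_mult_def v_def)
    then have "matrix_inv (?G y) *v v = 0" by (simp add: vec_eq_iff chr33[OF y])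
    then have "?G y *v (matrix_inv (?G y) *v v) = 0" by simp
    then have "v = 0"
      using pos_def_mult_matrix_inv[OF pos[OF y]] by (simp add: matrix_vector_mul_assoc)
    then have "v $ l = 0" by simp
    then show ?thesis by (simp add: v_def)
  qed
  have const: "?G (pt x t) $ i $ j = ?G (pt x 0) $ i $ j"
    if x: "pt x t \<in> ?C" and zero: "\<And>y. y \<in> ?C \<Longrightarrow> pd 3 (\<lambda>y. ?G y $ i $ j) y = 0" for x t i j
  proof -
    have "((\<lambda>s. ?G (pt x s) $ i $ j) has_vector_derivative 0) (at s)" if "s \<in> closed_segment 0 t" for s
      using pd[OF seg[OF x that], of 3 i j] zero[OF seg[OF x that]]
      by (simp add: has_vector_derivative_pt[of "\<lambda>y. ?G y $ i $ j"])
    then have "\<And>s. s \<in> closed_segment 0 t \<Longrightarrow>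
        ((\<lambda>s. ?G (pt x s) $ i $ j) has_field_derivative 0) (at s within closed_segment 0 t)"
      by (simp add: has_real_derivative_iff_has_vector_derivative has_vector_derivative_at_within)
    from has_field_derivative_zero_constant[OF _ this] obtain b
      where "\<And>s. s \<in> closed_segment 0 t \<Longrightarrow> ?G (pt x s) $ i $ j = b"
      by (auto simp: convex_closed_segment)
    then show ?thesis by (metis ends_in_segment)
  qed
  have 33: "?G y $ 3 $ 3 = 1" if y: "y \<in> ?C" for y
  proof -
    have 0: "pd 3 (\<lambda>y. ?G y $ 3 $ 3) y = 0" if "y \<in> ?C" for y using lowered[OF that, of 3] by simp
    have y': "pt (vector [y $ 1, y $ 2]) (y $ 3) \<in> ?C" using y split[of y] by simp
    have "pt (vector [y $ 1, y $ 2]) 0 \<in> ?C" by (rule seg[OF y']) simp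
    then show ?thesis using const[OF y' 0] slice_values(1) split[of y] by simp
  qed
  have "pd l (\<lambda>y. ?G y $ 3 $ 3) y = 0" if y: "y \<in> ?C" for l y
    by (rule pd_eq, rule has_pd_transform[OF has_pd_const C y]) (simp add: 33)
  then have 0: "pd 3 (\<lambda>y. ?G y $ l $ 3) y = 0" if "y \<in> ?C" for l y
    using lowered[OF that, of l] that by simp
  have const0: "?G y $ l $ 3 = ?G (pt (vector [y $ 1, y $ 2]) 0) $ l $ 3 \<and> pt (vector [y $ 1, y $ 2]) 0 \<in> ?C"
    if y: "y \<in> ?C" for y l
  proof -
    have y': "pt (vector [y $ 1, y $ 2]) (y $ 3) \<in> ?C" using y split[of y] by simp
    have "pt (vector [y $ 1, y $ 2]) 0 \<in> ?C" by (rule seg[OF y']) simp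
    then show ?thesis using const[OF y' 0] split[of y] by simp
  qed
  show "?G y $ 3 $ 3 = 1" if "y \<in> ?C" for y using that by (rule 33)
  show "?G y $ 1 $ 3 = 0" "?G y $ 2 $ 3 = 0" if "y \<in> ?C" for y
    using const0[OF that] slice_values by auto
  show "(\<Sum>a\<in>UNIV. \<Sum>b\<in>UNIV. christoffel (tangential_metric ?G 0) d a b x * x $ a * x $ b) = 0"
    if "pt x 0 \<in> ?C" for x d
  proof -
    have "at s within {0..1} \<noteq> bot" if "s \<in> {0..1}" for s :: real
      using at_within_closed_segment[of s 1] that by (simp add: closed_segment_eq_real_ivl)
    then show ?thesis
      using geodesic_on_line[OF geo_slice[OF that], of 1 0 x d] by simp
  qed
qed

lemma chart_image_open:
  assumes c: "is_chart M c" and C: "open (cimg c)" and U: "openin M U"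
  shows "open (cmap c ` (dom_of c \<inter> U))"
proof -
  have "homeomorphic_map (subtopology M (dom_of c)) (top_of_set (cimg c)) (cmap c)" "openin M (dom_of c)"
    using c by (auto simp: is_chart_def)
  then have "openin (top_of_set (cimg c)) (cmap c ` (dom_of c \<inter> U))"
    using U homeomorphic_imp_open_map unfolding open_map_def by (metis openin_subtopology_Int2)
  then show ?thesis using C by (simp add: openin_open_eq)
qed

lemma cinv_cmap:
  assumes c: "is_chart M c" and q: "q \<in> dom_of c"
  shows "cinv c (cmap c q) = q"
proof -
  have hom: "homeomorphic_map (subtopology M (dom_of c)) (top_of_set (cimg c)) (cmap c)" and "openin M (dom_of c)"
    using c by (auto simp: is_chart_def)
  have "inj_on (cmap c) (topspace (subtopology M (dom_of c)))"
    using hom by (rule homeomorphic_imp_injective_map)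
  then have "inj_on (cmap c) (dom_of c)"
    using openin_subset[OF \<open>openin M (dom_of c)\<close>] by (simp add: Int_absorb1)
  then show ?thesis unfolding cinv_def using q by simp
qed

text \<open>The number \<open>T\<close> occurs on the right only in \<tau>M and fixes its
  coefficient; the multiple of \<open>K\<close> left over then fixes that of \<tau>N. In the second
  identity \<open>K\<close> cancels, which is why the difference of the two scalar curvatures
  appears. \<open>Q\<close> drops out of both.\<close>

lemma J2_profile_coefficients:
  fixes n t Q :: complex and K T \<kappa>1 \<kappa>2 v1 v2 :: real
  assumes v: "v1 + v2 = 8 * (\<kappa>1\<^sup>2 + \<kappa>2\<^sup>2) - T"
  defines "m0 \<equiv> n / 2 * of_real ((\<kappa>1 + \<kappa>2)\<^sup>2 / 2 - (2 * (\<kappa>1 + \<kappa>2)\<^sup>2 - 4 * \<kappa>1 * \<kappa>2 - T / 2)) - Q - t"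
    and "m \<equiv> n / 2 * of_real ((v1 + v2) / 2 - 2 * K / 3) + Q"
    and "k \<equiv> n * of_real (- 15/4 * (\<kappa>1\<^sup>2 + \<kappa>2\<^sup>2) - 5/2 * (\<kappa>1 * \<kappa>2))"
    and "b \<equiv> n * of_real (4 * K / 3) - 4 * Q"
    and "\<tau>M \<equiv> 2 * K + 2 * (\<kappa>1\<^sup>2 + \<kappa>2\<^sup>2) - T - 2 * \<kappa>1 * \<kappa>2" and "\<tau>N \<equiv> 2 * K"
  shows "(- (m0 + m / 2 + k / 8) / 2 + b / 16) / (2 * pi) =
      n * of_real (\<tau>M / (32 * pi) + \<tau>N / (96 * pi) - ((\<kappa>1 + \<kappa>2) / 2)\<^sup>2 / (32 * pi) + \<kappa>1 * \<kappa>2 / (32 * pi)) + t / (4 * pi)"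
    and "(m / 8 + 3 * k / 64 + b / 32) / (2 * pi) =
      n * of_real (1 / (64 * pi) * (\<tau>M - \<tau>N) + 3 * ((\<kappa>1 + \<kappa>2) / 2)\<^sup>2 / (128 * pi) - 5 * (\<kappa>1 * \<kappa>2) / (128 * pi))"
  unfolding m0_def m_def k_def b_def \<tau>M_def \<tau>N_def v
  by (simp_all add: field_simps power2_eq_square)

theorem theorem3p4:
  fixes M :: "'a topology"
    and A Or :: "'a chart set"
    and g :: "'a metric"
    and vol :: "'a measure"
    and N :: "'a set"
    and \<nu> :: "'a chart \<Rightarrow> 'a \<Rightarrow> real^3"
    and \<pi> :: "'e \<Rightarrow> 'a"
    and Fr :: "('a, 'e, 'r::finite) frame set"
    and ip :: "'e \<Rightarrow> 'e \<Rightarrow> complex"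
    and w :: "('a, 'e, 'r) conn"
    and E :: "'e \<Rightarrow> 'e"
    and Lap :: "('a \<Rightarrow> 'e) \<Rightarrow> 'a \<Rightarrow> 'e"
    and R :: "real \<Rightarrow> ('a \<Rightarrow> 'e) \<Rightarrow> 'a \<Rightarrow> 'e"
    and p :: 'a
    and c :: "'a chart"
    and f :: "('a, 'e, 'r) frame"
    and \<kappa>1 \<kappa>2 :: real
    and \<gamma> :: "real^2 \<Rightarrow> real \<Rightarrow> complex"
    and h :: "real \<Rightarrow> real^2 \<Rightarrow> real^2^2"
    and \<omega> :: "3 \<Rightarrow> real \<Rightarrow> real^2 \<Rightarrow> complex^'r^'r"
    and e :: "real \<Rightarrow> real^2 \<Rightarrow> complex^'r^'r"
    and \<tau>\<^sub>M \<tau>\<^sub>N H1 H2 r0 :: real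
    and TrE :: complex
  assumes "compact_space M" and "Hausdorff_space M"
    and "smooth_structure M A" and "orientation M A Or"
    and "riemannian_metric A g" and "riemannian_volume M A g vol"
    and "closed_hypersurface M A N" and "N \<inter> bdry M A = {}"
    and "unit_normal_field A g N \<nu>"
    and "vector_bundle M A \<pi> Fr" and "inner_product_on_bundle A \<pi> Fr ip"
    and "connection A \<pi> Fr w" and "bundle_endomorphism A \<pi> Fr E"
    and "laplacian M A g vol \<pi> Fr ip w E Lap"
    and "R = dirichlet_to_neumann M A g \<pi> Fr w E N \<nu>"
    and "p \<in> N"
    and "boundary_normal_chart A g N \<nu> p c"
    and "f \<in> Fr" and "p \<in> fst f"
    and "shape_operator (g c) 0 (axis 1 1) = \<kappa>1 *\<^sub>R axis 1 1"
    and "shape_operator (g c) 0 (axis 2 1) = \<kappa>2 *\<^sub>R axis 2 1"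
  defines "h \<equiv> tangential_metric (g c)"
    and "\<omega> \<equiv> \<lambda>j t x. w c f j (pt x t)"
    and "e \<equiv> \<lambda>t x. endo_matrix \<pi> f E (cinv c (pt x t))"
  assumes "admissible_contours h \<gamma>"
  defines "\<tau>\<^sub>M \<equiv> scalar_curvature (g c) 0"
    and "\<tau>\<^sub>N \<equiv> scalar_curvature (h 0) 0"
    and "H1 \<equiv> (\<kappa>1 + \<kappa>2) / 2"
    and "H2 \<equiv> \<kappa>1 * \<kappa>2"
    and "r0 \<equiv> real CARD('r)"
    and "TrE \<equiv> trace (endo_matrix \<pi> f E p)"
  shows "(\<exists>J. is_J2 h \<omega> e \<gamma> J) \<and>
    (\<forall>J. is_J2 h \<omega> e \<gamma> J \<longrightarrow> J analytic_on {0} \<and>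
       1/2 * J 0 =
         complex_of_real (1/2 * r0 *
           (\<tau>\<^sub>M / (32 * pi) + \<tau>\<^sub>N / (96 * pi) - H1\<^sup>2 / (32 * pi) + H2 / (32 * pi)))
         + 1 / (8 * pi) * TrE \<and>
       - deriv J 0 =
         complex_of_real (r0 *
           ((\<tau>\<^sub>M / (32 * pi) + \<tau>\<^sub>N / (96 * pi) - H1\<^sup>2 / (32 * pi) + H2 / (32 * pi)) * ln 2
            - 1 / (64 * pi) * (\<tau>\<^sub>M - \<tau>\<^sub>N) - 3 * H1\<^sup>2 / (128 * pi) + 5 * H2 / (128 * pi)))
         + ln 2 / (4 * pi) * TrE)"
proof -
  note bn = boundary_normal_chart_metric[OF assms(3) assms(5) assms(9) assms(17)]
  have c: "c \<in> A" "p \<in> dom_of c" "cmap c p = 0" and G0: "tangential_metric (g c) 0 0 = mat 1"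
    using assms(17) by (auto simp: boundary_normal_chart_def adapted_chart_def slice_chart_def)
  have chart: "is_chart M c"
    using assms(3) c(1) by (simp add: smooth_structure_def)
  obtain V G1 G2 where V: "open V" "0 \<in> V" "V \<subseteq> cimg c"
    and pd_G: "\<And>y i j k. y \<in> V \<Longrightarrow> has_pd k (\<lambda>y. g c y $ i $ j) (G1 i j k y) y"
    and der_G1: "\<And>i j k. (G1 i j k has_derivative (\<lambda>v. \<Sum>l\<in>UNIV. v $ l * G2 i j k l)) (at 0)"
    and G2_comm: "\<And>i j k l. G2 i j k l = G2 i j l k"
    and cont_G: "\<And>i j. continuous_on V (\<lambda>y. g c y $ i $ j)"
    by (rule smooth_metric_jets[OF bn(3) bn(1) bn(2)]) (rule that)
  have inC: "y \<in> cimg c" if "y \<in> V" for y using V(3) that by (rule subsetD)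
  interpret B: normal_metric "g c" V G1 G2 \<kappa>1 \<kappa>2
  proof (rule normal_metric.intro)
    show "g c y $ i $ j = g c y $ j $ i" "v \<noteq> 0 \<Longrightarrow> 0 < v \<bullet> (g c y *v v)"
      "g c y $ 3 $ 3 = 1" "g c y $ 1 $ 3 = 0" "g c y $ 2 $ 3 = 0" if "y \<in> V" for y i j v
      by (rule bn(4-8)[OF inC[OF that]] | assumption)+
    show "(\<Sum>a\<in>UNIV. \<Sum>b\<in>UNIV. christoffel (tangential_metric (g c) 0) d a b x * x $ a * x $ b) = 0"
      if "pt x 0 \<in> V" for d x using inC[OF that] by (rule bn(9))
  qed (rule V pd_G der_G1 G2_comm cont_G G0 assms(20) assms(21) | assumption)+
  \<comment> \<open>The base point is interior to the chart image and the frame domain is open, so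
    smoothness of the connection matrices yields genuine partial derivatives at the origin.\<close>
  have W1: "has_pd i (w c f j) (pd i (w c f j) 0) 0" for i j
  proof -
    have "\<exists>D. has_pd i (w c f j) D 0"
    proof (rule smooth_on_has_pd)
      show "smooth_on (w c f j) (cmap c ` (dom_of c \<inter> fst f))"
        using assms(12,18) c(1) by (simp add: connection_def)
      have "openin M (fst f)" using assms(10,18) by (simp add: vector_bundle_def)
      then show "open (cmap c ` (dom_of c \<inter> fst f))" by (rule chart_image_open[OF chart bn(1)])
      show "0 \<in> cmap c ` (dom_of c \<inter> fst f)" using c assms(19) by force
    qed
    then show ?thesis using pd_eq by metis
  qed
  interpret S: dn_symbol_normal h "w c f" e V B.u B.u1 B.u2 B.L1 B.L2 B.A B.A1 "\<lambda>j i. pd i (w c f j) 0" \<kappa>1 \<kappa>2 B.K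
    "2 * (\<kappa>1 + \<kappa>2)\<^sup>2 - 4 * \<kappa>1 * \<kappa>2 - (G2 1 1 3 3 + G2 2 2 3 3) / 2"
    unfolding h_def by (rule B.dn_symbol_normal[OF W1])
  have e0: "trace (e 0 0) = TrE"
    using cinv_cmap[OF chart c(2)] c(3) by (simp add: e_def TrE_def)
  have adm: "admissible_contours h \<gamma>" by fact
  \<comment> \<open>The coefficients of the profile are found by unification with the closed form of
    the trace; \<open>eqs\<close> below brings their sums into the shape of the algebraic
    lemma.\<close>
  note J2 = is_J2_profile[where h = h and w = \<omega> and e = e and \<gamma> = \<gamma>, unfolded \<omega>_def,
      OF adm S.root1_rho S.trace_r_minus3_normal, folded \<omega>_def]
  define n where "n = complex_of_nat CARD('r)"
  define T where "T = G2 1 1 3 3 + G2 2 2 3 3"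
  define Q where "Q = S.Q11 + S.Q22"
  let ?c = "n / 2 * of_real ((\<kappa>1 + \<kappa>2)\<^sup>2 / 2 - (2 * (\<kappa>1 + \<kappa>2)\<^sup>2 - 4 * \<kappa>1 * \<kappa>2 - T / 2)) - Q - TrE"
  let ?m = "n / 2 * of_real ((B.u2 1 1 3 3 + B.u2 2 2 3 3) / 2 - 2 * B.K / 3) + Q"
  let ?k = "n * of_real (- 15/4 * (\<kappa>1\<^sup>2 + \<kappa>2\<^sup>2) - 5/2 * (\<kappa>1 * \<kappa>2))"
  let ?b = "n * of_real (4 * B.K / 3) - 4 * Q"
  have v: "B.u2 1 1 3 3 + B.u2 2 2 3 3 = 8 * (\<kappa>1\<^sup>2 + \<kappa>2\<^sup>2) - T"
    by (simp add: B.u2_normal T_def)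
  have eqs: "n / 2 * of_real ((\<kappa>1 + \<kappa>2)\<^sup>2 / 2 - (2 * (\<kappa>1 + \<kappa>2)\<^sup>2 - 4 * \<kappa>1 * \<kappa>2 - (G2 1 1 3 3 + G2 2 2 3 3) / 2))
        - (S.Q11 + S.Q22) - trace (e 0 0) = ?c"
    "n / 2 * of_real (B.u2 1 1 3 3 / 2 - B.K / 3) + S.Q11 + (n / 2 * of_real (B.u2 2 2 3 3 / 2 - B.K / 3) + S.Q22) = ?m"
    "3 * (- 5/4 * n * of_real (\<kappa>1\<^sup>2)) + - 5/2 * n * of_real (\<kappa>1 * \<kappa>2) + 3 * (- 5/4 * n * of_real (\<kappa>2\<^sup>2)) = ?k"
    "n * of_real (2 * B.K / 3) - 4 * S.Q11 + (n * of_real (2 * B.K / 3) - 4 * S.Q22) = ?b"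
    by (simp_all add: e0 Q_def T_def field_simps)
  \<comment> \<open>Agreement on a neighbourhood of 0, rather than at 0 alone, is what transfers
    analyticity and the derivative to \<open>J\<close>.\<close>
  have F: "eventually (\<lambda>s. J s = J2_profile ?c ?m ?k ?b s) (nhds 0)" if "is_J2 h \<omega> e \<gamma> J" for J
    by (rule back_subst[of "\<lambda>F. eventually (\<lambda>s. J s = F s) (nhds 0)", OF J2(2)[OF _ that]])
       (assumption, simp only: n_def[symmetric] eqs)
  have tau: "\<tau>\<^sub>M = 2 * B.K + 2 * (\<kappa>1\<^sup>2 + \<kappa>2\<^sup>2) - T - 2 * \<kappa>1 * \<kappa>2" "\<tau>\<^sub>N = 2 * B.K"
    by (simp_all add: \<tau>\<^sub>M_def \<tau>\<^sub>N_def h_def B.scalar_curvature_ambient B.scalar_curvature_slice T_def)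
  have n: "n = complex_of_real r0" by (simp add: n_def r0_def)
  have value_0: "J2_profile ?c ?m ?k ?b 0 = n * of_real (\<tau>\<^sub>M / (32 * pi) + \<tau>\<^sub>N / (96 * pi)
      - H1\<^sup>2 / (32 * pi) + H2 / (32 * pi)) + TrE / (4 * pi)"
    unfolding J2_profile_0 tau H1_def H2_def by (rule J2_profile_coefficients(1)[OF v])
  have deriv_0: "deriv (J2_profile ?c ?m ?k ?b) 0 = - ln 2 * J2_profile ?c ?m ?k ?b 0
      + n * of_real (1 / (64 * pi) * (\<tau>\<^sub>M - \<tau>\<^sub>N) + 3 * H1\<^sup>2 / (128 * pi) - 5 * H2 / (128 * pi))"
    unfolding deriv_J2_profile_0 tau H1_def H2_def
    by (rule arg_cong2[where f = "(+)", OF refl J2_profile_coefficients(2)[OF v]])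
  show ?thesis
  proof (intro conjI allI impI)
    show "\<exists>J. is_J2 h \<omega> e \<gamma> J" by (rule J2(1))
    fix J assume J: "is_J2 h \<omega> e \<gamma> J"
    have an: "J2_profile ?c ?m ?k ?b analytic_on {0}" by (rule J2_profile_analytic) auto
    show "J analytic_on {0}"
      using an analytic_at_cong[OF F[OF J] refl] by simp
    have J0: "J 0 = J2_profile ?c ?m ?k ?b 0"
      using F[OF J] by (rule eventually_nhds_x_imp_x)
    have J1: "deriv J 0 = deriv (J2_profile ?c ?m ?k ?b) 0"
      using F[OF J] by (rule deriv_cong_ev) simp
    have ln2: "ln 2 = complex_of_real (ln 2)" using Ln_of_real[of 2] by simp
    show "1/2 * J 0 = complex_of_real (1/2 * r0 *
           (\<tau>\<^sub>M / (32 * pi) + \<tau>\<^sub>N / (96 * pi) - H1\<^sup>2 / (32 * pi) + H2 / (32 * pi)))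
         + 1 / (8 * pi) * TrE"
      unfolding J0 value_0 unfolding n by (simp add: algebra_simps)
    show "- deriv J 0 = complex_of_real (r0 *
           ((\<tau>\<^sub>M / (32 * pi) + \<tau>\<^sub>N / (96 * pi) - H1\<^sup>2 / (32 * pi) + H2 / (32 * pi)) * ln 2
            - 1 / (64 * pi) * (\<tau>\<^sub>M - \<tau>\<^sub>N) - 3 * H1\<^sup>2 / (128 * pi) + 5 * H2 / (128 * pi)))
         + ln 2 / (4 * pi) * TrE"
      unfolding J1 deriv_0 value_0 unfolding n ln2 by (simp add: algebra_simps)
  qed
qed

end
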